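(* Let $\mathcal{A}$ and $\mathcal{B}$ be linearly ordered $\mathbb{Z}_2$-graded sets, each at most countable. Then $$\mathscr{Q}(\mathbf{x}_{\mathcal{A}})\,\mathscr{P}(\mathbf{x}_{\mathcal{B}})=\mathscr{P}(\mathbf{x}_{\mathcal{B}})\,\mathscr{Q}(\mathbf{x}_{\mathcal{A}})\,\frac{\prod_{|a|\neq|b|}(1+t\,x_ax_b)}{\prod_{|a|=|b|}(1-t\,x_ax_b)},$$ where the products run over $a\in\mathcal{A}$, $b\in\mathcal{B}$ (an identity of formal power series in $\mathbf{x}_{\mathcal{A}},\mathbf{x}_{\mathcal{B}}$ with coefficients in $\widehat{\mathscr{U}(t)}$).
   Context: A $\mathbb{Z}_2$-graded set is $\mathcal{A}=\mathcal{A}_0\sqcup\mathcal{A}_1$; $|a|=\epsilon$ for $a\in\mathcal{A}_\epsilon$. $\mathbf{x}_{\mathcal{A}}=\{x_a\}_{a\in\mathcal{A}}$ and $\mathbf{x}_{\mathcal{B}}=\{x_b\}_{b\in\mathcal{B}}$ are sets of commuting formal variables, commuting with each other and with all $u_i,u_{i^\vee}$. $\mathbb{N}^\vee=\{i^\vee:i\in\mathbb{N}\}$ with $i^\vee<j^\vee$ iff $i>j$. $\mathscr{U}(t)$ is the associative unital $\mathbb{Q}[t,t^{-1}]$-algebra ($t$ an indeterminate) generated by $u_i,u_{i^\vee}$ ($i\in\mathbb{N}=\{1,2,\dots\}$) with relations: $u_iu_ju_k=u_iu_ku_j$ and $u_{k^\vee}u_{j^\vee}u_{i^\vee}=u_{j^\vee}u_{k^\vee}u_{i^\vee}$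 for $j\le i<k$; $u_iu_ju_k=u_ju_iu_k$ and $u_{k^\vee}u_{j^\vee}u_{i^\vee}=u_{k^\vee}u_{i^\vee}u_{j^\vee}$ for $j<k\le i$; $u_{i+1}u_{(i+1)^\vee}=u_{i^\vee}u_i$ for $i\ge1$; $u_1u_{1^\vee}=t$; $u_iu_{j^\vee}=u_{j^\vee}u_i$ for $i\ne j$. Completion. For partitions $\mu,\nu$, $\mathcal{B}_\mu$ is the set of semistandard tableaux of shape $\mu$ with entries in $\mathbb{N}$; for a tableau $T$, $T^\vee$ is obtained by rotating $T$ by $180^\circ$ and replacing each entry $a$ by $a^\vee$ (with $(a^\vee)^\vee=a$), and $\mathcal{B}_\nu^\vee=\{T^\vee : T\in\mathcal{B}_\nu\}$. $\mathcal{B}_{\mu,\nu}$ is the set of $(S,T)\in\mathcal{B}_\mu\times\mathcal{B}_\nu^\vee$ such that $|\{i: S(i,1)\le k\}|+|\{i: T^\vee(i,1)\le k\}|\le k$ for all $k\ge1$, and $u_{(S,T)}=u_Su_T$ where $u_S,u_T$ are the products of generators along the column words (columns read from right to left, each from top to bottom). The elements $u_{(S,T)}$ form a $\mathbb{Q}[t,t^{-1}]$-basis of $\mathscr{U}(t)$. $\widehat{\mathscr{U}(t)}=\bigoplus_{n\ge0}\widehat{\mathscr{U}(t)}_n$, where $\widehat{\mathscr{U}(t)}_n$ is the completion (arbitrary infinite formal linear combinations) of $\bigoplus_{|\mu|+|\nu|=n}\bigoplus_{(S,T)\in\mathcal{B}_{\mu,\nu}}\mathbb{Q}[t,t^{-1}]u_{(S,T)}$.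 Cauchy products: $\mathscr{Q}(\mathbf{x}_{\mathcal{A}})=\overrightarrow{\prod}_{a\in\mathcal{A}}\mathscr{Q}(x_a)$ and $\mathscr{P}(\mathbf{x}_{\mathcal{B}})=\overrightarrow{\prod}_{b\in\mathcal{B}}\mathscr{P}(x_b)$, products taken in the linear order with smaller terms to the left, where $$\mathscr{Q}(x_a)=\begin{cases}\cdots(1-u_2x_a)^{-1}(1-u_1x_a)^{-1}, & |a|=0,\\ (1+u_1x_a)(1+u_2x_a)\cdots, & |a|=1,\end{cases}$$ $$\mathscr{P}(x_b)=\begin{cases}(1-u_{1^\vee}x_b)^{-1}(1-u_{2^\vee}x_b)^{-1}\cdots, & |b|=0,\\ \cdots(1+u_{2^\vee}x_b)(1+u_{1^\vee}x_b), & |b|=1.\end{cases}$$ Products of series are computed termwise; for each monomial in the $x$'s and each basis element $u_{(S,T)}$ only finitely many terms contribute. *)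

theory Defs
  imports
    "HOL-Library.Poly_Mapping"
    "HOL-Library.Z2"
    "HOL-Library.Countable_Set"
    "HOL-Library.Groups_Big_Fun"
    "HOL-Computational_Algebra.Formal_Power_Series"
begin

section \<open>The algebra\<close>

text \<open>\<open>\<rat>[t, t\<^sup>-\<^sup>1]\<close> is the group algebra of the additive group of integers.\<close>

type_synonym laurent = "int \<Rightarrow>\<^sub>0 rat"

definition t_laurent :: laurent where
  "t_laurent = Poly_Mapping.single 1 1"

text \<open>The generators are indexed by \<open>{1, 2, \<dots>}\<close>; \<open>Gen i\<close> stands for \<open>u\<^sub>i\<close>
  and \<open>Dual i\<close> for \<open>u\<^sub>j\<close> with \<open>j = i\<^sup>\<or>\<close>.\<close>

datatype letter = Gen nat | Dual nat

fun letter_index :: "letter \<Rightarrow> nat" where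
  "letter_index (Gen i) = i"
| "letter_index (Dual i) = i"

typedef gword = "{w :: letter list. \<forall>l\<in>set w. letter_index l \<ge> 1}"
  by (rule exI[of _ "[]"]) simp

setup_lifting type_definition_gword

instantiation gword :: monoid_add
begin

lift_definition zero_gword :: gword is "[]" by simp

lift_definition plus_gword :: "gword \<Rightarrow> gword \<Rightarrow> gword" is "(@)" by auto

instance by standard (transfer; simp)+

end

type_synonym free_alg = "gword \<Rightarrow>\<^sub>0 laurent"

text \<open>Only used for positive indices.\<close>

definition free_gen :: "letter \<Rightarrow> free_alg" where
  "free_gen l = Poly_Mapping.single (Abs_gword [l]) 1"

definition free_scalar :: "laurent \<Rightarrow> free_alg" where
  "free_scalar c = Poly_Mapping.single 0 c"

abbreviation (input) "fu i \<equiv> free_gen (Gen i)"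
abbreviation (input) "fv i \<equiv> free_gen (Dual i)"

inductive def_rel :: "free_alg \<Rightarrow> free_alg \<Rightarrow> bool" where
  "\<lbrakk>1 \<le> j; j \<le> i; i < k\<rbrakk> \<Longrightarrow> def_rel (fu i * fu j * fu k) (fu i * fu k * fu j)"
| "\<lbrakk>1 \<le> j; j \<le> i; i < k\<rbrakk> \<Longrightarrow> def_rel (fv k * fv j * fv i) (fv j * fv k * fv i)"
| "\<lbrakk>1 \<le> j; j < k; k \<le> i\<rbrakk> \<Longrightarrow> def_rel (fu i * fu j * fu k) (fu j * fu i * fu k)"
| "\<lbrakk>1 \<le> j; j < k; k \<le> i\<rbrakk> \<Longrightarrow> def_rel (fv k * fv j * fv i) (fv k * fv i * fv j)"
| "1 \<le> i \<Longrightarrow> def_rel (fu (i + 1) * fv (i + 1)) (fv i * fu i)"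
| "def_rel (fu 1 * fv 1) (free_scalar t_laurent)"
| "\<lbrakk>1 \<le> i; 1 \<le> j; i \<noteq> j\<rbrakk> \<Longrightarrow> def_rel (fu i * fv j) (fv j * fu i)"

inductive_set rel_ideal :: "free_alg set" where
  zero: "0 \<in> rel_ideal"
| rel: "def_rel p q \<Longrightarrow> x * (p - q) * y \<in> rel_ideal"
| add: "x \<in> rel_ideal \<Longrightarrow> y \<in> rel_ideal \<Longrightarrow> x + y \<in> rel_ideal"

lemma rel_ideal_mult_left: "x \<in> rel_ideal \<Longrightarrow> z * x \<in> rel_ideal"
proof (induction rule: rel_ideal.induct)
  case (rel p q x y)
  then show ?case using rel_ideal.rel[of p q "z * x" y] by (simp add: mult.assoc)
qed (auto simp: distrib_left intro: rel_ideal.intros)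

lemma rel_ideal_mult_right: "x \<in> rel_ideal \<Longrightarrow> x * z \<in> rel_ideal"
proof (induction rule: rel_ideal.induct)
  case (rel p q x y)
  then show ?case using rel_ideal.rel[of p q x "y * z"] by (simp add: mult.assoc)
qed (auto simp: distrib_right intro: rel_ideal.intros)

lemma rel_ideal_uminus: "x \<in> rel_ideal \<Longrightarrow> - x \<in> rel_ideal"
  using rel_ideal_mult_left[of x "- 1"] by simp

lemma rel_ideal_diff: "x \<in> rel_ideal \<Longrightarrow> y \<in> rel_ideal \<Longrightarrow> x - y \<in> rel_ideal"
  using rel_ideal.add[of x "- y"] rel_ideal_uminus[of y] by simp

text \<open>The ideal is proper: it is killed by the homomorphism with \<open>u\<^sub>i \<mapsto> t\<close> and dual generators
  \<open>\<mapsto> 1\<close>.  This is needed for the class \<open>ring_1\<close>.\<close>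

definition count_gen :: "gword \<Rightarrow> nat" where
  "count_gen w = length (filter (\<lambda>l. \<exists>i. l = Gen i) (Rep_gword w))"

lemma count_gen_zero [simp]: "count_gen 0 = 0"
  by (simp add: count_gen_def zero_gword.rep_eq)

lemma count_gen_plus: "count_gen (v + w) = count_gen v + count_gen w"
  by (simp add: count_gen_def plus_gword.rep_eq)

definition aug :: "free_alg \<Rightarrow> laurent" where
  "aug x = (\<Sum>w\<in>Poly_Mapping.keys x. Poly_Mapping.lookup x w * t_laurent ^ count_gen w)"

lemma aug_superset:
  assumes "finite W" "Poly_Mapping.keys x \<subseteq> W"
  shows "aug x = (\<Sum>w\<in>W. Poly_Mapping.lookup x w * t_laurent ^ count_gen w)"
  unfolding aug_def using assms
  by (intro sum.mono_neutral_left) (auto simp: in_keys_iff)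

lemma aug_add: "aug (x + y) = aug x + aug y"
proof -
  let ?W = "Poly_Mapping.keys x \<union> Poly_Mapping.keys y"
  have "aug (x + y) = (\<Sum>w\<in>?W. Poly_Mapping.lookup (x + y) w * t_laurent ^ count_gen w)"
    by (rule aug_superset) (auto simp: Poly_Mapping.keys_add)
  also have "\<dots> = (\<Sum>w\<in>?W. Poly_Mapping.lookup x w * t_laurent ^ count_gen w)
      + (\<Sum>w\<in>?W. Poly_Mapping.lookup y w * t_laurent ^ count_gen w)"
    by (simp add: lookup_add distrib_right sum.distrib)
  also have "\<dots> = aug x + aug y"
    by (simp add: aug_superset[of ?W x] aug_superset[of ?W y])
  finally show ?thesis .
qed

lemma aug_single: "aug (Poly_Mapping.single w c) = c * t_laurent ^ count_gen w"
  by (subst aug_superset[of "{w}"]) auto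

lemma aug_zero [simp]: "aug 0 = 0"
  by (simp add: aug_def)

lemma aug_diff: "aug (x - y) = aug x - aug y"
  using aug_add[of "x - y" y] by simp

lemma aug_mult: "aug (x * y) = aug x * aug y"
proof (induction x rule: update_induct)
  case const
  then show ?case by simp
next
  case (update x v c)
  have x: "Poly_Mapping.update v c x = x + Poly_Mapping.single v c"
    using update(1) by (intro poly_mapping_eqI)
      (auto simp: lookup_update lookup_add lookup_single in_keys_iff)
  have "aug (Poly_Mapping.single v c * y) = aug (Poly_Mapping.single v c) * aug y"
  proof (induction y rule: update_induct)
    case const
    then show ?case by simp
  next
    case (update y w d)
    have y: "Poly_Mapping.update w d y = y + Poly_Mapping.single w d"
      using update(1) by (intro poly_mapping_eqI)
        (auto simp: lookup_update lookup_add lookup_single in_keys_iff)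
    show ?case
      by (simp add: y distrib_left aug_add update mult_single aug_single count_gen_plus
          power_add mult_ac)
  qed
  then show ?case
    by (simp add: x distrib_right aug_add update)
qed

lemma aug_fu: "i \<ge> 1 \<Longrightarrow> aug (fu i) = t_laurent"
  by (simp add: free_gen_def aug_single count_gen_def Abs_gword_inverse)

lemma aug_fv: "i \<ge> 1 \<Longrightarrow> aug (fv i) = 1"
  by (simp add: free_gen_def aug_single count_gen_def Abs_gword_inverse)

lemma aug_def_rel: "def_rel p q \<Longrightarrow> aug p = aug q"
  by (induction rule: def_rel.induct)
    (simp_all add: aug_mult aug_fu aug_fv free_scalar_def aug_single)

lemma aug_rel_ideal: "x \<in> rel_ideal \<Longrightarrow> aug x = 0"
  by (induction rule: rel_ideal.induct)
    (simp_all add: aug_mult aug_diff aug_def_rel aug_add)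

quotient_type ualg = free_alg / "\<lambda>x y. x - y \<in> rel_ideal"
proof (rule equivpI)
  show "reflp (\<lambda>x y. x - y \<in> rel_ideal)"
    by (auto intro!: reflpI rel_ideal.zero)
  show "symp (\<lambda>x y. x - y \<in> rel_ideal)"
  proof (rule sympI)
    fix x y :: free_alg
    assume "x - y \<in> rel_ideal"
    then show "y - x \<in> rel_ideal" using rel_ideal_uminus[of "x - y"] by simp
  qed
  show "transp (\<lambda>x y. x - y \<in> rel_ideal)"
  proof (rule transpI)
    fix x y z :: free_alg
    assume "x - y \<in> rel_ideal" "y - z \<in> rel_ideal"
    then show "x - z \<in> rel_ideal" using rel_ideal.add[of "x - y" "y - z"] by simp
  qed
qed

instantiation ualg :: ring_1
begin

lift_definition zero_ualg :: ualg is 0 .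
lift_definition one_ualg :: ualg is 1 .

lift_definition plus_ualg :: "ualg \<Rightarrow> ualg \<Rightarrow> ualg" is "(+)"
  subgoal for a b c d
    using rel_ideal.add[of "a - b" "c - d"] by (simp add: algebra_simps)
  done

lift_definition uminus_ualg :: "ualg \<Rightarrow> ualg" is uminus
  subgoal for a b
    using rel_ideal_uminus[of "a - b"] by simp
  done

lift_definition minus_ualg :: "ualg \<Rightarrow> ualg \<Rightarrow> ualg" is "(-)"
  subgoal for a b c d
    using rel_ideal_diff[of "a - b" "c - d"] by (simp add: algebra_simps)
  done

lift_definition times_ualg :: "ualg \<Rightarrow> ualg \<Rightarrow> ualg" is "(*)"
  subgoal for a b c d
    using rel_ideal.add[OF rel_ideal_mult_right[of "a - b" c] rel_ideal_mult_left[of "c - d" b]]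
    by (simp add: algebra_simps)
  done

instance
proof
  show "(0::ualg) \<noteq> 1"
  proof transfer
    show "\<not> (0::free_alg) - 1 \<in> rel_ideal"
    proof
      assume "(0::free_alg) - 1 \<in> rel_ideal"
      then have "aug (0 - 1) = 0" by (rule aug_rel_ideal)
      moreover have "aug 1 = 1"
        using aug_single[of 0 1] by simp
      ultimately show False using aug_diff[of 0 1] by simp
    qed
  qed
qed (transfer; simp add: algebra_simps rel_ideal.zero)+

end

definition scalar :: "laurent \<Rightarrow> ualg" where
  "scalar c = abs_ualg (free_scalar c)"

definition gen :: "letter \<Rightarrow> ualg" where
  "gen l = abs_ualg (free_gen l)"

abbreviation u_gen :: "nat \<Rightarrow> ualg" where "u_gen i \<equiv> gen (Gen i)"
abbreviation u_dual :: "nat \<Rightarrow> ualg" where "u_dual i \<equiv> gen (Dual i)"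


section \<open>The tableau basis and the completion\<close>

text \<open>A tableau is the list of its rows, top to bottom, left-justified.\<close>

type_synonym tableau = "nat list list"

definition shape :: "tableau \<Rightarrow> nat list" where
  "shape T = map length T"

definition partitions :: "nat list set" where
  "partitions = {\<mu>. sorted_wrt (\<ge>) \<mu> \<and> (\<forall>k\<in>set \<mu>. k \<ge> 1)}"

definition semistandard :: "tableau \<Rightarrow> bool" where
  "semistandard T \<longleftrightarrow>
     (\<forall>r\<in>set T. sorted r \<and> (\<forall>a\<in>set r. a \<ge> 1)) \<and>
     (\<forall>i j. Suc i < length T \<longrightarrow> j < length (T ! Suc i) \<longrightarrow> T ! i ! j < T ! Suc i ! j)"

definition tableaux :: "nat list \<Rightarrow> tableau set" where
  "tableaux \<mu> = {T. shape T = \<mu> \<and> semistandard T}"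

definition column_word :: "tableau \<Rightarrow> nat list" where
  "column_word S =
     concat (map (\<lambda>j. [r ! j. r \<leftarrow> S, j < length r]) (rev [0..<Max (insert 0 (set (shape S)))]))"

text \<open>A tableau in \<open>\<B>\<^sub>\<nu>\<^sup>\<or>\<close> is represented by its image \<open>T\<^sup>\<or>\<close> in \<open>\<B>\<^sub>\<nu>\<close>.
  The tableau \<open>T\<close> itself is \<open>rotate180 T\<^sup>\<or>\<close> with each entry \<open>a\<close> read as \<open>a\<^sup>\<or>\<close>; its rows
  are right-justified, so that its columns are counted from the right end of each row.\<close>

definition rotate180 :: "tableau \<Rightarrow> tableau" where
  "rotate180 T = rev (map rev T)"

definition column_word_right :: "tableau \<Rightarrow> nat list" where
  "column_word_right R =
     concat (map (\<lambda>j. [rev r ! j. r \<leftarrow> R, j < length r]) [0..<Max (insert 0 (set (shape R)))])"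

text \<open>The pair \<open>(S, T)\<close> is encoded as \<open>(S, T\<^sup>\<or>)\<close>.\<close>

type_synonym tableau_pair = "tableau \<times> tableau"

definition basis_pairs_of_shape :: "nat list \<Rightarrow> nat list \<Rightarrow> tableau_pair set" where
  "basis_pairs_of_shape \<mu> \<nu> = {(S, T). S \<in> tableaux \<mu> \<and> T \<in> tableaux \<nu> \<and>
     (\<forall>k\<ge>1. card {i. i < length S \<and> S ! i ! 0 \<le> k} + card {i. i < length T \<and> T ! i ! 0 \<le> k} \<le> k)}"

definition basis_pairs :: "tableau_pair set" where
  "basis_pairs = (\<Union>\<mu>\<in>partitions. \<Union>\<nu>\<in>partitions. basis_pairs_of_shape \<mu> \<nu>)"

definition pair_degree :: "tableau_pair \<Rightarrow> nat" where
  "pair_degree b = sum_list (shape (fst b)) + sum_list (shape (snd b))"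

definition u_pair :: "tableau_pair \<Rightarrow> ualg" where
  "u_pair b = prod_list (map u_gen (column_word (fst b)))
            * prod_list (map u_dual (column_word_right (rotate180 (snd b))))"

text \<open>Coordinates with respect to the basis \<open>u_pair b\<close>, \<open>b \<in> basis_pairs\<close>, of the
  \<open>\<rat>[t, t\<^sup>-\<^sup>1]\<close>-module \<open>ualg\<close>.\<close>

definition basis_coords :: "ualg \<Rightarrow> tableau_pair \<Rightarrow>\<^sub>0 laurent" where
  "basis_coords x =
     (THE c. Poly_Mapping.keys c \<subseteq> basis_pairs \<and> x = (\<Sum>b\<in>Poly_Mapping.keys c. scalar (Poly_Mapping.lookup c b) * u_pair b))"

text \<open>A formal linear combination of basis elements lies in the direct sum of the completed
  homogeneous components iff only finitely many degrees occur in it.\<close>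

typedef uhat = "{f :: tableau_pair \<Rightarrow> laurent.
    (\<forall>b. f b \<noteq> 0 \<longrightarrow> b \<in> basis_pairs) \<and> finite (pair_degree ` {b. f b \<noteq> 0})}"
  morphisms hcoeff Abs_uhat
  by (rule exI[of _ "\<lambda>_. 0"]) simp

setup_lifting type_definition_uhat

lemma uhat_eqI: "(\<And>b. hcoeff f b = hcoeff g b) \<Longrightarrow> f = g"
  by (metis ext hcoeff_inject)

lemma empty_in_basis_pairs: "([], []) \<in> basis_pairs"
  by (auto simp: basis_pairs_def basis_pairs_of_shape_def partitions_def tableaux_def
      shape_def semistandard_def intro!: bexI[of _ "[]"])

text \<open>The empty pair indexes the basis element \<open>1\<close>.\<close>

definition hat_scalar :: "laurent \<Rightarrow> uhat" where
  "hat_scalar c = Abs_uhat (\<lambda>b. if b = ([], []) then c else 0)"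

lemma hcoeff_hat_scalar: "hcoeff (hat_scalar c) b = (if b = ([], []) then c else 0)"
proof -
  have "{b :: tableau_pair. (if b = ([], []) then c else 0) \<noteq> 0} \<subseteq> {([], [])}" by auto
  then have "finite (pair_degree ` {b. (if b = ([], []) then c else 0) \<noteq> 0})"
    by (meson finite.emptyI finite.insertI finite_imageI finite_subset)
  then show ?thesis
    unfolding hat_scalar_def using empty_in_basis_pairs by (subst Abs_uhat_inverse) auto
qed

instantiation uhat :: "{ab_group_add, one, times}"
begin

lift_definition zero_uhat :: uhat is "\<lambda>_. 0" by simp

lift_definition plus_uhat :: "uhat \<Rightarrow> uhat \<Rightarrow> uhat" is "\<lambda>f g b. f b + g b"
proof -
  fix f g :: "tableau_pair \<Rightarrow> laurent"
  assume *: "(\<forall>b. f b \<noteq> 0 \<longrightarrow> b \<in> basis_pairs) \<and> finite (pair_degree ` {b. f b \<noteq> 0})"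
    "(\<forall>b. g b \<noteq> 0 \<longrightarrow> b \<in> basis_pairs) \<and> finite (pair_degree ` {b. g b \<noteq> 0})"
  have "pair_degree ` {b. f b + g b \<noteq> 0} \<subseteq> pair_degree ` {b. f b \<noteq> 0} \<union> pair_degree ` {b. g b \<noteq> 0}"
    by (auto intro!: imageI)
  then have "finite (pair_degree ` {b. f b + g b \<noteq> 0})"
    by (rule finite_subset) (use * in simp)
  then show "?thesis f g" using * by (metis add_0)
qed

lift_definition uminus_uhat :: "uhat \<Rightarrow> uhat" is "\<lambda>f b. - f b" by simp

definition minus_uhat :: "uhat \<Rightarrow> uhat \<Rightarrow> uhat" where
  "minus_uhat f g = f + - g"

definition one_uhat :: uhat where
  "one_uhat = hat_scalar 1"

text \<open>Termwise product; \<open>Sum_any\<close> is the sum over the finitely many nonzero terms.\<close>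

definition times_uhat :: "uhat \<Rightarrow> uhat \<Rightarrow> uhat" where
  "times_uhat f g = Abs_uhat (\<lambda>b. Sum_any (\<lambda>(b1, b2).
     hcoeff f b1 * hcoeff g b2 * Poly_Mapping.lookup (basis_coords (u_pair b1 * u_pair b2)) b))"

instance
  by standard (rule uhat_eqI; simp add: minus_uhat_def plus_uhat.rep_eq uminus_uhat.rep_eq
      zero_uhat.rep_eq algebra_simps)+

end


section \<open>Formal power series in arbitrarily many commuting variables\<close>

typedef ('v, 'c) mps = "UNIV :: (('v \<Rightarrow>\<^sub>0 nat) \<Rightarrow> 'c) set"
  morphisms mcoeff Abs_mps ..

setup_lifting type_definition_mps

lemma mps_eqI: "(\<And>m. mcoeff F m = mcoeff G m) \<Longrightarrow> F = G"
  by (metis ext mcoeff_inject)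

lemma finite_monomial_splits: "finite {(p, q). p + q = (m :: 'v \<Rightarrow>\<^sub>0 nat)}"
proof -
  define N where "N = {f :: 'v \<Rightarrow> nat. \<forall>x. (x \<in> Poly_Mapping.keys m \<longrightarrow> f x \<in> {..Max (Poly_Mapping.lookup m ` Poly_Mapping.keys m)})
    \<and> (x \<notin> Poly_Mapping.keys m \<longrightarrow> f x = 0)}"
  have N: "finite N"
    unfolding N_def by (rule finite_set_of_finite_funs) auto
  have "Poly_Mapping.lookup p \<in> N \<and> Poly_Mapping.lookup q \<in> N" if "p + q = m" for p q
  proof -
    have eq: "Poly_Mapping.lookup m x = Poly_Mapping.lookup p x + Poly_Mapping.lookup q x" for x
      using that by (auto simp: lookup_add)
    have "Poly_Mapping.lookup p x \<le> Max (Poly_Mapping.lookup m ` Poly_Mapping.keys m) \<and> Poly_Mapping.lookup q x \<le> Max (Poly_Mapping.lookup m ` Poly_Mapping.keys m)"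
      if "x \<in> Poly_Mapping.keys m" for x
    proof -
      have "Poly_Mapping.lookup m x \<le> Max (Poly_Mapping.lookup m ` Poly_Mapping.keys m)" using that by simp
      then show ?thesis by (simp add: eq)
    qed
    moreover have "Poly_Mapping.lookup p x = 0 \<and> Poly_Mapping.lookup q x = 0" if "x \<notin> Poly_Mapping.keys m" for x
      using that eq[of x] by (simp add: in_keys_iff)
    ultimately show ?thesis by (auto simp: N_def)
  qed
  then have "{(p, q). p + q = m} \<subseteq> (Poly_Mapping.lookup -` N) \<times> (Poly_Mapping.lookup -` N)" by auto
  moreover have "finite (Poly_Mapping.lookup -` N :: ('v \<Rightarrow>\<^sub>0 nat) set)"
    by (rule finite_vimageI[OF N]) (auto intro: injI poly_mapping_eqI)
  ultimately show ?thesis by (meson finite_SigmaI finite_subset)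
qed

instantiation mps :: (type, zero) zero
begin
lift_definition zero_mps :: "('a, 'b) mps" is "\<lambda>_. 0" .
instance ..
end

instantiation mps :: (type, "{zero, one}") one
begin
lift_definition one_mps :: "('a, 'b) mps" is "\<lambda>m. if m = 0 then 1 else 0" .
instance ..
end

instantiation mps :: (type, plus) plus
begin
lift_definition plus_mps :: "('a, 'b) mps \<Rightarrow> ('a, 'b) mps \<Rightarrow> ('a, 'b) mps" is "\<lambda>F G m. F m + G m" .
instance ..
end

instantiation mps :: (type, minus) minus
begin
lift_definition minus_mps :: "('a, 'b) mps \<Rightarrow> ('a, 'b) mps \<Rightarrow> ('a, 'b) mps" is "\<lambda>F G m. F m - G m" .
instance ..
end

instantiation mps :: (type, uminus) uminus
begin
lift_definition uminus_mps :: "('a, 'b) mps \<Rightarrow> ('a, 'b) mps" is "\<lambda>F m. - F m" .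
instance ..
end

instantiation mps :: (type, "{comm_monoid_add, times}") times
begin
lift_definition times_mps :: "('a, 'b) mps \<Rightarrow> ('a, 'b) mps \<Rightarrow> ('a, 'b) mps" is
  "\<lambda>F G m. \<Sum>(p, q)\<in>{(p, q). p + q = m}. F p * G q" .
instance ..
end

instance mps :: (type, ab_group_add) ab_group_add
  by standard (transfer; auto simp: fun_eq_iff algebra_simps)+

lemma mps_mult_assoc:
  fixes F G H :: "('v, 'c::semiring_0) mps"
  shows "F * G * H = F * (G * H)"
proof (rule mps_eqI)
  fix m :: "'v \<Rightarrow>\<^sub>0 nat"
  let ?S = "\<lambda>m :: 'v \<Rightarrow>\<^sub>0 nat. {(p, q). p + q = m}"
  let ?t = "\<lambda>p q r. mcoeff F p * mcoeff G q * mcoeff H r"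
  have "mcoeff (F * G * H) m = (\<Sum>x\<in>?S m. \<Sum>y\<in>?S (fst x). ?t (fst y) (snd y) (snd x))"
    by (simp add: times_mps.rep_eq sum_distrib_right case_prod_unfold)
  also have "\<dots> = (\<Sum>(x, y)\<in>Sigma (?S m) (\<lambda>x. ?S (fst x)). ?t (fst y) (snd y) (snd x))"
    using finite_monomial_splits by (subst sum.Sigma) auto
  also have "\<dots> = (\<Sum>(x, y)\<in>Sigma (?S m) (\<lambda>x. ?S (snd x)). ?t (fst x) (fst y) (snd y))"
    by (rule sum.reindex_bij_witness[where
          i = "\<lambda>(x, y). ((fst x + fst y, snd y), (fst x, fst y))" and
          j = "\<lambda>(x, y). ((fst y, snd y + snd x), (snd y, snd x))"])
      (auto simp: add.assoc)
  also have "\<dots> = (\<Sum>x\<in>?S m. \<Sum>y\<in>?S (snd x). ?t (fst x) (fst y) (snd y))"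
    using finite_monomial_splits by (subst sum.Sigma) auto
  also have "\<dots> = mcoeff (F * (G * H)) m"
    by (simp add: times_mps.rep_eq sum_distrib_left case_prod_unfold mult.assoc)
  finally show "mcoeff (F * G * H) m = mcoeff (F * (G * H)) m" .
qed

lemma mps_mult_commute:
  fixes F G :: "('v, 'c::comm_semiring_0) mps"
  shows "F * G = G * F"
proof (rule mps_eqI)
  fix m :: "'v \<Rightarrow>\<^sub>0 nat"
  show "mcoeff (F * G) m = mcoeff (G * F) m"
    unfolding times_mps.rep_eq
    by (rule sum.reindex_bij_witness[where i = prod.swap and j = prod.swap])
      (auto simp: add.commute mult.commute)
qed

lemma mps_mult_1_left:
  fixes F :: "('v, 'c::semiring_1) mps"
  shows "1 * F = F"
proof (rule mps_eqI)
  fix m :: "'v \<Rightarrow>\<^sub>0 nat"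
  have "mcoeff (1 * F) m = (\<Sum>(p, q)\<in>{(0 :: 'v \<Rightarrow>\<^sub>0 nat, m)}. mcoeff 1 p * mcoeff F q)"
    unfolding times_mps.rep_eq
    by (rule sum.mono_neutral_right[OF finite_monomial_splits])
      (auto simp: one_mps.rep_eq split: if_splits)
  then show "mcoeff (1 * F) m = mcoeff F m" by (simp add: one_mps.rep_eq)
qed

lemma mps_distrib_right:
  fixes F G H :: "('v, 'c::semiring_0) mps"
  shows "(F + G) * H = F * H + G * H"
  by (rule mps_eqI)
    (simp add: times_mps.rep_eq plus_mps.rep_eq distrib_right sum.distrib case_prod_unfold)

instance mps :: (type, comm_ring_1) comm_ring_1
proof
  show "(0 :: ('a, 'b) mps) \<noteq> 1"
    by transfer (metis zero_neq_one)
qed (simp_all add: mps_mult_assoc mps_mult_1_left mps_distrib_right, rule mps_mult_commute)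

text \<open>Inverses are unique; \<open>inverse F\<close> is only used for units.\<close>

instantiation mps :: (type, comm_ring_1) inverse
begin

definition inverse_mps :: "('a, 'b) mps \<Rightarrow> ('a, 'b) mps" where
  "inverse_mps F = (THE G. F * G = 1)"

definition divide_mps :: "('a, 'b) mps \<Rightarrow> ('a, 'b) mps \<Rightarrow> ('a, 'b) mps" where
  "divide_mps F G = F * inverse G"

instance ..

end

definition mps_const :: "'c::zero \<Rightarrow> ('v, 'c) mps" where
  "mps_const c = Abs_mps (\<lambda>m. if m = 0 then c else 0)"

definition mps_var :: "'v \<Rightarrow> ('v, 'c::{zero, one}) mps" where
  "mps_var v = Abs_mps (\<lambda>m. if m = Poly_Mapping.single v 1 then 1 else 0)"

definition mps_map :: "('c \<Rightarrow> 'd) \<Rightarrow> ('v, 'c) mps \<Rightarrow> ('v, 'd) mps" where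
  "mps_map h F = Abs_mps (\<lambda>m. h (mcoeff F m))"

text \<open>The series \<open>\<Sum>n. c n * v ^ n\<close> in the single variable \<open>v\<close>.\<close>

definition mps_univariate :: "'v \<Rightarrow> (nat \<Rightarrow> 'c::zero) \<Rightarrow> ('v, 'c) mps" where
  "mps_univariate v c = Abs_mps (\<lambda>m. if Poly_Mapping.keys m \<subseteq> {v} then c (Poly_Mapping.lookup m v) else 0)"


section \<open>Infinite products\<close>

text \<open>Limit with respect to the discrete topology.\<close>

definition stable_value :: "'i filter \<Rightarrow> ('i \<Rightarrow> 'c) \<Rightarrow> 'c" where
  "stable_value F f = (THE c. eventually (\<lambda>i. f i = c) F)"

definition mps_prod :: "'i set \<Rightarrow> ('i \<Rightarrow> ('v, 'c::comm_ring_1) mps) \<Rightarrow> ('v, 'c) mps" where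
  "mps_prod I f = Abs_mps (\<lambda>m.
     stable_value (finite_subsets_at_top I) (\<lambda>J. mcoeff (\<Prod>i\<in>J. f i) m))"

text \<open>Product in increasing order from left to right.  The factors used below have constant
  term \<open>1\<close> and involve disjoint sets of variables, so each coefficient stabilises,
  whatever the order type of \<open>I\<close>.\<close>

definition mps_ordered_prod ::
    "'i::linorder set \<Rightarrow> ('i \<Rightarrow> ('v, 'c::{comm_monoid_add, one, times}) mps) \<Rightarrow> ('v, 'c) mps" where
  "mps_ordered_prod I f = Abs_mps (\<lambda>m.
     stable_value (finite_subsets_at_top I)
       (\<lambda>J. mcoeff (foldr (\<lambda>i F. f i * F) (sorted_list_of_set J) 1) m))"

text \<open>Limit of a sequence of power series over \<open>ualg\<close> as a power series over the completion:
  for every power \<open>n\<close> of the variable and every basis element \<open>b\<close> the coefficient stabilises.\<close>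

definition hat_limit :: "(nat \<Rightarrow> ualg fps) \<Rightarrow> nat \<Rightarrow> uhat" where
  "hat_limit F n = Abs_uhat (\<lambda>b.
     stable_value sequentially (\<lambda>N. Poly_Mapping.lookup (basis_coords (fps_nth (F N) n)) b))"


section \<open>Cauchy products\<close>

definition lin_factor :: "ualg \<Rightarrow> ualg fps" where
  "lin_factor w = 1 + fps_const w * fps_X"

text \<open>\<open>(1 - w x)\<^sup>-\<^sup>1\<close>.\<close>

definition inv_factor :: "ualg \<Rightarrow> ualg fps" where
  "inv_factor w = fps_right_inverse (1 - fps_const w * fps_X) 1"

lemma inv_factor:
  "(1 - fps_const w * fps_X) * inv_factor w = 1"
  "inv_factor w * (1 - fps_const w * fps_X) = 1"
proof -
  show *: "(1 - fps_const w * fps_X) * inv_factor w = 1"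
    unfolding inv_factor_def by (rule fps_right_inverse) simp
  let ?L = "fps_left_inverse (1 - fps_const w * fps_X) 1"
  have L: "?L * (1 - fps_const w * fps_X) = 1"
    by (rule fps_left_inverse) simp
  have "?L = ?L * ((1 - fps_const w * fps_X) * inv_factor w)"
    by (simp only: * mult_1_right)
  also have "\<dots> = inv_factor w"
    by (simp only: mult.assoc[symmetric] L mult_1_left)
  finally have "?L = inv_factor w" .
  then show "inv_factor w * (1 - fps_const w * fps_X) = 1" using L by (simp only:)
qed

definition Q_var :: "bit \<Rightarrow> nat \<Rightarrow> uhat" where
  "Q_var \<epsilon> = (if \<epsilon> = 0
     then hat_limit (\<lambda>N. prod_list (map (\<lambda>i. inv_factor (u_gen i)) (rev [1..<Suc N])))
     else hat_limit (\<lambda>N. prod_list (map (\<lambda>i. lin_factor (u_gen i)) [1..<Suc N])))"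

definition P_var :: "bit \<Rightarrow> nat \<Rightarrow> uhat" where
  "P_var \<epsilon> = (if \<epsilon> = 0
     then hat_limit (\<lambda>N. prod_list (map (\<lambda>i. inv_factor (u_dual i)) [1..<Suc N]))
     else hat_limit (\<lambda>N. prod_list (map (\<lambda>i. lin_factor (u_dual i)) (rev [1..<Suc N]))))"

text \<open>A \<open>\<int>\<^sub>2\<close>-graded set is a set \<open>A\<close> with a degree function into \<open>bit\<close>.  The variables
  are \<open>Inl a\<close> for \<open>x\<^sub>a\<close> and \<open>Inr b\<close> for \<open>x\<^sub>b\<close>.\<close>

definition cauchy_Q :: "'a::linorder set \<Rightarrow> ('a \<Rightarrow> bit) \<Rightarrow> ('a + 'b, uhat) mps" where
  "cauchy_Q A deg = mps_ordered_prod A (\<lambda>a. mps_univariate (Inl a) (Q_var (deg a)))"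

definition cauchy_P :: "'b::linorder set \<Rightarrow> ('b \<Rightarrow> bit) \<Rightarrow> ('a + 'b, uhat) mps" where
  "cauchy_P B deg = mps_ordered_prod B (\<lambda>b. mps_univariate (Inr b) (P_var (deg b)))"

text \<open>\<open>t x\<^sub>a x\<^sub>b\<close>.\<close>

definition t_xx :: "'a \<times> 'b \<Rightarrow> ('a + 'b, laurent) mps" where
  "t_xx = (\<lambda>(a, b). mps_const t_laurent * mps_var (Inl a) * mps_var (Inr b))"

end

theory Submission
  imports Defs
begin

text \<open>Write \<open>c\<^sub>i = u\<^sub>i v\<^sub>i\<close>, where \<open>v\<^sub>i\<close> is the dual of \<open>u\<^sub>i\<close>.  The mixed relations say \<open>c\<^sub>1 = t\<close>
  and \<open>v\<^sub>i u\<^sub>i = c\<^sub>i\<^sub>+\<^sub>1\<close>.  For any two elements \<open>u\<close>, \<open>v\<close> of a ring and central \<open>x\<close>, \<open>y\<close>,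
  expanding both sides gives
  \<open>(1 + u x) (1 - v u x y)\<^sup>-\<^sup>1 (1 + v y) = (1 + v y) (1 - u v x y)\<^sup>-\<^sup>1 (1 + u x)\<close>.
  Because \<open>u\<^sub>i\<close> commutes with \<open>v\<^sub>j\<close> for \<open>i \<noteq> j\<close>, these identities for \<open>i = N, \<dots>, 1\<close> telescope to
  \<open>Q\<^sub>N(x) (1 - c\<^sub>N\<^sub>+\<^sub>1 x y)\<^sup>-\<^sup>1 P\<^sub>N(y) = P\<^sub>N(y) (1 - t x y)\<^sup>-\<^sup>1 Q\<^sub>N(x)\<close>,
  where \<open>Q\<^sub>N(x) = (1 + u\<^sub>1 x) \<cdots> (1 + u\<^sub>N x)\<close> and \<open>P\<^sub>N(y) = (1 + v\<^sub>N y) \<cdots> (1 + v\<^sub>1 y)\<close>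
  (\<open>truncated_cauchy\<close>, by coefficients).  For \<open>N \<rightarrow> \<infinity>\<close> the terms with \<open>c\<^sub>N\<^sub>+\<^sub>1\<close> disappear, and
  the case of two odd variables remains (\<open>Q1_P1\<close>).  The even series in \<open>x\<close> is the inverse of the
  odd series in \<open>-x\<close>, so conjugation gives the other three parities (\<open>pair_commutation\<close>).
  Finally, a coefficient of the asserted identity involves finitely many variables only, and
  for finitely many variables the factors are moved past each other one at a time, each
  exchange leaving a central factor.

  The limit needs control over the basis.  Every word in the generators is a power of \<open>t\<close>
  times a single basis element, and a word of bounded length containing a large letter is sent
  to a basis element containing a large letter (\<open>word_val_reduce\<close>).  Hence a given basis element comes
  from finitely many words of bounded length.  This makes all sums in the completion finite,
  turns it into a ring in which multiplication is continuous (\<open>converges_mult\<close>), and makes the terms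
  with \<open>c\<^sub>N\<^sub>+\<^sub>1\<close> tend to \<open>0\<close>.

  Coordinates make sense only if the basis elements are linearly independent
  (\<open>u_pair_independent\<close>).  For a bound \<open>K\<close> on the letters, represent \<open>u\<^sub>i\<close> by the letter \<open>i\<close> of the
  plactic monoid on \<open>{1..K}\<close>, \<open>v\<^sub>i\<close> by the column word of \<open>{1..K} - {i}\<close>, and \<open>t\<close> by the full column
  \<open>1 2 \<cdots> K\<close>, which is central.  All relations hold there.  The condition on a pair \<open>(S, T)\<close> says exactly
  that the complements of the columns of \<open>T\<close>, followed by the columns of \<open>S\<close>, form a semistandard
  tableau, and distinct words of tableaux are inequivalent because column insertion is invariant
  under the plactic relations (\<open>knuth_tab\<close>).\<close>

section \<open>Knuth equivalence and column insertion\<close>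

text \<open>These are Knuth's relations for words read backwards: multiplying a word by a letter on the
  right corresponds to inserting the letter into the first column of a tableau.\<close>

inductive knuth_step :: "nat list \<Rightarrow> nat list \<Rightarrow> bool" where
  "j \<le> i \<Longrightarrow> i < k \<Longrightarrow> knuth_step (p @ [i, j, k] @ q) (p @ [i, k, j] @ q)"
| "j < k \<Longrightarrow> k \<le> i \<Longrightarrow> knuth_step (p @ [i, j, k] @ q) (p @ [j, i, k] @ q)"

definition knuth :: "nat list \<Rightarrow> nat list \<Rightarrow> bool" (infix "\<approx>" 50) where
  "knuth = equivclp knuth_step"

lemma knuth_refl [simp, intro]: "w \<approx> w"
  by (simp add: knuth_def)

lemma knuth_sym: "v \<approx> w \<Longrightarrow> w \<approx> v"
  unfolding knuth_def by (rule equivclp_sym)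

lemma knuth_trans [trans]: "u \<approx> v \<Longrightarrow> v \<approx> w \<Longrightarrow> u \<approx> w"
  unfolding knuth_def by (rule equivclp_trans)

lemma knuth_induct [consumes 1, case_names refl step]:
  assumes "v \<approx> w" "\<And>v. P v v"
    and "\<And>v x w. v \<approx> x \<Longrightarrow> P v x \<Longrightarrow> knuth_step x w \<or> knuth_step w x \<Longrightarrow> P v w"
  shows "P v w"
  using assms unfolding knuth_def by (induction rule: equivclp_induct) auto

lemma knuth_step_context: "knuth_step v w \<Longrightarrow> knuth_step (p @ v @ q) (p @ w @ q)"
proof (induction rule: knuth_step.induct)
  case (1 j i k p' q')
  then show ?case using knuth_step.intros(1)[of j i k "p @ p'" "q' @ q"] by simp
next
  case (2 j k i p' q')
  then show ?case using knuth_step.intros(2)[of j k i "p @ p'" "q' @ q"] by simp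
qed

lemma knuth_step_knuth: "knuth_step v w \<Longrightarrow> v \<approx> w"
  unfolding knuth_def by auto

lemma knuth_context: "v \<approx> w \<Longrightarrow> p @ v @ q \<approx> p @ w @ q"
proof (induction rule: knuth_induct)
  case (step v x w)
  then have "p @ x @ q \<approx> p @ w @ q"
    by (auto dest: knuth_step_context[of _ _ p q] intro: knuth_step_knuth knuth_sym)
  then show ?case using step knuth_trans by blast
qed auto

lemma knuth_append: "v \<approx> v' \<Longrightarrow> w \<approx> w' \<Longrightarrow> v @ w \<approx> v' @ w'"
  using knuth_context[of v v' "[]" w] knuth_context[of w w' v' "[]"] knuth_trans by simp

lemma knuth_rel1: "j \<le> i \<Longrightarrow> i < k \<Longrightarrow> p @ [i, j, k] @ q \<approx> p @ [i, k, j] @ q"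
  by (intro knuth_step_knuth knuth_step.intros)

lemma knuth_rel2: "j < k \<Longrightarrow> k \<le> i \<Longrightarrow> p @ [i, j, k] @ q \<approx> p @ [j, i, k] @ q"
  by (intro knuth_step_knuth knuth_step.intros)

lemma knuth_mset: "v \<approx> w \<Longrightarrow> mset v = mset w"
  by (induction rule: knuth_induct) (auto elim!: knuth_step.cases)

lemma knuth_set: "v \<approx> w \<Longrightarrow> set v = set w"
  by (metis knuth_mset set_mset_mset)

lemma knuth_length: "v \<approx> w \<Longrightarrow> length v = length w"
  by (metis knuth_mset size_mset)

text \<open>Column insertion of \<open>x\<close> into \<open>C\<close> replaces the smallest entry not
  below \<open>x\<close>; the result \<open>None\<close> means that \<open>x\<close> is added
  at the bottom.\<close>

definition bump :: "nat set \<Rightarrow> nat \<Rightarrow> nat option" where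
  "bump C x = (if \<exists>y\<in>C. x \<le> y then Some (LEAST y. y \<in> C \<and> x \<le> y) else None)"

lemma bump_None: "bump C x = None \<longleftrightarrow> (\<forall>y\<in>C. y < x)"
  by (auto simp: bump_def not_less)

lemma bump_Some: "bump C x = Some y \<longleftrightarrow> y \<in> C \<and> x \<le> y \<and> (\<forall>z\<in>C. x \<le> z \<longrightarrow> y \<le> z)"
proof
  assume "bump C x = Some y"
  then have e: "\<exists>y\<in>C. x \<le> y" and y: "y = (LEAST y. y \<in> C \<and> x \<le> y)"
    by (auto simp: bump_def split: if_splits)
  from e have "y \<in> C \<and> x \<le> y" unfolding y by (metis (mono_tags, lifting) LeastI)
  then show "y \<in> C \<and> x \<le> y \<and> (\<forall>z\<in>C. x \<le> z \<longrightarrow> y \<le> z)"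
    unfolding y by (auto intro: Least_le)
next
  assume *: "y \<in> C \<and> x \<le> y \<and> (\<forall>z\<in>C. x \<le> z \<longrightarrow> y \<le> z)"
  then have "(LEAST y. y \<in> C \<and> x \<le> y) = y" by (intro Least_equality) auto
  then show "bump C x = Some y" using * by (auto simp: bump_def)
qed

definition col_ins :: "nat set \<Rightarrow> nat \<Rightarrow> nat set" where
  "col_ins C x = insert x (C - set_option (bump C x))"

fun bumped :: "nat set \<Rightarrow> nat list \<Rightarrow> nat list" where
  "bumped C [] = []"
| "bumped C (x # w) = (case bump C x of None \<Rightarrow> [] | Some y \<Rightarrow> [y]) @ bumped (col_ins C x) w"

lemma bumped_append: "bumped C (v @ w) = bumped C v @ bumped (foldl col_ins C v) w"
  by (induction v arbitrary: C) auto

lemma length_bumped: "length (bumped C w) \<le> length w"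
  by (induction w arbitrary: C) (auto intro: le_SucI split: option.splits)

text \<open>After \<open>i\<close> has been inserted, \<open>j\<close> bumps an entry at most
  \<open>i\<close> and \<open>k\<close> bumps an entry above \<open>i\<close>. The two
  insertions do not interfere, and the bumped entries satisfy the same inequalities as
  \<open>i\<close>, \<open>j\<close>, \<open>k\<close>.\<close>

lemma col_rel1:
  assumes "j \<le> i" "i < k"
  shows "foldl col_ins C [i, j, k] = foldl col_ins C [i, k, j]
    \<and> bumped C [i, j, k] \<approx> bumped C [i, k, j]"
proof -
  define C1 where "C1 = col_ins C i"
  have i: "i \<in> C1" by (simp add: C1_def col_ins_def)
  \<comment> \<open>the letter \<open>i\<close> is present, hence \<open>j \<le> i\<close> bumps something\<close>
  obtain yj where yj: "bump C1 j = Some yj" "yj \<le> i"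
    using i assms by (cases "bump C1 j") (auto simp: bump_None bump_Some)
  have jj: "j \<le> yj" "yj \<in> C1" using yj by (auto simp: bump_Some)
  have cj: "col_ins C1 j = insert j (C1 - {yj})" using yj by (simp add: col_ins_def)
  have kk: "bump (col_ins C1 j) k = bump C1 k"
  proof (cases "bump C1 k")
    case None
    then have "bump (col_ins C1 j) k = None"
      using yj assms unfolding bump_None by (auto simp: col_ins_def)
    with None show ?thesis by simp
  next
    case (Some yk)
    then have yk: "yk \<in> C1" "k \<le> yk" "\<forall>z\<in>C1. k \<le> z \<longrightarrow> yk \<le> z"
      by (simp_all add: bump_Some)
    then have "yk \<noteq> yj" using yj(2) assms by linarith
    then have "bump (col_ins C1 j) k = Some yk"
      unfolding bump_Some cj using yk assms by auto
    with Some show ?thesis by simp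
  qed
  have ck: "col_ins C1 k = insert k (C1 - set_option (bump C1 k))" by (simp add: col_ins_def)
  have opt: "k \<le> z" if "z \<in> set_option (bump C1 k)" for z
    using that by (auto simp: bump_Some)
  have jk: "bump (col_ins C1 k) j = Some yj"
  proof -
    have "\<forall>z\<in>C1. j \<le> z \<longrightarrow> yj \<le> z" using yj(1) by (simp add: bump_Some)
    moreover have "yj \<notin> set_option (bump C1 k)" using opt[of yj] yj(2) assms by linarith
    ultimately show ?thesis unfolding bump_Some ck using yj(2) jj assms by auto
  qed
  have "col_ins (col_ins C1 j) k = col_ins (col_ins C1 k) j"
    unfolding cj ck col_ins_def[of "insert j (C1 - {yj})"]
      col_ins_def[of "insert k (C1 - set_option (bump C1 k))"] kk[unfolded cj] jk[unfolded ck]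
    using yj(2) assms opt[of j] opt[of yj] by auto
  then have set: "foldl col_ins C [i, j, k] = foldl col_ins C [i, k, j]"
    by (simp add: C1_def)
  have "bumped C [i, j, k] \<approx> bumped C [i, k, j]"
  proof (cases "bump C i")
    case None
    then have "bump C1 k = None"
      using assms by (auto simp: bump_None C1_def col_ins_def)
    then show ?thesis using kk jk yj None by (simp add: C1_def[symmetric])
  next
    case (Some yi)
    show ?thesis
    proof (cases "bump C1 k")
      case None
      then show ?thesis using kk jk yj Some by (simp add: C1_def[symmetric])
    next
      case (Some yk)
      have "yj \<le> yi" using yj \<open>bump C i = Some yi\<close> by (auto simp: bump_Some)
      moreover have "yi < yk"
      proof -
        have yk: "yk \<in> C1" "k \<le> yk" using Some by (simp_all add: bump_Some)
        then have "yk \<in> C" "yk \<noteq> yi"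
          using assms \<open>bump C i = Some yi\<close> by (auto simp: C1_def col_ins_def)
        moreover have "i \<le> yk" using yk assms by linarith
        ultimately show ?thesis using \<open>bump C i = Some yi\<close> by (metis bump_Some le_neq_implies_less)
      qed
      ultimately show ?thesis
        using kk jk yj Some \<open>bump C i = Some yi\<close> knuth_rel1[of yj yi yk "[]" "[]"]
        by (simp add: C1_def[symmetric])
    qed
  qed
  with set show ?thesis by blast
qed

text \<open>If some entry lies in \<open>{j..<i}\<close>, then \<open>i\<close> and \<open>j\<close>
  bump different entries and a relation of the second kind results. Otherwise both would bump
  the same entry; then the letter inserted first is bumped later, and the bumped words differ
  by a relation of the first kind.\<close>

lemma col_rel2:
  assumes "j < k" "k \<le> i"
  shows "foldl col_ins C [i, j, k] = foldl col_ins C [j, i, k]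
    \<and> bumped C [i, j, k] \<approx> bumped C [j, i, k]"
proof (cases "\<exists>a\<in>C. j \<le> a \<and> a < i")
  case True
  then obtain a where a: "bump C j = Some a" "a < i"
    by (cases "bump C j") (auto simp: bump_None bump_Some)
  have a2: "bump (col_ins C i) j = Some a"
    using a assms unfolding bump_Some col_ins_def
    by (cases "bump C i") (auto simp: bump_Some bump_None)
  have b2: "bump (col_ins C j) i = bump C i"
  proof (cases "bump C i")
    case None
    then have "bump (col_ins C j) i = None"
      using a assms unfolding bump_None by (auto simp: col_ins_def)
    with None show ?thesis by simp
  next
    case (Some b)
    then have "bump (col_ins C j) i = Some b"
      using a assms unfolding bump_Some by (auto simp: col_ins_def bump_Some)
    with Some show ?thesis by simp
  qed
  have "bump C i \<noteq> Some a" "bump C i \<noteq> Some j" using a assms by (auto simp: bump_Some)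
  then have set2: "col_ins (col_ins C i) j = col_ins (col_ins C j) i" (is "?D = ?D'")
    unfolding col_ins_def[of "col_ins _ _"] a2 b2
    using a(2) assms by (cases "bump C i") (auto simp: col_ins_def a(1))
  have "i \<in> ?D'" by (simp add: col_ins_def[of "col_ins _ _"])
  then obtain c where c: "bump ?D' k = Some c" "c \<le> i"
    using assms by (cases "bump ?D' k") (auto simp: bump_None bump_Some)
  have "a < c"
  proof -
    have c': "c \<in> ?D'" "k \<le> c" using c by (auto simp: bump_Some)
    then have "c = i \<or> c \<in> col_ins C j" by (auto simp: col_ins_def[of "col_ins _ _"])
    then show ?thesis
    proof
      assume "c \<in> col_ins C j"
      then have "c \<in> C" "c \<noteq> a" using a c' assms by (auto simp: col_ins_def)
      then show ?thesis using a c' assms by (force simp: bump_Some)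
    qed (use a in simp)
  qed
  have "bumped C [i, j, k] \<approx> bumped C [j, i, k]"
  proof (cases "bump C i")
    case None
    then show ?thesis using a(1) a2 b2 c(1) set2 by simp
  next
    case (Some b)
    then have "c \<le> b" using c(2) by (simp add: bump_Some)
    then show ?thesis
      using a(1) a2 b2 c(1) set2 Some knuth_rel2[OF \<open>a < c\<close>, of b "[]" "[]"] by simp
  qed
  then show ?thesis using set2 by simp
next
  case False
  have ab: "bump C j = bump C i"
  proof (cases "bump C i")
    case None
    then have "bump C j = None" unfolding bump_None using False by (meson not_le)
    with None show ?thesis by simp
  next
    case (Some b)
    then have b: "b \<in> C" "i \<le> b" "\<forall>z\<in>C. i \<le> z \<longrightarrow> b \<le> z" by (simp_all add: bump_Some)
    then have "bump C j = Some b" unfolding bump_Some using False assms by (auto simp: not_less)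
    with Some show ?thesis by simp
  qed
  define E where "E = C - set_option (bump C i)"
  have E: "z \<in> E \<Longrightarrow> z < j \<or> i < z" for z
    using False assms unfolding E_def
    by (cases "bump C i") (force simp: bump_Some bump_None)+
  have ci: "col_ins C i = insert i E" and cj: "col_ins C j = insert j E"
    by (simp_all add: col_ins_def E_def ab)
  have bi: "bump (insert i E) j = Some i"
    using assms E by (force simp: bump_Some)
  have cij: "col_ins (insert i E) j = insert j E"
    using E[of i] assms unfolding col_ins_def bi by auto
  have bik: "bump (insert j E) i = bump (insert j E) k"
  proof (cases "bump (insert j E) i")
    case None
    then have "bump (insert j E) k = None"
      using assms unfolding bump_None by (fastforce dest: E)
    with None show ?thesis by simp
  next
    case (Some c)
    then have c: "c \<in> insert j E" "i \<le> c" "\<forall>z\<in>insert j E. i \<le> z \<longrightarrow> c \<le> z"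
      by (simp_all add: bump_Some)
    have "c \<le> z" if "z \<in> insert j E" "k \<le> z" for z
      using that c(3) E[of z] assms by auto
    then have "bump (insert j E) k = Some c" unfolding bump_Some using c assms by auto
    with Some show ?thesis by simp
  qed
  define D where "D = insert j E - set_option (bump (insert j E) i)"
  have D: "z \<le> j \<or> i < z" if "z \<in> D" for z
    using that E[of z] unfolding D_def by auto
  have cji: "col_ins (insert j E) i = insert i D" "col_ins (insert j E) k = insert k D"
    by (simp_all add: col_ins_def D_def bik)
  have bk: "bump (insert i D) k = Some i"
    using D assms by (force simp: bump_Some)
  have ck: "col_ins (insert i D) k = insert k D"
    using D[of i] assms unfolding col_ins_def bk by auto
  have set: "foldl col_ins C [i, j, k] = foldl col_ins C [j, i, k]"
    by (simp add: ci cj cij cji ck)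
  have "bumped C [i, j, k] \<approx> bumped C [j, i, k]"
  proof (cases "bump C i")
    case None
    then have "\<forall>y\<in>C. y < j" using ab by (metis bump_None)
    then have "bump (insert j E) k = None"
      using assms unfolding bump_None E_def by (auto intro: less_trans)
    then show ?thesis by (simp add: None ci cj cij cji bi bk bik ab)
  next
    case (Some b)
    show ?thesis
    proof (cases "bump (insert j E) k")
      case None
      then show ?thesis by (simp add: Some ci cj cij cji bi bk bik ab)
    next
      case (Some c)
      have "i \<le> b" using \<open>bump C i = Some b\<close> by (simp add: bump_Some)
      moreover have "b < c"
      proof -
        have "c \<in> insert j E" "k \<le> c" using Some by (auto simp: bump_Some)
        then have "c \<in> E" using assms by auto
        then have "c \<in> C" "c \<noteq> b" "i < c"
          using E[of c] \<open>k \<le> c\<close> assms \<open>bump C i = Some b\<close> by (auto simp: E_def)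
        then show ?thesis using \<open>bump C i = Some b\<close> by (force simp: bump_Some)
      qed
      ultimately show ?thesis
        using knuth_rel1[of i b c "[]" "[]"] Some \<open>bump C i = Some b\<close>
        by (simp add: ci cj cij cji bi bk bik ab)
    qed
  qed
  with set show ?thesis by blast
qed

text \<open>Passing a word through one column thus preserves equivalence, which allows treating a
  tableau column by column.\<close>

lemma col_knuth:
  "v \<approx> w \<Longrightarrow> foldl col_ins C v = foldl col_ins C w \<and> bumped C v \<approx> bumped C w"
proof (induction rule: knuth_induct)
  case (step v x w)
  have context_step: "foldl col_ins C (p @ v @ q) = foldl col_ins C (p @ w @ q)
      \<and> bumped C (p @ v @ q) \<approx> bumped C (p @ w @ q)"
    if "\<And>D. foldl col_ins D v = foldl col_ins D w \<and> bumped D v \<approx> bumped D w" for p q v w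
    using that by (simp add: bumped_append knuth_append)
  have "foldl col_ins C x = foldl col_ins C w \<and> bumped C x \<approx> bumped C w" if "knuth_step x w" for x w
    using that
  proof (induction rule: knuth_step.induct)
    case (1 j i k p q)
    show ?case by (rule context_step) (rule col_rel1[OF 1])
  next
    case (2 j k i p q)
    show ?case by (rule context_step) (rule col_rel2[OF 2])
  qed
  then show ?case using step by (metis knuth_sym knuth_trans)
qed auto

fun tab_ins :: "nat set list \<Rightarrow> nat \<Rightarrow> nat set list" where
  "tab_ins [] x = [{x}]"
| "tab_ins (C # \<tau>) x = col_ins C x # (case bump C x of None \<Rightarrow> \<tau> | Some y \<Rightarrow> tab_ins \<tau> y)"

lemma tab_word_Cons: "foldl tab_ins (C # \<tau>) w = foldl col_ins C w # foldl tab_ins \<tau> (bumped C w)"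
  by (induction w arbitrary: C \<tau>) (auto split: option.split)

lemma tab_word_Nil: "w \<noteq> [] \<Longrightarrow> foldl tab_ins [] w = foldl tab_ins [{}] w"
  by (cases w) (auto simp: bump_def col_ins_def)

text \<open>Induction on the columns: each column hands an equivalent word to the next one. An empty
  tableau behaves like an empty column, which absorbs the first letter, so the measure
  decreases in that case as well.\<close>

theorem knuth_tab: "v \<approx> w \<Longrightarrow> foldl tab_ins \<tau> v = foldl tab_ins \<tau> w"
proof (induction "2 * length v + length \<tau>" arbitrary: v w \<tau> rule: less_induct)
  case less
  show ?case
  proof (cases \<tau>)
    case Nil
    show ?thesis
    proof (cases "v = []")
      case True
      then show ?thesis using less.prems knuth_length by fastforce
    next
      case False
      then have "w \<noteq> []" using less.prems knuth_length by fastforce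
      have "length (bumped {} v) < length v"
        using False length_bumped by (cases v) (auto simp: bump_def le_imp_less_Suc)
      then have "foldl tab_ins [] (bumped {} v) = foldl tab_ins [] (bumped {} w)"
        using less.prems col_knuth by (intro less.hyps) (auto simp: Nil)
      then show ?thesis using col_knuth[OF less.prems, of "{}"]
        by (simp add: Nil tab_word_Nil False \<open>w \<noteq> []\<close> tab_word_Cons)
    qed
  next
    case (Cons C \<sigma>)
    have "foldl tab_ins \<sigma> (bumped C v) = foldl tab_ins \<sigma> (bumped C w)"
      using less.prems col_knuth length_bumped[of C v] by (intro less.hyps) (auto simp: Cons)
    then show ?thesis using col_knuth[OF less.prems, of C] by (simp add: Cons tab_word_Cons)
  qed
qed

section \<open>Chains of columns and their reading words\<close>

definition count_le :: "nat set \<Rightarrow> nat \<Rightarrow> nat" where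
  "count_le C k = card (C \<inter> {..k})"

text \<open>For strictly increasing columns this means that \<open>C\<close> may stand immediately to
  the left of \<open>D\<close> in a semistandard tableau. Counting entries up to
  \<open>k\<close> avoids indices and is preserved visibly by insertion and complementation.\<close>

definition dominates :: "nat set \<Rightarrow> nat set \<Rightarrow> bool" where
  "dominates C D \<longleftrightarrow> (\<forall>k. count_le D k \<le> count_le C k)"

lemma count_le_insert: "x \<notin> C \<Longrightarrow> count_le (insert x C) k = count_le C k + (if x \<le> k then 1 else 0)"
  by (auto simp: count_le_def Int_insert_left)

lemma count_le_empty [simp]: "count_le {} k = 0"
  by (simp add: count_le_def)

lemma count_le_remove: "x \<in> C \<Longrightarrow> count_le C k = count_le (C - {x}) k + (if x \<le> k then 1 else 0)"
  using count_le_insert[of x "C - {x}" k] by (simp add: insert_absorb)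

lemma count_le_col_ins:
  "count_le (col_ins C x) k = count_le C k + (if x \<le> k \<and> (\<forall>z\<in>C. x \<le> z \<longrightarrow> k < z) then 1 else 0)"
proof (cases "bump C x")
  case None
  then have *: "\<forall>z\<in>C. z < x" by (simp add: bump_None)
  then have "x \<notin> C" by auto
  then show ?thesis using * by (auto simp: col_ins_def None count_le_insert)
next
  case (Some y)
  then have y: "y \<in> C" "x \<le> y" "\<forall>z\<in>C. x \<le> z \<longrightarrow> y \<le> z" by (simp_all add: bump_Some)
  then have "x \<notin> C - {y}" by auto
  then have "count_le (col_ins C x) k = count_le (C - {y}) k + (if x \<le> k then 1 else 0)"
    by (simp add: col_ins_def Some count_le_insert)
  moreover have "(\<forall>z\<in>C. x \<le> z \<longrightarrow> k < z) \<longleftrightarrow> k < y"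
    using y by (auto intro: less_le_trans)
  ultimately show ?thesis using y count_le_remove[OF y(1), of k] by auto
qed

lemma count_le_col_ins_mono: "count_le C k \<le> count_le (col_ins C x) k"
  by (simp add: count_le_col_ins)

text \<open>Insertion of \<open>y\<close> raises the counts of \<open>D\<close> by one from
  \<open>y\<close> up to the next entry of \<open>D\<close>. On that range the count of
  \<open>D\<close> is the one just below \<open>y\<close>, while \<open>C\<close> has the
  additional entry \<open>y\<close>.\<close>

lemma dominates_bump:
  assumes "dominates C D" "y \<in> C"
  shows "dominates C (col_ins D y)"
  unfolding dominates_def
proof
  fix k
  show "count_le (col_ins D y) k \<le> count_le C k"
  proof (cases "y \<le> k \<and> (\<forall>z\<in>D. y \<le> z \<longrightarrow> k < z)")
    case True
    have "card (D \<inter> {..<y}) \<le> card (C \<inter> {..<y})"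
    proof (cases y)
      case (Suc y')
      then have "{..<y} = {..y'}" by auto
      then show ?thesis using assms by (simp add: dominates_def count_le_def)
    qed simp
    moreover have "D \<inter> {..k} = D \<inter> {..<y}" using True by force
    moreover have "card (insert y (C \<inter> {..<y})) \<le> card (C \<inter> {..k})"
      using True assms by (intro card_mono) auto
    moreover have "count_le (col_ins D y) k = Suc (count_le D k)" using True by (simp add: count_le_col_ins)
    ultimately show ?thesis by (simp add: count_le_def)
  next
    case False
    then show ?thesis using assms by (auto simp: count_le_col_ins dominates_def)
  qed
qed

lemma successively_dominates_mono:
  "successively dominates (C # \<tau>) \<Longrightarrow> (\<And>k. count_le C k \<le> count_le C' k) \<Longrightarrow> successively dominates (C' # \<tau>)"
  by (cases \<tau>) (auto simp: dominates_def intro: le_trans)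

lemma chain_tab_ins_aux:
  "successively dominates (C # \<tau>) \<Longrightarrow> y \<in> C \<Longrightarrow> successively dominates (C # tab_ins \<tau> y)"
proof (induction \<tau> arbitrary: C y)
  case Nil
  have "dominates C (col_ins {} y)" by (rule dominates_bump) (use Nil in \<open>auto simp: dominates_def\<close>)
  then show ?case by (simp add: col_ins_def bump_def)
next
  case (Cons D \<tau>)
  have "successively dominates (col_ins D y # (case bump D y of None \<Rightarrow> \<tau> | Some z \<Rightarrow> tab_ins \<tau> z))"
  proof (rule successively_dominates_mono[OF _ count_le_col_ins_mono])
    show "successively dominates (D # (case bump D y of None \<Rightarrow> \<tau> | Some z \<Rightarrow> tab_ins \<tau> z))"
      using Cons by (auto simp: bump_Some split: option.split)
  qed
  then show ?case using Cons.prems dominates_bump[of C D y] by simp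
qed

lemma chain_tab_ins: "successively dominates \<tau> \<Longrightarrow> successively dominates (tab_ins \<tau> x)"
proof (cases \<tau>)
  case (Cons C \<sigma>)
  assume *: "successively dominates \<tau>"
  have "successively dominates (C # (case bump C x of None \<Rightarrow> \<sigma> | Some y \<Rightarrow> tab_ins \<sigma> y))"
    using * chain_tab_ins_aux[of C \<sigma>] by (auto simp: Cons bump_Some split: option.split)
  then show ?thesis using successively_dominates_mono[OF _ count_le_col_ins_mono] by (simp add: Cons)
qed simp

lemma tab_ins_finite_nonempty:
  "\<forall>C\<in>set \<tau>. finite C \<and> C \<noteq> {} \<Longrightarrow> \<forall>C\<in>set (tab_ins \<tau> x). finite C \<and> C \<noteq> {}"
  by (induction \<tau> arbitrary: x) (auto simp: col_ins_def split: option.split)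

lemma tab_word_chain: "successively dominates (foldl tab_ins [] w)"
  by (induction w rule: rev_induct) (auto intro: chain_tab_ins)

lemma tab_word_finite_nonempty: "\<forall>C\<in>set (foldl tab_ins [] w). finite C \<and> C \<noteq> {}"
proof (induction w rule: rev_induct)
  case (snoc x w)
  then show ?case unfolding foldl_append foldl.simps by (rule tab_ins_finite_nonempty)
qed simp

abbreviation "slist \<equiv> sorted_list_of_set :: nat set \<Rightarrow> nat list"

lemma slist_unique: "sorted_wrt (<) l \<Longrightarrow> set l = A \<Longrightarrow> slist A = l"
  by (metis List.finite_set set_sorted_list_of_set strict_sorted_equal strict_sorted_list_of_set)

lemma slist_upt: "slist {a..<b} = [a..<b]"
  by (rule slist_unique) auto

text \<open>The inserted letter travels left by relations of the first kind until it stands behind the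
  bumped one, which then travels left by relations of the second kind.\<close>

lemma col_word_bump:
  assumes "sorted_wrt (<) (p @ y # q)" "\<forall>a\<in>set p. a < x" "x \<le> y"
  shows "p @ y # q @ [x] \<approx> y # p @ x # q"
proof -
  have 1: "y # q @ [x] \<approx> y # x # q"
    using assms(1,3)
  proof (induction q arbitrary: x rule: rev_induct)
    case (snoc z q)
    obtain r i where ri: "y # q = r @ [i]" by (metis list.distinct(1) rev_exhaust)
    have "i \<in> set (y # q)" by (simp add: ri)
    then have "i < z" "x \<le> i" using snoc.prems by (auto simp: sorted_wrt_append)
    then have "r @ [i, x, z] @ [] \<approx> r @ [i, z, x] @ []" by (intro knuth_rel1)
    then have "y # q @ [z] @ [x] \<approx> (y # q @ [x]) @ [z]"
      using ri by (metis append.assoc append_Cons append_Nil append_Nil2 knuth_sym)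
    also have "\<dots> \<approx> (y # x # q) @ [z]"
      using snoc by (intro knuth_append) (auto simp: sorted_wrt_append)
    finally show ?case by simp
  qed simp
  have 2: "p @ [y, x] \<approx> y # p @ [x]"
    using assms
  proof (induction p arbitrary: x rule: rev_induct)
    case (snoc a p)
    have "p @ [y, a, x] @ [] \<approx> p @ [a, y, x] @ []"
      using snoc.prems by (intro knuth_rel2) auto
    then have "(p @ [a]) @ [y, x] \<approx> (p @ [y, a]) @ [x]" by (simp add: knuth_sym)
    also have "\<dots> \<approx> (y # p @ [a]) @ [x]"
      using snoc.prems by (intro knuth_append snoc.IH) (auto simp: sorted_wrt_append)
    finally show ?case by simp
  qed simp
  have "p @ y # q @ [x] \<approx> p @ y # x # q" using knuth_append[OF knuth_refl 1] by simp
  also have "\<dots> \<approx> y # p @ x # q" using knuth_append[OF 2 knuth_refl, of q] by simp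
  finally show ?thesis .
qed

lemma col_word_ins:
  assumes "finite C"
  shows "slist C @ [x] \<approx> (case bump C x of None \<Rightarrow> [] | Some y \<Rightarrow> [y]) @ slist (col_ins C x)"
proof (cases "bump C x")
  case None
  then have "\<forall>y\<in>C. y < x" by (simp add: bump_None)
  moreover have "col_ins C x = insert x C" by (simp add: None col_ins_def)
  ultimately have "slist (col_ins C x) = slist C @ [x]"
    using assms by (intro slist_unique) (simp_all add: sorted_wrt_append)
  then show ?thesis by (simp add: None)
next
  case (Some y)
  then have y: "y \<in> C" "x \<le> y" "\<forall>z\<in>C. x \<le> z \<longrightarrow> y \<le> z" by (simp_all add: bump_Some)
  obtain p q where pq: "slist C = p @ y # q"
    using y assms by (metis set_sorted_list_of_set split_list)
  have s: "sorted_wrt (<) (p @ y # q)" by (simp flip: pq)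
  have "set (slist C) = C" using assms by simp
  then have C: "C = set p \<union> {y} \<union> set q" unfolding pq by auto
  have p: "\<forall>a\<in>set p. a < x"
  proof
    fix a assume "a \<in> set p"
    then have "a < y" "a \<in> C" using s C by (auto simp: sorted_wrt_append)
    then show "a < x" using y(3) by (meson not_le)
  qed
  have ci: "col_ins C x = insert x (C - {y})" by (simp add: col_ins_def Some)
  have "slist (col_ins C x) = p @ x # q"
  proof (rule slist_unique)
    show "sorted_wrt (<) (p @ x # q)" using s p y by (auto simp: sorted_wrt_append)
    show "set (p @ x # q) = col_ins C x"
    proof -
      have "C - {y} = set p \<union> set q" using s unfolding C by (auto simp: sorted_wrt_append)
      then show ?thesis by (simp add: ci)
    qed
  qed
  then show ?thesis using col_word_bump[OF s p y(2)] by (simp add: Some pq)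
qed

text \<open>The columns of a tableau are listed from left to right, whereas words are read from the last
  column to the first.\<close>

definition reading :: "nat set list \<Rightarrow> nat list" where
  "reading \<tau> = concat (map slist (rev \<tau>))"

lemma reading_simps [simp]: "reading [] = []" "reading (C # \<tau>) = reading \<tau> @ slist C"
  by (simp_all add: reading_def)

lemma reading_tab_ins:
  "\<forall>C\<in>set \<tau>. finite C \<Longrightarrow> reading \<tau> @ [x] \<approx> reading (tab_ins \<tau> x)"
proof (induction \<tau> arbitrary: x)
  case (Cons C \<tau>)
  have "reading (C # \<tau>) @ [x] \<approx> reading \<tau> @
      (case bump C x of None \<Rightarrow> [] | Some y \<Rightarrow> [y]) @ slist (col_ins C x)"
    using Cons.prems col_word_ins[of C x] by (simp add: knuth_append)
  also have "\<dots> \<approx> reading (tab_ins (C # \<tau>) x)"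
  proof (cases "bump C x")
    case (Some y)
    then show ?thesis
      using knuth_append[OF Cons.IH[of y] knuth_refl, of "slist (col_ins C x)"] Cons.prems by simp
  qed simp
  finally show ?case .
qed simp

theorem reading_tab_word: "w \<approx> reading (foldl tab_ins [] w)"
proof (induction w rule: rev_induct)
  case (snoc x w)
  have "w @ [x] \<approx> reading (foldl tab_ins [] w) @ [x]"
    by (intro knuth_append snoc) simp
  also have "\<dots> \<approx> reading (foldl tab_ins [] (w @ [x]))"
    using tab_word_finite_nonempty by (simp add: reading_tab_ins)
  finally show ?case .
qed simp

fun dominates_list :: "nat list \<Rightarrow> nat list \<Rightarrow> bool" where
  "dominates_list cs [] = True"
| "dominates_list [] (d # ds) = False"
| "dominates_list (c # cs) (d # ds) = (c \<le> d \<and> dominates_list cs ds)"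

lemma dominates_imp_list:
  assumes "sorted_wrt (<) cs" "sorted_wrt (<) ds" "\<And>k. count_le (set ds) k \<le> count_le (set cs) k"
  shows "dominates_list cs ds"
  using assms
proof (induction cs ds rule: dominates_list.induct)
  case (2 d ds)
  from 2(3)[of d] show ?case by (simp add: count_le_def)
next
  case (3 c cs d ds)
  have "set (c # cs) \<inter> {..d} \<noteq> {}"
  proof
    assume "set (c # cs) \<inter> {..d} = {}"
    then have "count_le (set (d # ds)) d = 0" using 3(4)[of d] by (simp add: count_le_def)
    then show False by (auto simp: count_le_def)
  qed
  then have "c \<le> d" using 3(2) by fastforce
  moreover have "count_le (set ds) k \<le> count_le (set cs) k" for k
  proof (cases "d \<le> k")
    case True
    have "c \<notin> set cs" "d \<notin> set ds" using 3(2,3) by auto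
    then show ?thesis using 3(4)[of k] True \<open>c \<le> d\<close> by (simp add: count_le_insert)
  next
    case False
    then have "set ds \<inter> {..k} = {}" using 3(3) by fastforce
    then show ?thesis by (simp add: count_le_def)
  qed
  ultimately show ?case using 3 by simp
qed simp

lemma dominates_imp_slist: "finite C \<Longrightarrow> finite D \<Longrightarrow> dominates C D \<Longrightarrow> dominates_list (slist C) (slist D)"
  by (intro dominates_imp_list) (auto simp: dominates_def)

text \<open>Each \<open>c\<close> in turn replaces the corresponding \<open>d\<close>, and the surplus
  letters of \<open>cs\<close> are appended.\<close>

lemma dominates_list_knuth:
  assumes "dominates_list cs ds" "sorted_wrt (<) (p @ cs)" "sorted_wrt (<) (p @ ds)"
  shows "p @ ds @ cs \<approx> ds @ p @ cs"
  using assms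
proof (induction cs ds arbitrary: p rule: dominates_list.induct)
  case (3 c cs d ds)
  have "(p @ d # ds @ [c]) @ cs \<approx> (d # p @ c # ds) @ cs"
    using 3 by (intro knuth_append col_word_bump) (auto simp: sorted_wrt_append)
  also have "\<dots> = [d] @ (p @ [c]) @ ds @ cs" by simp
  also have "\<dots> \<approx> [d] @ ds @ (p @ [c]) @ cs"
    by (intro knuth_append knuth_refl "3.IH") (use "3.prems" in \<open>auto simp: sorted_wrt_append\<close>)
  finally show ?case by simp
qed auto

lemma bump_append_le:
  assumes "sorted_wrt (<) (p @ d # ds)" "\<forall>a\<in>set p. a < c" "c \<le> d"
  shows "bump (set p \<union> set (d # ds)) c = Some d"
  using assms by (fastforce simp: bump_Some sorted_wrt_append)

lemma dominates_list_col_ins: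
  assumes "dominates_list cs ds" "sorted_wrt (<) (p @ cs)" "sorted_wrt (<) (p @ ds)"
  shows "foldl col_ins (set p \<union> set ds) cs = set p \<union> set cs
    \<and> bumped (set p \<union> set ds) cs = ds"
  using assms
proof (induction cs arbitrary: ds p)
  case Nil
  then show ?case by (cases ds) auto
next
  case (Cons c cs)
  show ?case
  proof (cases ds)
    case Nil
    have b: "bump (set p) c = None" using Cons.prems by (auto simp: bump_None sorted_wrt_append)
    show ?thesis
      using Cons.IH[of "[]" "p @ [c]"] Cons.prems
      by (simp add: Nil b col_ins_def sorted_wrt_append)
  next
    case (Cons d ds')
    have prems: "dominates_list (c # cs) (d # ds')" "sorted_wrt (<) (p @ c # cs)"
      "sorted_wrt (<) (p @ d # ds')" using Cons.prems Cons by simp_all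
    have b: "bump (set p \<union> set (d # ds')) c = Some d"
      using prems by (intro bump_append_le) (auto simp: sorted_wrt_append)
    have "col_ins (set p \<union> set (d # ds')) c = set (p @ [c]) \<union> set ds'"
      unfolding col_ins_def b using prems by (auto simp: sorted_wrt_append)
    moreover have "sorted_wrt (<) ((p @ [c]) @ ds')" "sorted_wrt (<) ((p @ [c]) @ cs)"
      using prems by (auto simp: sorted_wrt_append)
    ultimately show ?thesis
      using Cons.IH[of ds' "p @ [c]"] prems b unfolding Cons by simp
  qed
qed

text \<open>Inserting the word of a column that dominates the first column of a tableau pushes every
  column one place to the right.\<close>

lemma tab_word_column:
  assumes "successively dominates (C # \<tau>)" "\<forall>D\<in>set (C # \<tau>). finite D \<and> D \<noteq> {}"
  shows "foldl tab_ins \<tau> (slist C) = C # \<tau>"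
  using assms
proof (induction \<tau> arbitrary: C)
  case Nil
  then have "slist C \<noteq> []" by simp
  moreover have "foldl col_ins {} (slist C) = C \<and> bumped {} (slist C) = []"
    using dominates_list_col_ins[of "slist C" "[]" "[]"] Nil by simp
  ultimately show ?case by (simp add: tab_word_Nil tab_word_Cons)
next
  case (Cons D \<tau>)
  have "foldl col_ins D (slist C) = C \<and> bumped D (slist C) = slist D"
    using dominates_list_col_ins[of "slist C" "slist D" "[]"] Cons.prems by (simp add: dominates_imp_slist)
  then show ?case using Cons by (simp add: tab_word_Cons)
qed

theorem tab_word_reading:
  "successively dominates \<tau> \<Longrightarrow> \<forall>D\<in>set \<tau>. finite D \<and> D \<noteq> {} \<Longrightarrow> foldl tab_ins [] (reading \<tau>) = \<tau>"
proof (induction \<tau>)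
  case (Cons C \<tau>)
  then have "successively dominates \<tau>" by (cases \<tau>) auto
  then show ?case using Cons tab_word_column[of C \<tau>] by simp
qed simp

section \<open>Dual letters as complementary columns\<close>

lemma knuth_append_left: "v \<approx> w \<Longrightarrow> p @ v \<approx> p @ w"
  by (intro knuth_append knuth_refl)

lemma knuth_append_right: "v \<approx> w \<Longrightarrow> v @ q \<approx> w @ q"
  by (intro knuth_append knuth_refl)

text \<open>A letter that occurs in the column bumps itself.\<close>

lemma col_word_pass: "finite C \<Longrightarrow> set w \<subseteq> C \<Longrightarrow> slist C @ w \<approx> w @ slist C"
proof (induction w)
  case (Cons x w)
  have b: "bump C x = Some x" using Cons.prems by (auto simp: bump_Some)
  have "col_ins C x = C" using Cons.prems by (auto simp: b col_ins_def)
  then have *: "slist C @ [x] \<approx> [x] @ slist C" using col_word_ins[of C x] Cons.prems by (simp add: b)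
  have "slist C @ x # w = (slist C @ [x]) @ w" by simp
  also have "\<dots> \<approx> ([x] @ slist C) @ w" by (rule knuth_append_right[OF *])
  also have "\<dots> = [x] @ slist C @ w" by simp
  also have "\<dots> \<approx> [x] @ w @ slist C" using Cons by (intro knuth_append_left) auto
  finally show ?case by simp
qed simp

definition compl_word :: "nat \<Rightarrow> nat set \<Rightarrow> nat list" where
  "compl_word K B = filter (\<lambda>x. x \<notin> B) [1..<Suc K]"

lemma set_compl_word [simp]: "set (compl_word K B) = {1..K} - B"
  by (auto simp: compl_word_def)

lemma sorted_compl_word: "sorted_wrt (<) (compl_word K B)"
  unfolding compl_word_def by (intro sorted_wrt_filter sorted_wrt_upt)

lemma slist_compl_word: "slist ({1..K} - B) = compl_word K B"
  by (rule slist_unique[OF sorted_compl_word set_compl_word])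

lemma compl_word_pass: "set w \<subseteq> {1..K} - B \<Longrightarrow> compl_word K B @ w \<approx> w @ compl_word K B"
  using col_word_pass[of "{1..K} - B" w] by (simp only: slist_compl_word) simp

lemma compl_word_shift1:
  assumes "1 \<le> b" "b < K"
  shows "compl_word K {b} @ [b] \<approx> [Suc b] @ compl_word K {Suc b}"
proof -
  have b: "bump ({1..K} - {b}) b = Some (Suc b)"
    using assms by (auto simp: bump_Some Suc_le_eq)
  have "col_ins ({1..K} - {b}) b = {1..K} - {Suc b}"
    using assms unfolding col_ins_def b by auto
  then show ?thesis using col_word_ins[of "{1..K} - {b}" b] unfolding b by (simp only: slist_compl_word) simp
qed

lemma compl_word_shift:
  assumes "1 \<le> a" "a \<le> b" "b \<le> K" "set v \<subseteq> {1..<a}" "set w \<subseteq> {Suc b..K}"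
  shows "compl_word K {a} @ v @ [a..<b] @ w \<approx> v @ [Suc a..<Suc b] @ w @ compl_word K {b}"
proof -
  have *: "compl_word K {a} @ [a..<b] \<approx> [Suc a..<Suc b] @ compl_word K {b}"
    using assms(2,3)
  proof (induction b rule: dec_induct)
    case (step n)
    have "compl_word K {a} @ [a..<Suc n] = (compl_word K {a} @ [a..<n]) @ [n]" using step by simp
    also have "\<dots> \<approx> ([Suc a..<Suc n] @ compl_word K {n}) @ [n]"
      using step by (intro knuth_append_right) (simp del: upt_Suc)
    also have "\<dots> = [Suc a..<Suc n] @ (compl_word K {n} @ [n])" by simp
    also have "\<dots> \<approx> [Suc a..<Suc n] @ ([Suc n] @ compl_word K {Suc n})"
      using step assms by (intro knuth_append_left compl_word_shift1) auto
    finally show ?case using step by simp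
  qed simp
  have "(compl_word K {a} @ v) @ [a..<b] @ w \<approx> (v @ compl_word K {a}) @ [a..<b] @ w"
    using assms by (intro knuth_append_right compl_word_pass) auto
  also have "\<dots> = v @ (compl_word K {a} @ [a..<b]) @ w" by simp
  also have "\<dots> \<approx> v @ ([Suc a..<Suc b] @ compl_word K {b}) @ w"
    by (intro knuth_append_left knuth_append_right *)
  also have "\<dots> = (v @ [Suc a..<Suc b]) @ (compl_word K {b} @ w)" by simp
  also have "\<dots> \<approx> (v @ [Suc a..<Suc b]) @ (w @ compl_word K {b})"
    using assms by (intro knuth_append_left compl_word_pass) auto
  finally show ?thesis by simp
qed

lemma compl_word_split:
  assumes "1 \<le> j" "j \<le> Suc K"
  shows "compl_word K B = filter (\<lambda>x. x \<notin> B) [1..<j] @ filter (\<lambda>x. x \<notin> B) [j..<Suc K]"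
  using assms upt_add_eq_append[of 1 j "Suc K - j"] by (simp add: compl_word_def flip: filter_append del: upt_Suc)

lemma filter_id_upt: "(\<And>x. a \<le> x \<Longrightarrow> x < b \<Longrightarrow> P x) \<Longrightarrow> filter P [a..<b] = [a..<b]"
  by (rule filter_True) auto

text \<open>The letters below \<open>j\<close> pass through the column unchanged; the letters above
  \<open>j\<close> push out what is left of the column above \<open>j\<close> and complete it
  to the full column.\<close>

lemma compl_word_merge:
  assumes "1 \<le> j" "j \<le> K" "\<forall>b\<in>B. j < b"
  shows "compl_word K B @ compl_word K {j} \<approx> compl_word K (insert j B) @ [1..<Suc K]"
proof -
  define ds where "ds = filter (\<lambda>x. x \<notin> B) [Suc j..<Suc K]"
  have B: "compl_word K B = [1..<Suc j] @ ds"
    unfolding ds_def using assms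
    by (subst compl_word_split[of "Suc j"]) (auto simp del: upt_Suc intro!: filter_id_upt)
  have J: "compl_word K {j} = [1..<j] @ [Suc j..<Suc K]"
    using assms compl_word_split[of j K "{j}"] upt_conv_Cons[of j "Suc K"]
    by (auto simp: filter_id_upt simp del: upt_Suc)
  have JB: "compl_word K (insert j B) = [1..<j] @ ds"
  proof -
    have "filter (\<lambda>x. x \<notin> insert j B) [1..<j] = [1..<j]" using assms by (intro filter_id_upt) auto
    moreover have "filter (\<lambda>x. x \<notin> insert j B) [j..<Suc K] = ds"
      using assms upt_conv_Cons[of j "Suc K"]
      by (auto simp: ds_def simp del: upt_Suc intro!: filter_cong)
    ultimately show ?thesis using assms compl_word_split[of j K "insert j B"] by simp
  qed
  have "compl_word K B @ compl_word K {j} = (compl_word K B @ [1..<j]) @ [Suc j..<Suc K]" by (simp add: J)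
  also have "\<dots> \<approx> ([1..<j] @ compl_word K B) @ [Suc j..<Suc K]"
    using assms by (intro knuth_append_right compl_word_pass) force
  also have "\<dots> = [1..<j] @ ([1..<Suc j] @ ds @ [Suc j..<Suc K])" by (simp only: B append_assoc)
  also have "\<dots> \<approx> [1..<j] @ (ds @ [1..<Suc j] @ [Suc j..<Suc K])"
  proof (intro knuth_append_left dominates_list_knuth)
    have "sorted_wrt (<) ds" unfolding ds_def by (intro sorted_wrt_filter sorted_wrt_upt)
    then show "sorted_wrt (<) ([1..<Suc j] @ ds)"
      by (auto simp: sorted_wrt_append ds_def simp del: upt_Suc)
    show "dominates_list [Suc j..<Suc K] ds"
      using \<open>sorted_wrt (<) ds\<close> by (intro dominates_imp_list) (auto simp: count_le_def ds_def simp del: upt_Suc intro!: card_mono)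
    show "sorted_wrt (<) ([1..<Suc j] @ [Suc j..<Suc K])"
      by (auto simp: sorted_wrt_append simp del: upt_Suc)
  qed
  also have "\<dots> = compl_word K (insert j B) @ [1..<Suc K]"
    using assms upt_add_eq_append[of 1 "Suc j" "K - j"] by (simp add: JB)
  finally show ?thesis .
qed

lemma full_pass: "set w \<subseteq> {1..K} \<Longrightarrow> [1..<Suc K] @ w \<approx> w @ [1..<Suc K]"
  using compl_word_pass[of w K "{}"] by (simp add: compl_word_def)

text \<open>The letters \<open>a, \<dots>, b - 1\<close> move the gap of the left factor from
  \<open>a\<close> to \<open>b\<close> and leave as \<open>a + 1, \<dots>, b\<close>; all
  other letters pass unchanged.\<close>

lemma compl_word_exchange:
  assumes "1 \<le> a" "a \<le> b" "b \<le> K" "\<forall>x\<in>B. x < a \<or> b < x"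
  shows "compl_word K {a} @ compl_word K (insert b B) \<approx> compl_word K (insert a B) @ compl_word K {b}"
proof -
  define v w where "v = filter (\<lambda>x. x \<notin> B) [1..<a]" and "w = filter (\<lambda>x. x \<notin> B) [Suc b..<Suc K]"
  have u: "[1..<Suc K] = [1..<a] @ [a..<b] @ b # [Suc b..<Suc K]"
    "[1..<Suc K] = [1..<a] @ a # [Suc a..<Suc b] @ [Suc b..<Suc K]"
    using assms upt_add_eq_append[of 1 a "Suc K - a"] upt_add_eq_append[of a b "Suc K - b"]
      upt_conv_Cons[of b "Suc K"] upt_conv_Cons[of a "Suc K"]
      upt_add_eq_append[of "Suc a" "Suc b" "K - b"]
    by (simp_all del: upt_Suc)
  have f1: "filter (\<lambda>x. x \<notin> insert b B) [1..<a] = v" "filter (\<lambda>x. x \<notin> insert a B) [1..<a] = v"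
    unfolding v_def using assms by (auto intro!: filter_cong)
  have f2: "filter (\<lambda>x. x \<notin> insert b B) [a..<b] = [a..<b]"
    "filter (\<lambda>x. x \<notin> insert a B) [Suc a..<Suc b] = [Suc a..<Suc b]"
    by (rule filter_id_upt; use assms in force)+
  have f3: "filter (\<lambda>x. x \<notin> insert b B) [Suc b..<Suc K] = w"
    "filter (\<lambda>x. x \<notin> insert a B) [Suc b..<Suc K] = w"
    unfolding w_def using assms by (auto intro!: filter_cong simp del: upt_Suc)
  have "compl_word K (insert b B) = v @ [a..<b] @ w"
    unfolding compl_word_def by (subst u(1)) (simp only: filter_append filter.simps f1 f2 f3, simp)
  moreover have "compl_word K (insert a B) = v @ [Suc a..<Suc b] @ w"
    unfolding compl_word_def by (subst u(2)) (simp only: filter_append filter.simps f1 f2 f3, simp)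
  moreover have "compl_word K {a} @ v @ [a..<b] @ w \<approx> v @ [Suc a..<Suc b] @ w @ compl_word K {b}"
    using assms by (intro compl_word_shift) (auto simp: v_def w_def)
  ultimately show ?thesis by simp
qed

lemma compl_word_triple:
  assumes "1 \<le> j" "j < k" "k \<le> K"
  shows "compl_word K {k} @ compl_word K {j} @ compl_word K {i} \<approx> compl_word K {j, k} @ compl_word K {i} @ [1..<Suc K]"
proof -
  have "(compl_word K {k} @ compl_word K {j}) @ compl_word K {i} \<approx> (compl_word K {j, k} @ [1..<Suc K]) @ compl_word K {i}"
    using assms by (intro knuth_append_right compl_word_merge) auto
  also have "\<dots> = compl_word K {j, k} @ [1..<Suc K] @ compl_word K {i}" by simp
  also have "\<dots> \<approx> compl_word K {j, k} @ compl_word K {i} @ [1..<Suc K]"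
    by (intro knuth_append_left full_pass) auto
  finally show ?thesis by simp
qed

lemma compl_word_pair_exchange:
  assumes "1 \<le> b" "b \<le> K" "1 \<le> a" "a \<le> b" "c < a \<or> b < c" "1 \<le> c" "c \<le> K"
  shows "compl_word K {a} @ compl_word K {max b c} @ compl_word K {min b c} \<approx> compl_word K {a, c} @ compl_word K {b} @ [1..<Suc K]"
proof -
  have "{min b c, max b c} = insert b {c}" by (auto simp: min_def max_def)
  then have "compl_word K {a} @ (compl_word K {max b c} @ compl_word K {min b c}) \<approx> compl_word K {a} @ (compl_word K (insert b {c}) @ [1..<Suc K])"
    using assms compl_word_merge[of "min b c" K "{max b c}"] by (intro knuth_append_left) auto
  also have "\<dots> = (compl_word K {a} @ compl_word K (insert b {c})) @ [1..<Suc K]" by simp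
  also have "\<dots> \<approx> (compl_word K (insert a {c}) @ compl_word K {b}) @ [1..<Suc K]"
    using assms by (intro knuth_append_right compl_word_exchange) auto
  finally show ?thesis by simp
qed

text \<open>Both sides contain two gaps in decreasing order, which merge and release a full column. What
  remains is an exchange of a column with one gap and a column with two gaps.\<close>

lemma compl_word_rel1:
  assumes "1 \<le> j" "j \<le> i" "i < k" "k \<le> K"
  shows "compl_word K {k} @ compl_word K {j} @ compl_word K {i} \<approx> compl_word K {j} @ compl_word K {k} @ compl_word K {i}"
  using compl_word_triple[of j k K i] knuth_sym[OF compl_word_pair_exchange[of i K j k]] assms
  by (auto simp: max_def min_def intro: knuth_trans)

lemma compl_word_rel2:
  assumes "1 \<le> j" "j < k" "k \<le> i" "i \<le> K"
  shows "compl_word K {k} @ compl_word K {j} @ compl_word K {i} \<approx> compl_word K {k} @ compl_word K {i} @ compl_word K {j}"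
  using compl_word_triple[of j k K i] knuth_sym[OF compl_word_pair_exchange[of i K k j]] assms
  by (auto simp: max_def min_def insert_commute intro: knuth_trans)

text \<open>The representation of the generators in the plactic monoid on \<open>{1..K}\<close>.\<close>

fun expand1 :: "nat \<Rightarrow> letter \<Rightarrow> nat list" where
  "expand1 K (Gen i) = [i]"
| "expand1 K (Dual i) = compl_word K {i}"

definition expand :: "nat \<Rightarrow> letter list \<Rightarrow> nat list" where
  "expand K w = concat (map (expand1 K) w)"

lemma expand_simps [simp]: "expand K [] = []" "expand K (l # w) = expand1 K l @ expand K w"
  "expand K (v @ w) = expand K v @ expand K w"
  by (simp_all add: expand_def)

definition bounded_word :: "nat \<Rightarrow> letter list \<Rightarrow> bool" where
  "bounded_word K w \<longleftrightarrow> (\<forall>l\<in>set w. 1 \<le> letter_index l \<and> letter_index l \<le> K)"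

lemma set_expand: "bounded_word K w \<Longrightarrow> set (expand K w) \<subseteq> {1..K}"
proof (induction w)
  case (Cons l w)
  then show ?case by (cases l) (auto simp: bounded_word_def)
qed simp

inductive word_rel :: "letter list \<Rightarrow> letter list \<Rightarrow> bool" where
  "\<lbrakk>1 \<le> j; j \<le> i; i < k\<rbrakk> \<Longrightarrow> word_rel [Gen i, Gen j, Gen k] [Gen i, Gen k, Gen j]"
| "\<lbrakk>1 \<le> j; j \<le> i; i < k\<rbrakk> \<Longrightarrow> word_rel [Dual k, Dual j, Dual i] [Dual j, Dual k, Dual i]"
| "\<lbrakk>1 \<le> j; j < k; k \<le> i\<rbrakk> \<Longrightarrow> word_rel [Gen i, Gen j, Gen k] [Gen j, Gen i, Gen k]"
| "\<lbrakk>1 \<le> j; j < k; k \<le> i\<rbrakk> \<Longrightarrow> word_rel [Dual k, Dual j, Dual i] [Dual k, Dual i, Dual j]"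
| "1 \<le> i \<Longrightarrow> word_rel [Gen (i + 1), Dual (i + 1)] [Dual i, Gen i]"
| "\<lbrakk>1 \<le> i; 1 \<le> j; i \<noteq> j\<rbrakk> \<Longrightarrow> word_rel [Gen i, Dual j] [Dual j, Gen i]"

lemma expand_rel: "word_rel v w \<Longrightarrow> bounded_word K v \<Longrightarrow> expand K v \<approx> expand K w"
proof (induction rule: word_rel.induct)
  case (1 j i k)
  then show ?case using knuth_rel1[of j i k "[]" "[]"] by simp
next
  case (2 j i k)
  then show ?case using compl_word_rel1[of j i k K] by (simp add: bounded_word_def)
next
  case (3 j k i)
  then show ?case using knuth_rel2[of j k i "[]" "[]"] by simp
next
  case (4 j k i)
  then show ?case using compl_word_rel2[of j k i K] by (simp add: bounded_word_def)
next
  case (5 i)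
  then show ?case using compl_word_shift1[of i K] by (simp add: bounded_word_def knuth_sym)
next
  case (6 i j)
  then show ?case using compl_word_pass[of "[i]" K "{j}"] by (simp add: bounded_word_def knuth_sym)
qed

definition insertion_tab :: "nat \<Rightarrow> letter list \<Rightarrow> nat set list" where
  "insertion_tab K w = foldl tab_ins [] (expand K w)"

lemma insertion_tab_rel: "word_rel v w \<Longrightarrow> bounded_word K v \<Longrightarrow> insertion_tab K (p @ v @ q) = insertion_tab K (p @ w @ q)"
  unfolding insertion_tab_def by (intro knuth_tab) (simp add: knuth_append expand_rel)

lemma full_column_pass:
  "set w \<subseteq> {1..K} \<Longrightarrow> foldl col_ins {1..K} w = {1..K} \<and> bumped {1..K} w = w"
proof (induction w)
  case (Cons x w)
  then have "bump {1..K} x = Some x" by (auto simp: bump_Some)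
  then show ?case using Cons by (auto simp: col_ins_def insert_absorb)
qed simp

text \<open>Every letter bumps itself in a full column.\<close>

lemma insertion_tab_full:
  assumes "1 \<le> K" "set w \<subseteq> {1..K}"
  shows "foldl tab_ins [] ([1..<Suc K] @ w) = {1..K} # foldl tab_ins [] w"
proof -
  have "foldl tab_ins [] (slist {1..K}) = [{1..K}]"
    using assms by (intro tab_word_column) auto
  moreover have "slist {1..K} = [1..<Suc K]"
    using slist_upt[of 1 "Suc K"] by (simp add: atLeastLessThanSuc_atLeastAtMost)
  ultimately show ?thesis using full_column_pass[OF assms(2)] by (simp add: tab_word_Cons del: upt_Suc)
qed

lemma insertion_tab_contract:
  assumes "1 \<le> K" "bounded_word K v" "bounded_word K w"
  shows "insertion_tab K (v @ [Gen 1, Dual 1] @ w) = {1..K} # insertion_tab K (v @ w)"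
proof -
  have "1 # compl_word K {1} = [1..<Suc K]"
    using assms upt_conv_Cons[of 1 "Suc K"] by (auto simp: compl_word_def filter_id_upt simp del: upt_Suc)
  then have "expand K (v @ [Gen 1, Dual 1] @ w) = (expand K v @ [1..<Suc K]) @ expand K w"
    by simp
  also have "\<dots> \<approx> ([1..<Suc K] @ expand K v) @ expand K w"
    using set_expand[OF assms(2)] by (intro knuth_append_right knuth_sym[OF full_pass]) auto
  finally have "insertion_tab K (v @ [Gen 1, Dual 1] @ w) =
      foldl tab_ins [] ([1..<Suc K] @ expand K v @ expand K w)"
    unfolding insertion_tab_def append_assoc by (rule knuth_tab)
  then show ?thesis
    using insertion_tab_full[OF assms(1), of "expand K v @ expand K w"] set_expand assms
    by (simp add: insertion_tab_def del: upt_Suc)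
qed

text \<open>The gaps are met in decreasing order, so they merge one after the other.\<close>

lemma expand_dual_column:
  assumes "sorted_wrt (<) as" "as \<noteq> []" "set as \<subseteq> {1..K}"
  shows "expand K (map Dual (rev as)) \<approx>
    concat (replicate (length as - 1) [1..<Suc K]) @ compl_word K (set as)"
  using assms
proof (induction as)
  case (Cons a as)
  show ?case
  proof (cases "as = []")
    case False
    define F where "F = concat (replicate (length as - 1) [1..<Suc K])"
    have "expand K (map Dual (rev (a # as))) = expand K (map Dual (rev as)) @ compl_word K {a}" by simp
    also have "\<dots> \<approx> (F @ compl_word K (set as)) @ compl_word K {a}"
      unfolding F_def using Cons False by (intro knuth_append_right) auto
    also have "\<dots> = F @ (compl_word K (set as) @ compl_word K {a})" by simp
    also have "\<dots> \<approx> F @ (compl_word K (insert a (set as)) @ [1..<Suc K])"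
      using Cons.prems by (intro knuth_append_left compl_word_merge) auto
    also have "\<dots> \<approx> F @ ([1..<Suc K] @ compl_word K (insert a (set as)))"
      by (intro knuth_append_left knuth_sym[OF full_pass]) auto
    also have "\<dots> = (F @ [1..<Suc K]) @ compl_word K (set (a # as))" by simp
    also have "F @ [1..<Suc K] = concat (replicate (length (a # as) - 1) [1..<Suc K])"
    proof -
      have "concat (replicate n xs) @ xs = xs @ concat (replicate n xs)" for n and xs :: "nat list"
        by (induction n) auto
      moreover obtain n where "length as = Suc n" using False by (cases as) auto
      ultimately show ?thesis by (simp add: F_def)
    qed
    finally show ?thesis .
  qed simp
qed simp

section \<open>Tableau pairs as chains of columns\<close>

definition is_tableau :: "tableau \<Rightarrow> bool" where
  "is_tableau T \<longleftrightarrow> T \<in> tableaux (shape T) \<and> shape T \<in> partitions"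

text \<open>A tableau is handled through the list of its columns, that is, its transpose.\<close>

definition is_column_list :: "nat list list \<Rightarrow> bool" where
  "is_column_list cs \<longleftrightarrow> (\<forall>c\<in>set cs. c \<noteq> [] \<and> sorted_wrt (<) c \<and> (\<forall>x\<in>set c. 1 \<le> x)) \<and> sorted_wrt dominates_list cs"

lemma dominates_list_nth: "dominates_list c d \<longleftrightarrow> length d \<le> length c \<and> (\<forall>i<length d. c ! i \<le> d ! i)"
proof (induction c d rule: dominates_list.induct)
  case (3 c cs d ds)
  show ?case unfolding dominates_list.simps 3 by (auto simp: nth_Cons less_Suc_eq_0_disj split: nat.split)
qed auto

lemma count_le_dominates_list:
  "dominates_list c d \<Longrightarrow> sorted_wrt (<) c \<Longrightarrow> sorted_wrt (<) d \<Longrightarrow> count_le (set d) k \<le> count_le (set c) k"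
proof (induction c d rule: dominates_list.induct)
  case (3 c cs d ds)
  have "c \<notin> set cs" "d \<notin> set ds" using 3(3,4) by auto
  then show ?case using 3 by (auto simp: count_le_insert)
qed simp_all

lemma sorted_rev_lengths_cols: "is_column_list cs \<Longrightarrow> sorted (rev (map length cs))"
  unfolding is_column_list_def
  by (auto simp: sorted_wrt_rev sorted_wrt_map dominates_list_nth elim!: sorted_wrt_mono_rel[rotated])

lemma sorted_rev_lengths_tab: "is_tableau T \<Longrightarrow> sorted (rev (map length T))"
  by (auto simp: is_tableau_def partitions_def shape_def sorted_wrt_rev sorted_wrt_map)

lemma filter_take_length:
  assumes "sorted (rev (map length xs))"
  shows "filter (\<lambda>r. j < length r) xs = take (length (filter (\<lambda>r. j < length r) xs)) xs"
  using filter_equals_takeWhile_sorted_rev[OF assms, of j] by (metis takeWhile_eq_take)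

lemma transpose_nth_nth:
  assumes "sorted (rev (map length xs))" "j < length (transpose xs)" "i < length (transpose xs ! j)"
  shows "transpose xs ! j ! i = xs ! i ! j" "i < length xs" "j < length (xs ! i)"
proof -
  let ?f = "filter (\<lambda>r. j < length r) xs"
  have i: "i < length ?f" using assms by (simp add: nth_transpose)
  moreover have "?f ! i = xs ! i"
    using i by (subst filter_take_length[OF assms(1)]) simp
  moreover have "?f ! i \<in> set ?f" using i by (rule nth_mem)
  ultimately show "transpose xs ! j ! i = xs ! i ! j" "j < length (xs ! i)"
    using assms(2) by (auto simp: nth_transpose)
  show "i < length xs" using i length_filter_le less_le_trans by blast
qed

lemma length_transpose_antimono:
  "j \<le> j' \<Longrightarrow> j' < length (transpose xs) \<Longrightarrow> length (transpose xs ! j') \<le> length (transpose xs ! j)"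
  using sorted_rev_nth_mono[OF sorted_transpose, of j j' xs] by simp

lemma transpose_nonempty: "c \<in> set (transpose xs) \<Longrightarrow> c \<noteq> []"
proof -
  assume "c \<in> set (transpose xs)"
  then obtain j where j: "j < length (transpose xs)" "c = transpose xs ! j"
    by (auto simp: in_set_conv_nth)
  then have "j < foldr (\<lambda>xs. max (length xs)) xs 0" by (simp add: length_transpose)
  then have "\<exists>r\<in>set xs. j < length r" by (induction xs) (auto simp: less_max_iff_disj)
  then show "c \<noteq> []" using j by (auto simp: nth_transpose filter_empty_conv)
qed

lemma transpose_twice:
  assumes "sorted (rev (map length xs))" "\<forall>c\<in>set xs. c \<noteq> []"
  shows "transpose (transpose xs) = xs"
  using assms by (simp add: transpose_transpose takeWhile_eq_all_conv)

lemma tab_nonempty_rows: "is_tableau T \<Longrightarrow> \<forall>r\<in>set T. r \<noteq> []"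
  by (auto simp: is_tableau_def partitions_def shape_def Suc_le_eq)

lemma tab_cols:
  assumes "is_tableau T"
  shows "is_column_list (transpose T)" "transpose (transpose T) = T"
proof -
  have s: "sorted (rev (map length T))" by (rule sorted_rev_lengths_tab[OF assms])
  have ss: "semistandard T" using assms by (simp add: is_tableau_def tableaux_def)
  have 1: "sorted_wrt (<) c \<and> (\<forall>x\<in>set c. 1 \<le> x)" if "c \<in> set (transpose T)" for c
  proof -
    from that obtain j where j: "j < length (transpose T)" "c = transpose T ! j"
      by (auto simp: in_set_conv_nth)
    note nth = transpose_nth_nth[OF s j(1), folded j(2)]
    have "sorted_wrt (<) c"
      unfolding sorted_wrt_iff_nth_Suc_transp[OF transp_on_less]
    proof (intro allI impI)
      fix i assume "Suc i < length c"
      then show "c ! i < c ! Suc i"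
        using nth[of i] nth[of "Suc i"] ss unfolding semistandard_def by auto
    qed
    moreover have "1 \<le> x" if "x \<in> set c" for x
    proof -
      from that obtain i where "i < length c" "x = c ! i" by (auto simp: in_set_conv_nth)
      then show ?thesis using nth[of i] ss unfolding semistandard_def by (metis nth_mem)
    qed
    ultimately show ?thesis by blast
  qed
  have 2: "dominates_list (transpose T ! j) (transpose T ! j')" if "j < j'" "j' < length (transpose T)" for j j'
  proof -
    have j: "j < length (transpose T)" using that by simp
    have len: "length (transpose T ! j') \<le> length (transpose T ! j)"
      using that by (intro length_transpose_antimono) auto
    show ?thesis unfolding dominates_list_nth
    proof (intro conjI allI impI len)
      fix i assume i: "i < length (transpose T ! j')"
      then have i': "i < length (transpose T ! j)" using len by simp
      have "sorted (T ! i)"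
        using ss transpose_nth_nth(2)[OF s that(2) i] unfolding semistandard_def by simp
      then show "transpose T ! j ! i \<le> transpose T ! j' ! i"
        using transpose_nth_nth[OF s that(2) i] transpose_nth_nth[OF s j i'] that(1)
        by (simp add: sorted_nth_mono)
    qed
  qed
  show "is_column_list (transpose T)"
  proof (unfold is_column_list_def, intro conjI ballI)
    show "sorted_wrt dominates_list (transpose T)" using 2 by (simp add: sorted_wrt_iff_nth_less)
  qed (use 1 transpose_nonempty in auto)
  show "transpose (transpose T) = T" by (rule transpose_twice[OF s tab_nonempty_rows[OF assms]])
qed

lemma cols_tab:
  assumes "is_column_list cs"
  shows "is_tableau (transpose cs)" "transpose (transpose cs) = cs"
proof -
  have s: "sorted (rev (map length cs))" by (rule sorted_rev_lengths_cols[OF assms])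
  let ?T = "transpose cs"
  have len: "length (?T ! j') \<le> length (?T ! j)" if "j \<le> j'" "j' < length ?T" for j j'
    using that by (rule length_transpose_antimono)
  have row: "sorted r \<and> (\<forall>a\<in>set r. 1 \<le> a)" if "r \<in> set ?T" for r
  proof -
    from that obtain i where i: "i < length ?T" "r = ?T ! i" by (auto simp: in_set_conv_nth)
    note nth = transpose_nth_nth[OF s i(1), folded i(2)]
    have "sorted r"
      unfolding sorted_iff_nth_mono_less
    proof (intro allI impI)
      fix j j' assume j: "j < j'" "j' < length r"
      then have "dominates_list (cs ! j) (cs ! j')"
        using assms nth[of j'] by (auto simp: is_column_list_def sorted_wrt_iff_nth_less)
      then show "r ! j \<le> r ! j'" using nth[of j] nth[of j'] j by (simp add: dominates_list_nth)
    qed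
    moreover have "1 \<le> a" if "a \<in> set r" for a
    proof -
      from that obtain j where "j < length r" "a = r ! j" by (auto simp: in_set_conv_nth)
      then show ?thesis using nth[of j] assms unfolding is_column_list_def by (metis nth_mem)
    qed
    ultimately show ?thesis by blast
  qed
  have col: "?T ! i ! j < ?T ! Suc i ! j" if "Suc i < length ?T" "j < length (?T ! Suc i)" for i j
  proof -
    have i: "i < length ?T" and ij: "j < length (?T ! i)" using that len[of i "Suc i"] by simp_all
    note a = transpose_nth_nth[OF s i ij] and b = transpose_nth_nth[OF s that]
    have "sorted_wrt (<) (cs ! j)" using assms a(2) by (simp add: is_column_list_def)
    then show ?thesis using a b by (simp add: sorted_wrt_iff_nth_less)
  qed
  have "sorted_wrt (\<ge>) (shape ?T)"
    unfolding shape_def sorted_wrt_map sorted_wrt_iff_nth_less using len by auto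
  then show "is_tableau ?T"
    unfolding is_tableau_def tableaux_def semistandard_def partitions_def
    using row col transpose_nonempty[of _ cs] by (auto simp: shape_def Suc_le_eq)
  show "transpose ?T = cs" using assms by (intro transpose_twice[OF s]) (simp add: is_column_list_def)
qed

lemma length_transpose_Max: "length (transpose S) = Max (insert 0 (set (shape S)))"
  unfolding length_transpose
proof (induction S)
  case (Cons r S)
  have "Max (insert 0 (set (shape (r # S)))) = max (length r) (Max (insert 0 (set (shape S))))"
    by (simp add: shape_def insert_commute[of 0])
  then show ?case using Cons by simp
qed (simp add: shape_def)

lemma transpose_conv: "transpose S = map (\<lambda>j. map (\<lambda>r. r ! j) (filter (\<lambda>r. j < length r) S)) [0..<length (transpose S)]"
  by (rule nth_equalityI) (simp_all add: nth_transpose)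

lemma comprehension_filter: "concat (map (\<lambda>r. if P r then [f r] else []) S) = map f (filter P S)"
  by (induction S) auto

lemma column_word_transpose: "column_word S = concat (rev (transpose S))"
  unfolding column_word_def length_transpose_Max[symmetric] comprehension_filter
  by (subst (2) transpose_conv) (simp add: rev_map)

lemma column_word_right_transpose:
  "column_word_right (rotate180 T) = concat (map rev (transpose T))"
proof -
  have shift_seq: "set (shape (rotate180 T)) = set (shape T)" by (simp add: shape_def rotate180_def image_image)
  have "concat (map (\<lambda>r. if j < length r then [rev r ! j] else []) (rotate180 T)) =
      rev (map (\<lambda>r. r ! j) (filter (\<lambda>r. j < length r) T))" for j
    unfolding comprehension_filter rotate180_def by (simp add: rev_map filter_map o_def rev_filter)
  then show ?thesis
    unfolding column_word_right_def shift_seq length_transpose_Max[symmetric]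
    by (subst (2) transpose_conv) (simp add: o_def)
qed

definition first_col :: "tableau \<Rightarrow> nat set" where
  "first_col T = (case transpose T of [] \<Rightarrow> {} | c # _ \<Rightarrow> set c)"

lemma card_first_col:
  assumes "is_tableau T"
  shows "card {i. i < length T \<and> T ! i ! 0 \<le> k} = count_le (first_col T) k"
proof (cases "T = []")
  case True
  then show ?thesis by (simp add: first_col_def)
next
  case False
  then have "0 < length (transpose T)"
    using tab_cols(2)[OF assms] by (cases "transpose T") auto
  then obtain c cs where c: "transpose T = c # cs" by (cases "transpose T") auto
  have "c = transpose T ! 0" by (simp add: c)
  then have c2: "c = map (\<lambda>r. r ! 0) T"
    using tab_nonempty_rows[OF assms] \<open>0 < length (transpose T)\<close>
    by (simp add: nth_transpose filter_id_conv)
  have dist: "distinct c" using tab_cols(1)[OF assms]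
    by (simp add: is_column_list_def c strict_sorted_iff)
  have "set c \<inter> {..k} = (\<lambda>i. c ! i) ` {i. i < length T \<and> T ! i ! 0 \<le> k}"
    by (auto simp: in_set_conv_nth c2 image_iff) (metis nth_mem)
  moreover have "inj_on (\<lambda>i. c ! i) {i. i < length T \<and> T ! i ! 0 \<le> k}"
    by (rule inj_on_nth[OF dist]) (simp add: c2)
  ultimately have "card (set c \<inter> {..k}) = card {i. i < length T \<and> T ! i ! 0 \<le> k}"
    by (simp add: card_image)
  then show ?thesis by (simp add: first_col_def c count_le_def)
qed

lemma basis_pairs_iff:
  "(S, T) \<in> basis_pairs \<longleftrightarrow> is_tableau S \<and> is_tableau T \<and>
    (\<forall>k\<ge>1. count_le (first_col S) k + count_le (first_col T) k \<le> k)"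
proof -
  have "(S, T) \<in> basis_pairs \<longleftrightarrow> is_tableau S \<and> is_tableau T \<and>
     (\<forall>k\<ge>1. card {i. i < length S \<and> S ! i ! 0 \<le> k} + card {i. i < length T \<and> T ! i ! 0 \<le> k} \<le> k)"
    unfolding basis_pairs_def basis_pairs_of_shape_def is_tableau_def by (auto simp: tableaux_def)
  then show ?thesis by (simp add: card_first_col cong: conj_cong)
qed

definition pair_word :: "tableau_pair \<Rightarrow> letter list" where
  "pair_word b = map Gen (concat (rev (transpose (fst b)))) @
     map Dual (concat (map rev (transpose (snd b))))"

lemma set_pair_word:
  "set (pair_word b) = Gen ` \<Union> (set ` set (transpose (fst b))) \<union> Dual ` \<Union> (set ` set (transpose (snd b)))"
  by (simp add: pair_word_def)

lemma pair_word_cols: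
  assumes "b \<in> basis_pairs" "\<forall>l\<in>set (pair_word b). letter_index l < K"
    and "c \<in> set (transpose (fst b)) \<union> set (transpose (snd b))"
  shows "set c \<subseteq> {1..<K}"
proof
  fix x assume x: "x \<in> set c"
  have "is_column_list (transpose (fst b))" "is_column_list (transpose (snd b))"
    using assms(1) tab_cols by (cases b; simp add: basis_pairs_iff)+
  then have "1 \<le> x" using assms(3) x unfolding is_column_list_def by blast
  moreover have "Gen x \<in> set (pair_word b) \<or> Dual x \<in> set (pair_word b)"
    using assms(3) x unfolding set_pair_word by blast
  then have "x < K" using assms(2) by force
  ultimately show "x \<in> {1..<K}" by simp
qed

definition pair_tab :: "nat \<Rightarrow> tableau_pair \<Rightarrow> nat set list" where
  "pair_tab K b = map (\<lambda>c. {1..K} - set c) (rev (transpose (snd b))) @ map set (transpose (fst b))"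

lemma reading_append: "reading (\<sigma> @ \<tau>) = reading \<tau> @ reading \<sigma>"
  by (simp add: reading_def)

lemma expand_map_Gen: "expand K (map Gen w) = w"
  by (induction w) auto

lemma full_power_pass:
  "set w \<subseteq> {1..K} \<Longrightarrow> w @ concat (replicate n [1..<Suc K]) \<approx> concat (replicate n [1..<Suc K]) @ w"
proof (induction n)
  case (Suc n)
  let ?F = "[1..<Suc K]"
  have "w @ concat (replicate (Suc n) ?F) = (w @ ?F) @ concat (replicate n ?F)" by simp
  also have "\<dots> \<approx> (?F @ w) @ concat (replicate n ?F)"
    by (intro knuth_append_right knuth_sym[OF full_pass] Suc.prems)
  also have "\<dots> = ?F @ (w @ concat (replicate n ?F))" by simp
  also have "\<dots> \<approx> ?F @ (concat (replicate n ?F) @ w)" by (intro knuth_append_left Suc)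
  finally show ?case by simp
qed simp

lemma expand_dual_columns:
  assumes "\<forall>c\<in>set cs. c \<noteq> [] \<and> sorted_wrt (<) c \<and> set c \<subseteq> {1..K}"
  shows "\<exists>n. expand K (map Dual (concat (map rev cs))) \<approx>
    concat (replicate n [1..<Suc K]) @ concat (map (\<lambda>c. compl_word K (set c)) cs)"
  using assms
proof (induction cs)
  case Nil
  show ?case by (rule exI[of _ 0]) simp
next
  case (Cons c cs)
  let ?F = "\<lambda>n. concat (replicate n [1..<Suc K])"
  from Cons obtain n where n: "expand K (map Dual (concat (map rev cs))) \<approx>
    ?F n @ concat (map (\<lambda>c. compl_word K (set c)) cs)" (is "_ \<approx> _ @ ?w") by auto
  define m where "m = length c - 1"
  have "expand K (map Dual (concat (map rev (c # cs)))) =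
      expand K (map Dual (rev c)) @ expand K (map Dual (concat (map rev cs)))" by simp
  also have "\<dots> \<approx> (?F m @ compl_word K (set c)) @ (?F n @ ?w)"
    unfolding m_def using Cons.prems by (intro knuth_append n expand_dual_column) auto
  also have "\<dots> = ?F m @ (compl_word K (set c) @ ?F n) @ ?w" by simp
  also have "\<dots> \<approx> ?F m @ (?F n @ compl_word K (set c)) @ ?w"
    by (intro knuth_append_left knuth_append_right full_power_pass) auto
  also have "\<dots> = ?F (m + n) @ concat (map (\<lambda>c. compl_word K (set c)) (c # cs))"
    by (simp add: replicate_add)
  finally show ?case by blast
qed

lemma insertion_tab_full_power:
  "1 \<le> K \<Longrightarrow> set w \<subseteq> {1..K} \<Longrightarrow>
    foldl tab_ins [] (concat (replicate n [1..<Suc K]) @ w) = replicate n {1..K} @ foldl tab_ins [] w"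
proof (induction n)
  case (Suc n)
  have "set (concat (replicate n [1..<Suc K]) @ w) \<subseteq> {1..K}" using Suc.prems by auto
  from insertion_tab_full[OF Suc.prems(1) this] show ?case using Suc by (simp del: upt_Suc)
qed simp

lemma count_le_Diff: "A \<subseteq> {1..K} \<Longrightarrow> count_le ({1..K} - A) k = min k K - count_le A k"
proof -
  assume "A \<subseteq> {1..K}"
  then have "({1..K} - A) \<inter> {..k} = {1..min k K} - A \<inter> {..k}" "A \<inter> {..k} \<subseteq> {1..min k K}" by auto
  then show ?thesis by (simp add: count_le_def card_Diff_subset)
qed

lemma successively_append_iff_last_hd:
  "successively P (xs @ ys) \<longleftrightarrow> successively P xs \<and> successively P ys
     \<and> (xs \<noteq> [] \<longrightarrow> ys \<noteq> [] \<longrightarrow> P (last xs) (hd ys))"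
  by (auto simp: successively_append_iff)

text \<open>The bound on the letters keeps \<open>K\<close> in every complement of a column of
  \<open>T\<close> and out of every column of \<open>S\<close>, so none of these columns is
  full: the full columns in the insertion tableau are exactly those released by the dual
  letters.\<close>

theorem insertion_tab_pair_word:
  assumes b: "b \<in> basis_pairs" and K: "\<forall>l\<in>set (pair_word b). letter_index l < K" "1 \<le> K"
  shows "filter (\<lambda>C. C \<noteq> {1..K}) (insertion_tab K (pair_word b)) = pair_tab K b"
proof -
  obtain S T where ST: "b = (S, T)" by (cases b)
  define cs ds where "cs = transpose S" and "ds = transpose T"
  have cs: "is_column_list cs" and ds: "is_column_list ds"
    and res: "\<And>k. k \<ge> 1 \<Longrightarrow> count_le (first_col S) k + count_le (first_col T) k \<le> k"
    using b tab_cols by (auto simp: ST basis_pairs_iff cs_def ds_def)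
  have csK: "set c \<subseteq> {1..<K}" if "c \<in> set cs" for c
    using pair_word_cols[OF b K(1), of c] that by (simp add: ST cs_def)
  have dsK: "set c \<subseteq> {1..<K}" if "c \<in> set ds" for c
    using pair_word_cols[OF b K(1), of c] that by (simp add: ST ds_def)
  have dsK_le: "\<forall>c\<in>set ds. set c \<subseteq> {1..K}"
  proof
    fix c assume "c \<in> set ds"
    then show "set c \<subseteq> {1..K}" using dsK[of c] by auto
  qed
  have pt: "pair_tab K b = map (\<lambda>c. {1..K} - set c) (rev ds) @ map set cs"
    by (simp add: pair_tab_def ST cs_def ds_def)
  have nonempty: "finite D \<and> D \<noteq> {} \<and> D \<noteq> {1..K}" if "D \<in> set (pair_tab K b)" for D
  proof -
    from that consider c where "c \<in> set ds" "D = {1..K} - set c" | c where "c \<in> set cs" "D = set c"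
      by (auto simp: pt)
    then show ?thesis
    proof cases
      case 1
      have "c \<noteq> []" using 1 ds by (simp add: is_column_list_def)
      then have "hd c \<in> set c" by simp
      then have "hd c \<in> {1..<K}" "hd c \<notin> D" using dsK[OF 1(1)] 1(2) by blast+
      then have "hd c \<in> {1..K}" "hd c \<notin> D" by simp_all
      moreover have "K \<notin> set c" using dsK[OF 1(1)] by auto
      then have "K \<in> D" unfolding 1(2) using K(2) by simp
      moreover have "finite D" unfolding 1(2) by simp
      ultimately show ?thesis by blast
    next
      case 2
      then have "K \<notin> D" using csK[OF 2(1)] by auto
      moreover have "K \<in> {1..K}" using K(2) by simp
      moreover have "finite D \<and> D \<noteq> {}" using 2 cs by (simp add: is_column_list_def)
      ultimately show ?thesis by blast
    qed
  qed
  have chain: "successively dominates (pair_tab K b)"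
  proof -
    have "sorted_wrt (\<lambda>c d. dominates (set c) (set d)) cs"
      using cs by (auto simp: is_column_list_def dominates_def intro!: count_le_dominates_list elim!: sorted_wrt_mono_rel[rotated])
    then have 1: "successively dominates (map set cs)"
      by (auto simp: successively_map intro: successively_if_sorted_wrt)
    have "sorted_wrt (\<lambda>c d. dominates ({1..K} - set d) ({1..K} - set c)) ds"
    proof (rule sorted_wrt_mono_rel)
      show "sorted_wrt dominates_list ds" using ds by (simp add: is_column_list_def)
      fix c d assume cd: "c \<in> set ds" "d \<in> set ds" "dominates_list c d"
      then have "set c \<subseteq> {1..K}" "set d \<subseteq> {1..K}" using dsK[of c] dsK[of d] by auto
      moreover have "count_le (set d) k \<le> count_le (set c) k" for k
        using cd ds by (intro count_le_dominates_list) (auto simp: is_column_list_def)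
      ultimately show "dominates ({1..K} - set d) ({1..K} - set c)"
        by (simp add: dominates_def count_le_Diff diff_le_mono2 del: One_nat_def)
    qed
    then have 2: "successively dominates (map (\<lambda>c. {1..K} - set c) (rev ds))"
      by (auto simp: successively_map successively_rev intro: successively_if_sorted_wrt)
    have 3: "dominates ({1..K} - set d) (set c)" if "ds = d # ds'" "cs = c # cs'" for c d cs' ds'
      unfolding dominates_def
    proof
      fix k
      have fc: "first_col S = set c" "first_col T = set d"
        using that by (simp_all add: first_col_def cs_def ds_def)
      have sub: "set c \<subseteq> {1..<K}" "set d \<subseteq> {1..<K}" using csK[of c] dsK[of d] that by auto
      have "count_le (set c) k = count_le (set c) (min k K)" "count_le (set d) k = count_le (set d) (min k K)"
        unfolding count_le_def using sub by (auto intro!: arg_cong[where f = card])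
      moreover have "count_le (set c) (min k K) + count_le (set d) (min k K) \<le> min k K"
      proof (cases "min k K = 0")
        case True
        then have "set c \<inter> {..min k K} = {}" "set d \<inter> {..min k K} = {}" using sub by auto
        then show ?thesis by (simp add: count_le_def)
      qed (use res[of "min k K"] fc in auto)
      moreover have "set d \<subseteq> {1..K}" using sub by auto
      then have "count_le ({1..K} - set d) k = min k K - count_le (set d) k" by (rule count_le_Diff)
      ultimately show "count_le (set c) k \<le> count_le ({1..K} - set d) k" by linarith
    qed
    have "dominates (last (map (\<lambda>c. {1..K} - set c) (rev ds))) (hd (map set cs))" if "ds \<noteq> []" "cs \<noteq> []"
      using that 3 by (cases ds; cases cs) auto
    then show ?thesis unfolding pt successively_append_iff_last_hd using 1 2 by simp
  qed
  have "map (\<lambda>c. slist (set c)) cs = cs"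
    using cs by (intro map_idI slist_unique) (auto simp: is_column_list_def)
  then have r1: "reading (map set cs) = concat (rev cs)"
    unfolding reading_def rev_map[symmetric] map_map o_def by simp
  have r2: "reading (map (\<lambda>c. {1..K} - set c) (rev ds)) = concat (map (\<lambda>c. compl_word K (set c)) ds)"
    unfolding reading_def rev_map[symmetric] rev_rev_ident map_map o_def slist_compl_word ..
  obtain n where n: "expand K (map Dual (concat (map rev ds))) \<approx>
      concat (replicate n [1..<Suc K]) @ concat (map (\<lambda>c. compl_word K (set c)) ds)"
    using expand_dual_columns[of ds K] dsK_le ds unfolding is_column_list_def by blast
  let ?F = "concat (replicate n [1..<Suc K])"
  have sub: "set (concat (rev cs)) \<subseteq> {1..K}"
  proof
    fix x assume "x \<in> set (concat (rev cs))"
    then obtain c where "c \<in> set cs" "x \<in> set c" by auto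
    then show "x \<in> {1..K}" using csK[of c] by auto
  qed
  have "expand K (pair_word b) = concat (rev cs) @ expand K (map Dual (concat (map rev ds)))"
    by (simp add: pair_word_def ST cs_def ds_def expand_map_Gen)
  also have "\<dots> \<approx> concat (rev cs) @ (?F @ concat (map (\<lambda>c. compl_word K (set c)) ds))"
    by (intro knuth_append_left n)
  also have "\<dots> = (concat (rev cs) @ ?F) @ concat (map (\<lambda>c. compl_word K (set c)) ds)" by simp
  also have "\<dots> \<approx> (?F @ concat (rev cs)) @ concat (map (\<lambda>c. compl_word K (set c)) ds)"
    by (intro knuth_append_right full_power_pass sub)
  also have "\<dots> = ?F @ reading (pair_tab K b)" by (simp add: pt reading_append r1 r2 del: One_nat_def)
  finally have "insertion_tab K (pair_word b) = foldl tab_ins [] (?F @ reading (pair_tab K b))"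
    unfolding insertion_tab_def by (rule knuth_tab)
  also have "\<dots> = replicate n {1..K} @ foldl tab_ins [] (reading (pair_tab K b))"
    using sub by (intro insertion_tab_full_power K) (auto simp: pt reading_append r1 r2 simp del: One_nat_def)
  also have "foldl tab_ins [] (reading (pair_tab K b)) = pair_tab K b"
    using chain nonempty by (intro tab_word_reading) auto
  finally show ?thesis using nonempty by (simp add: filter_id_conv)
qed

text \<open>Whether a column comes from \<open>S\<close> or from \<open>T\<close> is decided by the
  entry \<open>K\<close>.\<close>

lemma pair_tab_inj:
  assumes "b \<in> basis_pairs" "b' \<in> basis_pairs" "pair_tab K b = pair_tab K b'" "1 \<le> K"
    and "\<forall>l\<in>set (pair_word b). letter_index l < K" "\<forall>l\<in>set (pair_word b'). letter_index l < K"
  shows "b = b'"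
proof -
  define f where "f = (\<lambda>b :: tableau_pair. map (\<lambda>c. {1..K} - set c) (rev (transpose (snd b))))"
  define g where "g = (\<lambda>b :: tableau_pair. map set (transpose (fst b)))"
  have cols: "is_column_list (transpose (fst b))" "is_column_list (transpose (snd b))"
    "transpose (transpose (fst b)) = fst b" "transpose (transpose (snd b)) = snd b"
    if "b \<in> basis_pairs" for b
    using that tab_cols by (cases b; auto simp: basis_pairs_iff)+
  have sub: "\<forall>c\<in>set (transpose (fst b)) \<union> set (transpose (snd b)). set c \<subseteq> {1..<K}"
    if "b \<in> basis_pairs" "\<forall>l\<in>set (pair_word b). letter_index l < K" for b
    using pair_word_cols[OF that] by blast
  have split: "filter (\<lambda>C. K \<in> C) (pair_tab K b) = f b \<and> filter (\<lambda>C. K \<notin> C) (pair_tab K b) = g b"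
    if "b \<in> basis_pairs" and that': "\<forall>l\<in>set (pair_word b). letter_index l < K" for b
  proof -
    have "K \<in> C" if "C \<in> set (f b)" for C
    proof -
      from that obtain c where c: "c \<in> set (transpose (snd b))" "C = {1..K} - set c"
        by (auto simp: f_def)
      then have "set c \<subseteq> {1..<K}" using sub[OF \<open>b \<in> basis_pairs\<close>] that' by blast
      then have "K \<notin> set c" by auto
      then show ?thesis using c(2) assms(4) by simp
    qed
    moreover have "K \<notin> C" if "C \<in> set (g b)" for C
    proof -
      from that obtain c where c: "c \<in> set (transpose (fst b))" "C = set c"
        by (auto simp: g_def)
      then have "set c \<subseteq> {1..<K}" using sub[OF \<open>b \<in> basis_pairs\<close>] that' by blast
      then show ?thesis using c(2) by auto
    qed
    moreover have "pair_tab K b = f b @ g b" by (simp add: pair_tab_def f_def g_def)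
    ultimately show ?thesis by (simp add: filter_id_conv filter_empty_conv)
  qed
  have "f b = f b'" "g b = g b'" using split[of b] split[of b'] assms by metis+
  have inj: "inj_on set {c. sorted_wrt (<) (c :: nat list)}"
    by (auto simp: inj_on_def intro: strict_sorted_equal)
  have "transpose (fst b) = transpose (fst b')"
    using \<open>g b = g b'\<close> cols(1)[OF assms(1)] cols(1)[OF assms(2)] unfolding g_def
    by (intro map_inj_on[of set]) (auto simp: is_column_list_def intro!: inj_on_subset[OF inj])
  moreover have "rev (transpose (snd b)) = rev (transpose (snd b'))"
  proof (rule map_inj_on)
    show "map (\<lambda>c. {1..K} - set c) (rev (transpose (snd b))) =
        map (\<lambda>c. {1..K} - set c) (rev (transpose (snd b')))"
      using \<open>f b = f b'\<close> by (simp add: f_def)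
    let ?X = "set (rev (transpose (snd b))) \<union> set (rev (transpose (snd b')))"
    have X: "sorted_wrt (<) c \<and> set c \<subseteq> {1..K}" if "c \<in> ?X" for c
    proof -
      from that have "c \<in> set (transpose (snd b)) \<or> c \<in> set (transpose (snd b'))" by auto
      then have "sorted_wrt (<) c" "set c \<subseteq> {1..<K}"
        using cols(2)[OF assms(1)] cols(2)[OF assms(2)] sub[OF assms(1,5)] sub[OF assms(2,6)]
        unfolding is_column_list_def by blast+
      then show ?thesis by auto
    qed
    show "inj_on (\<lambda>c. {1..K} - set c) ?X"
    proof (rule inj_onI)
      fix c d assume "c \<in> ?X" "d \<in> ?X" "{1..K} - set c = {1..K} - set d"
      then have "set c = set d" using X[of c] X[of d] by blast
      then show "c = d" using X \<open>c \<in> ?X\<close> \<open>d \<in> ?X\<close> by (auto intro: strict_sorted_equal)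
    qed
  qed
  ultimately show ?thesis
    using cols(3,4)[OF assms(1)] cols(3,4)[OF assms(2)] by (metis prod_eqI rev_rev_ident)
qed

section \<open>Linear independence of the tableau basis\<close>

definition valid :: "letter list \<Rightarrow> bool" where
  "valid w \<longleftrightarrow> (\<forall>l\<in>set w. 1 \<le> letter_index l)"

lemma valid_simps [simp]: "valid []" "valid (l # w) \<longleftrightarrow> 1 \<le> letter_index l \<and> valid w"
  "valid (v @ w) \<longleftrightarrow> valid v \<and> valid w"
  by (auto simp: valid_def)

definition word_val :: "letter list \<Rightarrow> ualg" where
  "word_val w = prod_list (map gen w)"

lemma word_val_simps: "word_val [] = 1" "word_val (l # w) = gen l * word_val w" "word_val (v @ w) = word_val v * word_val w"
  by (simp_all add: word_val_def)

definition fword :: "letter list \<Rightarrow> free_alg" where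
  "fword w = Poly_Mapping.single (Abs_gword w) 1"

lemma Rep_Abs_gword: "valid w \<Longrightarrow> Rep_gword (Abs_gword w) = w"
  by (simp add: Abs_gword_inverse valid_def)

lemma valid_Rep: "valid (Rep_gword w)"
  using Rep_gword[of w] by (simp add: valid_def)

lemma Abs_gword_append: "valid v \<Longrightarrow> valid w \<Longrightarrow> Abs_gword v + Abs_gword w = Abs_gword (v @ w)"
  by (metis Rep_Abs_gword Rep_gword_inverse plus_gword.rep_eq)

lemma Abs_gword_Nil: "Abs_gword [] = 0"
  by (metis Rep_gword_inverse zero_gword.rep_eq)

lemma fword_append: "valid v \<Longrightarrow> valid w \<Longrightarrow> fword v * fword w = fword (v @ w)"
  by (simp add: fword_def mult_single Abs_gword_append)

lemma fword_Nil: "fword [] = 1"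
  by (simp add: fword_def Abs_gword_Nil)

lemma abs_ualg_mult: "abs_ualg (x * y) = abs_ualg x * abs_ualg y"
  by (simp add: times_ualg.abs_eq)

lemma abs_ualg_add: "abs_ualg (x + y) = abs_ualg x + abs_ualg y"
  by (simp add: plus_ualg.abs_eq)

lemma abs_ualg_sum: "abs_ualg (sum f A) = (\<Sum>a\<in>A. abs_ualg (f a))"
  by (induction A rule: infinite_finite_induct) (simp_all add: abs_ualg_add zero_ualg_def[symmetric])

lemma word_val_fword: "valid w \<Longrightarrow> word_val w = abs_ualg (fword w)"
proof (induction w)
  case Nil
  then show ?case by (simp add: word_val_simps fword_Nil one_ualg_def)
next
  case (Cons l w)
  then have "fword (l # w) = free_gen l * fword w"
    using fword_append[of "[l]" w] by (simp add: free_gen_def fword_def)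
  then show ?case using Cons by (simp add: word_val_simps abs_ualg_mult gen_def)
qed

lemma fword_free_gen:
  "valid [a, b] \<Longrightarrow> free_gen a * free_gen b = fword [a, b]"
  "valid [a, b, c] \<Longrightarrow> free_gen a * free_gen b * free_gen c = fword [a, b, c]"
proof -
  have *: "free_gen l = fword [l]" for l by (simp add: free_gen_def fword_def)
  show "valid [a, b] \<Longrightarrow> free_gen a * free_gen b = fword [a, b]"
    unfolding * using fword_append[of "[a]" "[b]"] by simp
  show "valid [a, b, c] \<Longrightarrow> free_gen a * free_gen b * free_gen c = fword [a, b, c]"
    unfolding * using fword_append[of "[a]" "[b]"] fword_append[of "[a, b]" "[c]"] by simp
qed

lemma word_rel_def_rel: "word_rel v w \<Longrightarrow> def_rel (fword v) (fword w)"
  by (induction rule: word_rel.induct)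
    (simp_all add: fword_free_gen[symmetric] def_rel.intros del: One_nat_def)

lemma word_rel_valid: "word_rel v w \<Longrightarrow> valid v \<and> valid w"
  by (induction rule: word_rel.induct) auto

lemma def_rel_cases_word:
  assumes "def_rel p q"
  shows "(\<exists>v w. word_rel v w \<and> p = fword v \<and> q = fword w) \<or>
    p = fword [Gen 1, Dual 1] \<and> q = free_scalar t_laurent"
proof -
  have *: ?thesis if "word_rel v w" "p = fword v" "q = fword w" for v w using that by blast
  from assms show ?thesis
  proof cases
    case (1 j i k)
    show ?thesis
      by (rule *[OF word_rel.intros(1)[of j i k]]) (use 1 in \<open>simp_all add: fword_free_gen(2)\<close>)
  next
    case (2 j i k)
    show ?thesis
      by (rule *[OF word_rel.intros(2)[of j i k]]) (use 2 in \<open>simp_all add: fword_free_gen(2)\<close>)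
  next
    case (3 j k i)
    show ?thesis
      by (rule *[OF word_rel.intros(3)[of j k i]]) (use 3 in \<open>simp_all add: fword_free_gen(2)\<close>)
  next
    case (4 j k i)
    show ?thesis
      by (rule *[OF word_rel.intros(4)[of j k i]]) (use 4 in \<open>simp_all add: fword_free_gen(2)\<close>)
  next
    case (5 i)
    show ?thesis
      by (rule *[OF word_rel.intros(5)[of i]]) (use 5 in \<open>simp_all add: fword_free_gen(1)\<close>)
  next
    case 6
    then show ?thesis by (simp add: fword_free_gen(1))
  next
    case (7 i j)
    show ?thesis
      by (rule *[OF word_rel.intros(6)[of i j]]) (use 7 in \<open>simp_all add: fword_free_gen(1)\<close>)
  qed
qed

lemma abs_ualg_rel: "def_rel p q \<Longrightarrow> abs_ualg p = abs_ualg q"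
  using rel_ideal.rel[of p q 1 1] by (simp add: ualg.abs_eq_iff)

lemma word_val_rel: "word_rel v w \<Longrightarrow> word_val v = word_val w"
  using abs_ualg_rel[OF word_rel_def_rel] word_rel_valid by (simp add: word_val_fword)

lemma word_val_contract: "word_val [Gen 1, Dual 1] = scalar t_laurent"
  using abs_ualg_rel[OF def_rel.intros(6)] by (simp add: word_val_fword scalar_def fword_free_gen)

lemma poly_sum_single: "x = (\<Sum>w\<in>Poly_Mapping.keys x. Poly_Mapping.single w (Poly_Mapping.lookup x w))"
  by (rule poly_mapping_eqI) (simp add: lookup_sum lookup_single when_def in_keys_iff)

lemma free_scalar_central: "free_scalar c * x = x * free_scalar c"
proof -
  have "free_scalar c * (\<Sum>w\<in>Poly_Mapping.keys x. Poly_Mapping.single w (Poly_Mapping.lookup x w)) =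
      (\<Sum>w\<in>Poly_Mapping.keys x. Poly_Mapping.single w (Poly_Mapping.lookup x w)) * free_scalar c"
    unfolding sum_distrib_left sum_distrib_right
    by (intro sum.cong) (auto simp: free_scalar_def mult_single mult.commute)
  then show ?thesis by (simp flip: poly_sum_single)
qed

lemma ualg_abs: "\<exists>y. x = abs_ualg y"
  by (induct x rule: ualg.abs_induct) auto

lemma scalar_central: "scalar c * x = x * scalar c"
proof -
  obtain y where "x = abs_ualg y" using ualg_abs by blast
  then show ?thesis by (simp add: scalar_def free_scalar_central flip: abs_ualg_mult)
qed

lemma scalar_simps: "scalar 0 = 0" "scalar 1 = 1" "scalar (c + d) = scalar c + scalar d"
  "scalar (c * d) = scalar c * scalar d"
  by (simp_all add: scalar_def free_scalar_def zero_ualg_def one_ualg_def single_add mult_single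
      flip: abs_ualg_add abs_ualg_mult)

lemma abs_single: "abs_ualg (Poly_Mapping.single w c) = scalar c * word_val (Rep_gword w)"
proof -
  have "Poly_Mapping.single w c = free_scalar c * fword (Rep_gword w)"
    by (simp add: free_scalar_def fword_def mult_single Rep_gword_inverse)
  then show ?thesis by (simp add: scalar_def word_val_fword valid_Rep abs_ualg_mult)
qed

lemma ualg_word_sum: "\<exists>W c. finite W \<and> (\<forall>w\<in>W. valid w) \<and> x = (\<Sum>w\<in>W. scalar (c w) * word_val w)"
proof -
  obtain y where abs_eq: "x = abs_ualg y" using ualg_abs by blast
  let ?W = "Rep_gword ` Poly_Mapping.keys y"
  have "abs_ualg y = (\<Sum>w\<in>Poly_Mapping.keys y. scalar (Poly_Mapping.lookup y w) * word_val (Rep_gword w))"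
    by (subst poly_sum_single[of y]) (simp add: abs_ualg_sum abs_single)
  also have "\<dots> = (\<Sum>w\<in>?W. scalar (Poly_Mapping.lookup y (Abs_gword w)) * word_val w)"
    by (subst sum.reindex) (auto simp: inj_on_def Rep_gword_inject Rep_gword_inverse)
  finally show ?thesis using abs_eq valid_Rep
    by (intro exI[of _ ?W] exI[of _ "\<lambda>w. Poly_Mapping.lookup y (Abs_gword w)"]) auto
qed

lemma valid_pair_word: "b \<in> basis_pairs \<Longrightarrow> valid (pair_word b)"
proof -
  assume b: "b \<in> basis_pairs"
  then have "is_column_list (transpose (fst b))" "is_column_list (transpose (snd b))"
    using tab_cols by (cases b; simp add: basis_pairs_iff)+
  then show ?thesis unfolding valid_def set_pair_word is_column_list_def by auto
qed

lemma u_pair_word_val: "u_pair b = word_val (pair_word b)"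
  by (simp add: u_pair_def word_val_def pair_word_def column_word_transpose column_word_right_transpose o_def)

text \<open>Full columns are removed from the insertion tableau and recorded as powers of
  \<open>t\<close>.\<close>

definition tab_functional_word :: "nat \<Rightarrow> nat set list \<Rightarrow> letter list \<Rightarrow> laurent" where
  "tab_functional_word K \<tau> w = (if filter (\<lambda>C. C \<noteq> {1..K}) (insertion_tab K w) = \<tau>
     then t_laurent ^ length (filter (\<lambda>C. C = {1..K}) (insertion_tab K w)) else 0)"

definition tab_functional :: "nat \<Rightarrow> nat set list \<Rightarrow> free_alg \<Rightarrow> laurent" where
  "tab_functional K \<tau> x = (\<Sum>w\<in>Poly_Mapping.keys x. Poly_Mapping.lookup x w * tab_functional_word K \<tau> (Rep_gword w))"

lemma tab_functional_superset:
  assumes "finite W" "Poly_Mapping.keys x \<subseteq> W"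
  shows "tab_functional K \<tau> x = (\<Sum>w\<in>W. Poly_Mapping.lookup x w * tab_functional_word K \<tau> (Rep_gword w))"
  unfolding tab_functional_def using assms
  by (intro sum.mono_neutral_left) (auto simp: in_keys_iff)

lemma tab_functional_add: "tab_functional K \<tau> (x + y) = tab_functional K \<tau> x + tab_functional K \<tau> y"
proof -
  let ?W = "Poly_Mapping.keys x \<union> Poly_Mapping.keys y"
  have "tab_functional K \<tau> (x + y) = (\<Sum>w\<in>?W. Poly_Mapping.lookup (x + y) w * tab_functional_word K \<tau> (Rep_gword w))"
    by (rule tab_functional_superset) (auto simp: Poly_Mapping.keys_add)
  also have "\<dots> = tab_functional K \<tau> x + tab_functional K \<tau> y"
    by (simp add: lookup_add distrib_right sum.distrib tab_functional_superset[of ?W x] tab_functional_superset[of ?W y])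
  finally show ?thesis .
qed

lemma tab_functional_zero [simp]: "tab_functional K \<tau> 0 = 0"
  by (simp add: tab_functional_def)

lemma tab_functional_sum: "tab_functional K \<tau> (sum f A) = (\<Sum>a\<in>A. tab_functional K \<tau> (f a))"
  by (induction A rule: infinite_finite_induct) (simp_all add: tab_functional_add)

lemma tab_functional_diff: "tab_functional K \<tau> (x - y) = tab_functional K \<tau> x - tab_functional K \<tau> y"
  using tab_functional_add[of K \<tau> "x - y" y] by simp

lemma tab_functional_single: "tab_functional K \<tau> (Poly_Mapping.single w c) = c * tab_functional_word K \<tau> (Rep_gword w)"
  by (subst tab_functional_superset[of "{w}"]) auto

lemma Rep_gword_add: "Rep_gword (v + w) = Rep_gword v @ Rep_gword w"
  by (rule plus_gword.rep_eq)

lemma tab_functional_word_rel: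
  assumes "word_rel v w" "bounded_word K v"
  shows "tab_functional_word K \<tau> (p @ v @ q) = tab_functional_word K \<tau> (p @ w @ q)"
  unfolding tab_functional_word_def insertion_tab_rel[OF assms] ..

lemma tab_functional_word_contract:
  assumes "1 \<le> K" "bounded_word K p" "bounded_word K q"
  shows "tab_functional_word K \<tau> (p @ [Gen 1, Dual 1] @ q) = t_laurent * tab_functional_word K \<tau> (p @ q)"
  unfolding tab_functional_word_def insertion_tab_contract[OF assms] by simp

lemma tab_functional_def_rel:
  assumes "def_rel p q" "1 \<le> K"
    and "\<forall>w\<in>Poly_Mapping.keys x \<union> Poly_Mapping.keys y \<union> Poly_Mapping.keys p. bounded_word K (Rep_gword w)"
  shows "tab_functional K \<tau> (x * (p - q) * y) = 0"
proof -
  let ?s = "\<lambda>x w. Poly_Mapping.single w (Poly_Mapping.lookup x w)"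
  have main: "tab_functional K \<tau> (?s x a * (p - q) * ?s y b) = 0"
    if "a \<in> Poly_Mapping.keys x" "b \<in> Poly_Mapping.keys y" for a b
    using def_rel_cases_word[OF assms(1)]
  proof (elim disjE exE conjE)
    fix v w assume vw: "word_rel v w" "p = fword v" "q = fword w"
    have val: "valid v" "valid w" using word_rel_valid[OF vw(1)] by auto
    then have "bounded_word K v" using assms(3) by (auto simp: vw fword_def Rep_Abs_gword)
    then show ?thesis
      by (simp add: vw fword_def right_diff_distrib left_diff_distrib mult_single tab_functional_diff tab_functional_single
          Rep_gword_add Rep_Abs_gword val tab_functional_word_rel[OF vw(1)])
  next
    assume pq: "p = fword [Gen 1, Dual 1]" "q = free_scalar t_laurent"
    have "bounded_word K (Rep_gword a)" "bounded_word K (Rep_gword b)" using assms(3) that by auto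
    then show ?thesis
      using tab_functional_word_contract[OF assms(2), of "Rep_gword a" "Rep_gword b" \<tau>]
      by (simp add: pq fword_def free_scalar_def right_diff_distrib left_diff_distrib mult_single
          tab_functional_diff tab_functional_single Rep_gword_add Rep_Abs_gword mult_ac)
  qed
  have "x * (p - q) * y = (\<Sum>a\<in>Poly_Mapping.keys x. \<Sum>b\<in>Poly_Mapping.keys y. ?s x a * (p - q) * ?s y b)"
    by (subst (1) poly_sum_single[of x], subst (1) poly_sum_single[of y])
      (simp add: sum_distrib_left sum_distrib_right, rule sum.swap)
  then show ?thesis using main by (simp add: tab_functional_sum)
qed

lemma bounded_word_finite:
  "finite W \<Longrightarrow> \<exists>K0. \<forall>K\<ge>K0. \<forall>w\<in>W. bounded_word K (Rep_gword w)"
proof -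
  assume W: "finite W"
  let ?L = "letter_index ` (\<Union>w\<in>W. set (Rep_gword w))"
  have "finite ?L" using W by auto
  then obtain K0 where K0: "\<forall>i\<in>?L. i \<le> K0" using finite_nat_set_iff_bounded_le by auto
  have "bounded_word K (Rep_gword w)" if "K \<ge> K0" "w \<in> W" for K w
    using K0 that valid_Rep[of w] unfolding bounded_word_def valid_def by fastforce
  then show ?thesis by blast
qed

text \<open>The relation \<open>u\<^sub>i\<^sub>+\<^sub>1 v\<^sub>i\<^sub>+\<^sub>1 = v\<^sub>i
  u\<^sub>i\<close> cannot be truncated at a fixed index, so the functional for
  \<open>K\<close> vanishes only on those elements of the ideal that are witnessed by
  relations with letters up to \<open>K\<close>. Every element of the ideal has such a witness
  for large \<open>K\<close>.\<close>

theorem tab_functional_rel_ideal: "x \<in> rel_ideal \<Longrightarrow> \<exists>K0. \<forall>K\<ge>K0. \<forall>\<tau>. tab_functional K \<tau> x = 0"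
proof (induction rule: rel_ideal.induct)
  case (rel p q x y)
  obtain K0 where "\<forall>K\<ge>K0. \<forall>w\<in>Poly_Mapping.keys x \<union> Poly_Mapping.keys y \<union> Poly_Mapping.keys p.
      bounded_word K (Rep_gword w)"
    using bounded_word_finite[of "Poly_Mapping.keys x \<union> Poly_Mapping.keys y \<union> Poly_Mapping.keys p"]
    by auto
  then have "\<forall>K\<ge>max 1 K0. \<forall>\<tau>. tab_functional K \<tau> (x * (p - q) * y) = 0"
    using tab_functional_def_rel[OF rel] by auto
  then show ?case by blast
next
  case (add x y)
  then obtain K1 K2 where "\<forall>K\<ge>K1. \<forall>\<tau>. tab_functional K \<tau> x = 0" "\<forall>K\<ge>K2. \<forall>\<tau>. tab_functional K \<tau> y = 0" by blast
  then have "\<forall>K\<ge>max K1 K2. \<forall>\<tau>. tab_functional K \<tau> (x + y) = 0" by (simp add: tab_functional_add)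
  then show ?case by blast
qed auto

lemma t_power_cancel: "c * t_laurent ^ n = 0 \<Longrightarrow> c = 0"
proof -
  have "t_laurent * Poly_Mapping.single (- 1) 1 = 1"
    by (simp add: t_laurent_def mult_single)
  then have "t_laurent ^ n * Poly_Mapping.single (- 1) 1 ^ n = 1"
    by (simp flip: power_mult_distrib)
  moreover assume "c * t_laurent ^ n = 0"
  then have "c * (t_laurent ^ n * Poly_Mapping.single (- 1) 1 ^ n) = 0"
    by (simp flip: mult.assoc)
  ultimately show "c = 0" by simp
qed

theorem u_pair_independent:
  assumes "finite B" "B \<subseteq> basis_pairs" "(\<Sum>b\<in>B. scalar (c b) * u_pair b) = 0" "b0 \<in> B"
  shows "c b0 = 0"
proof -
  define X where "X = (\<Sum>b\<in>B. Poly_Mapping.single (Abs_gword (pair_word b)) (c b))"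
  have Rep: "Rep_gword (Abs_gword (pair_word b)) = pair_word b" if "b \<in> B" for b
    using that assms valid_pair_word Rep_Abs_gword by blast
  have "abs_ualg X = (\<Sum>b\<in>B. scalar (c b) * u_pair b)"
    unfolding X_def abs_ualg_sum by (intro sum.cong) (auto simp: abs_single Rep u_pair_word_val)
  then have "X \<in> rel_ideal" using assms by (simp add: zero_ualg_def ualg.abs_eq_iff)
  then obtain K0 where K0: "\<forall>K\<ge>K0. \<forall>\<tau>. tab_functional K \<tau> X = 0" using tab_functional_rel_ideal by blast
  obtain K1 where K1: "\<forall>K\<ge>K1. \<forall>w\<in>(\<lambda>b. Abs_gword (pair_word b)) ` B. bounded_word K (Rep_gword w)"
    using bounded_word_finite[of "(\<lambda>b. Abs_gword (pair_word b)) ` B"] assms by auto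
  \<comment> \<open>strictly larger than every letter of the words involved\<close>
  define K where "K = Suc (max K0 K1)"
  have "bounded_word (max K0 K1) (pair_word b)" if "b \<in> B" for b
  proof -
    have "max K0 K1 \<ge> K1" "Abs_gword (pair_word b) \<in> (\<lambda>b. Abs_gword (pair_word b)) ` B"
      using that by auto
    then have "bounded_word (max K0 K1) (Rep_gword (Abs_gword (pair_word b)))" using K1 by blast
    then show ?thesis by (simp only: Rep[OF that])
  qed
  then have less: "\<forall>l\<in>set (pair_word b). letter_index l < K" if "b \<in> B" for b
    using that by (auto simp: bounded_word_def K_def less_Suc_eq_le)
  have K: "1 \<le> K" "K0 \<le> K" by (auto simp: K_def)
  let ?\<tau> = "pair_tab K b0"
  have ft: "filter (\<lambda>C. C \<noteq> {1..K}) (insertion_tab K (pair_word b)) = pair_tab K b" if "b \<in> B" for b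
    using that assms less K by (intro insertion_tab_pair_word) auto
  have val: "tab_functional_word K ?\<tau> (pair_word b) = 0" if "b \<in> B" "b \<noteq> b0" for b
  proof -
    have "pair_tab K b \<noteq> pair_tab K b0"
      using pair_tab_inj[of b b0 K] that less assms K by blast
    then show ?thesis by (simp only: tab_functional_word_def ft[OF that(1)] if_False)
  qed
  have "0 = tab_functional K ?\<tau> X" using K0 K by simp
  also have "\<dots> = (\<Sum>b\<in>B. c b * tab_functional_word K ?\<tau> (pair_word b))"
    unfolding X_def tab_functional_sum by (intro sum.cong) (auto simp: tab_functional_single Rep)
  also have "\<dots> = c b0 * tab_functional_word K ?\<tau> (pair_word b0)"
    using assms val by (subst sum.remove[of _ b0]) (auto intro!: sum.neutral)
  also have "\<dots> = c b0 * t_laurent ^ length (filter (\<lambda>C. C = {1..K}) (insertion_tab K (pair_word b0)))"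
    by (simp only: tab_functional_word_def ft[OF assms(4)] simp_thms if_True)
  finally show ?thesis using t_power_cancel by metis
qed

section \<open>Reduction of words to basis elements\<close>

text \<open>The largest index is tracked through the reduction: in the end, a word with a large letter
  must not reduce to a basis element with small letters only.\<close>

definition max_index :: "letter list \<Rightarrow> nat" where
  "max_index w = foldr max (map letter_index w) 0"

lemma max_index_simps [simp]: "max_index [] = 0" "max_index (l # w) = max (letter_index l) (max_index w)"
  "max_index (v @ w) = max (max_index v) (max_index w)"
  by (simp_all add: max_index_def) (induction v, auto)

lemma max_index_le_iff: "max_index w \<le> M \<longleftrightarrow> (\<forall>l\<in>set w. letter_index l \<le> M)"
  by (induction w) auto

lemma max_index_cong: "set v = set w \<Longrightarrow> max_index v = max_index w"
  by (metis max_index_le_iff order_antisym order_refl)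

lemma valid_map: "valid (map Gen y) \<longleftrightarrow> (\<forall>x\<in>set y. 1 \<le> x)"
  "valid (map Dual y) \<longleftrightarrow> (\<forall>x\<in>set y. 1 \<le> x)"
  by (auto simp: valid_def)

lemma word_val_append_cong: "word_val v = word_val w \<Longrightarrow> word_val (p @ v @ q) = word_val (p @ w @ q)"
  by (simp add: word_val_simps)

text \<open>A dual letter moves to the right by \<open>v\<^sub>i u\<^sub>i = u\<^sub>i\<^sub>+\<^sub>1
  v\<^sub>i\<^sub>+\<^sub>1\<close>, which only increases indices.\<close>

lemma word_val_Dual_pass:
  "1 \<le> i \<Longrightarrow> valid (map Gen y) \<Longrightarrow>
    \<exists>y' i'. word_val (Dual i # map Gen y) = word_val (map Gen y' @ [Dual i']) \<and> length y' = length y \<and>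
      valid (map Gen y' @ [Dual i']) \<and> max_index (Dual i # map Gen y) \<le> max_index (map Gen y' @ [Dual i'])"
proof (induction y arbitrary: i)
  case Nil
  then show ?case by (intro exI[of _ "[]"] exI[of _ i]) auto
next
  case (Cons j y)
  define i2 where "i2 = (if i = j then Suc i else i)"
  define j2 where "j2 = (if i = j then Suc i else j)"
  have "word_val [Dual i, Gen j] = word_val [Gen j2, Dual i2]"
  proof (cases "i = j")
    case True
    then show ?thesis using word_val_rel[OF word_rel.intros(5)[of i]] Cons.prems by (simp add: i2_def j2_def)
  next
    case False
    then show ?thesis using word_val_rel[OF word_rel.intros(6)[of j i]] Cons.prems by (simp add: i2_def j2_def)
  qed
  then have 1: "word_val (Dual i # Gen j # map Gen y) = word_val (Gen j2 # Dual i2 # map Gen y)"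
    using word_val_append_cong[of _ _ "[]" "map Gen y"] by fastforce
  obtain y' i' where IH: "word_val (Dual i2 # map Gen y) = word_val (map Gen y' @ [Dual i'])"
    "length y' = length y" "valid (map Gen y' @ [Dual i'])"
    "max_index (Dual i2 # map Gen y) \<le> max_index (map Gen y' @ [Dual i'])"
  proof -
    have "1 \<le> i2" "valid (map Gen y)" using Cons.prems by (auto simp: i2_def)
    from Cons.IH[OF this] show ?thesis using that by blast
  qed
  have "word_val (Dual i # map Gen (j # y)) = word_val (map Gen (j2 # y') @ [Dual i'])"
    using 1 IH(1) by (simp add: word_val_simps)
  moreover have "1 \<le> j2" "j \<le> j2" "i \<le> i2" using Cons.prems by (auto simp: j2_def i2_def)
  ultimately show ?case using IH
    by (intro exI[of _ "j2 # y'"] exI[of _ i']) auto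
qed

lemma word_val_normal_order:
  "valid w \<Longrightarrow> \<exists>y z. word_val w = word_val (map Gen y @ map Dual z) \<and> length y + length z = length w \<and>
     valid (map Gen y @ map Dual z) \<and> max_index w \<le> max_index (map Gen y @ map Dual z)"
proof (induction w)
  case Nil
  then show ?case by (intro exI[of _ "[]"]) simp
next
  case (Cons l w)
  then obtain y z where yz: "word_val w = word_val (map Gen y @ map Dual z)" "length y + length z = length w"
     "valid (map Gen y @ map Dual z)" "max_index w \<le> max_index (map Gen y @ map Dual z)" by auto
  show ?case
  proof (cases l)
    case (Gen i)
    then show ?thesis using yz Cons.prems
      by (intro exI[of _ "i # y"] exI[of _ z]) (auto simp: word_val_simps)
  next
    case (Dual i)
    obtain y' i' where p: "word_val (Dual i # map Gen y) = word_val (map Gen y' @ [Dual i'])"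
      "length y' = length y" "valid (map Gen y' @ [Dual i'])"
      "max_index (Dual i # map Gen y) \<le> max_index (map Gen y' @ [Dual i'])"
      using word_val_Dual_pass[of i y] Cons.prems yz Dual by auto
    have "word_val (l # w) = word_val (Dual i # map Gen y) * word_val (map Dual z)"
      by (simp add: Dual yz(1) word_val_simps mult.assoc)
    also have "\<dots> = word_val (map Gen y' @ map Dual (i' # z))" unfolding p(1) by (simp add: word_val_simps mult.assoc)
    finally show ?thesis using p yz Dual
      by (intro exI[of _ y'] exI[of _ "i' # z"]) auto
  qed
qed

text \<open>The relations of the dual generators are the mirror images of those of the
  \<open>u\<^sub>i\<close>, whence the reversal.\<close>

lemma knuth_word_val:
  assumes "v \<approx> w" "\<forall>x\<in>set v. 1 \<le> x"
  shows "word_val (map Gen v) = word_val (map Gen w) \<and> word_val (map Dual (rev v)) = word_val (map Dual (rev w))"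
  using assms
proof (induction rule: knuth_induct)
  case (refl v)
  show ?case by simp
next
  case (step v' x w)
  have "word_val (map Gen x) = word_val (map Gen w) \<and> word_val (map Dual (rev x)) = word_val (map Dual (rev w))"
    if "knuth_step x w" "\<forall>a\<in>set x. 1 \<le> a" for x w
    using that
  proof (induction rule: knuth_step.induct)
    case (1 j i k p q)
    then have "1 \<le> j" by simp
    then have "word_val [Gen i, Gen j, Gen k] = word_val [Gen i, Gen k, Gen j]"
      "word_val [Dual k, Dual j, Dual i] = word_val [Dual j, Dual k, Dual i]"
      using 1 by (auto intro!: word_val_rel word_rel.intros)
    then show ?case
      using word_val_append_cong[of "[Gen i, Gen j, Gen k]" _ "map Gen p" "map Gen q"]
        word_val_append_cong[of "[Dual k, Dual j, Dual i]" _ "map Dual (rev q)" "map Dual (rev p)"] by simp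
  next
    case (2 j k i p q)
    then have "1 \<le> j" by simp
    then have "word_val [Gen i, Gen j, Gen k] = word_val [Gen j, Gen i, Gen k]"
      "word_val [Dual k, Dual j, Dual i] = word_val [Dual k, Dual i, Dual j]"
      using 2 by (auto intro!: word_val_rel word_rel.intros)
    then show ?case
      using word_val_append_cong[of "[Gen i, Gen j, Gen k]" _ "map Gen p" "map Gen q"]
        word_val_append_cong[of "[Dual k, Dual j, Dual i]" _ "map Dual (rev q)" "map Dual (rev p)"] by simp
  qed
  moreover have "\<forall>a\<in>set x. 1 \<le> a" "\<forall>a\<in>set w. 1 \<le> a"
  proof -
    have "set x = set w" using step.hyps knuth_set[OF knuth_step_knuth] by metis
    moreover have "set v' = set x" using step.hyps(1) by (rule knuth_set)
    show "\<forall>a\<in>set x. 1 \<le> a" "\<forall>a\<in>set w. 1 \<le> a"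
      using step.prems \<open>set x = set w\<close> \<open>set v' = set x\<close> by auto
  qed
  moreover have "word_val (map Gen v') = word_val (map Gen x) \<and> word_val (map Dual (rev v')) = word_val (map Dual (rev x))"
    using step.IH step.prems by blast
  ultimately show ?case using step.hyps(2) by metis
qed

lemma knuth_cols: "\<forall>x\<in>set w. 1 \<le> x \<Longrightarrow> \<exists>cs. is_column_list cs \<and> w \<approx> concat (rev cs)"
proof -
  assume pos: "\<forall>x\<in>set w. 1 \<le> x"
  let ?\<tau> = "foldl tab_ins [] w"
  let ?cs = "map slist ?\<tau>"
  have fin: "\<And>C. C \<in> set ?\<tau> \<Longrightarrow> finite C \<and> C \<noteq> {}" using tab_word_finite_nonempty by blast
  have r: "w \<approx> concat (rev ?cs)" using reading_tab_word[of w] by (simp add: reading_def rev_map)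
  have "transp dominates" by (auto simp: transp_def dominates_def intro: le_trans)
  then have "sorted_wrt dominates ?\<tau>" using tab_word_chain[of w] successively_conv_sorted_wrt by blast
  then have "sorted_wrt (\<lambda>C D. dominates_list (slist C) (slist D)) ?\<tau>"
    by (rule sorted_wrt_mono_rel[rotated]) (use fin dominates_imp_slist in blast)
  moreover have "c \<noteq> [] \<and> sorted_wrt (<) c \<and> (\<forall>x\<in>set c. 1 \<le> x)" if "c \<in> set ?cs" for c
  proof -
    obtain C where C: "C \<in> set ?\<tau>" "c = slist C" using \<open>c \<in> set ?cs\<close> by auto
    have "set c \<subseteq> set (concat (rev ?cs))" using that by auto
    then have "set c \<subseteq> set w" using knuth_set[OF r] by simp
    then show ?thesis using C fin[OF C(1)] pos by auto
  qed
  ultimately have "is_column_list ?cs" unfolding is_column_list_def sorted_wrt_map by blast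
  then show ?thesis using r by blast
qed

lemma word_val_tableaux:
  assumes "valid w"
  shows "\<exists>cs ds. is_column_list cs \<and> is_column_list ds \<and>
    word_val w = word_val (pair_word (transpose cs, transpose ds)) \<and>
    length w = length (pair_word (transpose cs, transpose ds)) \<and>
    max_index w \<le> max_index (pair_word (transpose cs, transpose ds))"
proof -
  obtain y z where yz: "word_val w = word_val (map Gen y @ map Dual z)" "length y + length z = length w"
     "valid (map Gen y @ map Dual z)" "max_index w \<le> max_index (map Gen y @ map Dual z)"
    using word_val_normal_order[OF assms] by blast
  have pos: "\<forall>x\<in>set y. 1 \<le> x" "\<forall>x\<in>set (rev z). 1 \<le> x"
    using yz(3) by (simp_all add: valid_map)
  obtain cs where cs: "is_column_list cs" "y \<approx> concat (rev cs)" using knuth_cols[OF pos(1)] by blast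
  obtain ds where ds: "is_column_list ds" "rev z \<approx> concat (rev ds)" using knuth_cols[OF pos(2)] by blast
  have pw: "pair_word (transpose cs, transpose ds) =
      map Gen (concat (rev cs)) @ map Dual (rev (concat (rev ds)))"
    using cols_tab(2)[OF cs(1)] cols_tab(2)[OF ds(1)] by (simp add: pair_word_def rev_concat)
  have "word_val (map Gen y) = word_val (map Gen (concat (rev cs)))"
    using knuth_word_val[OF cs(2) pos(1)] by blast
  moreover have "word_val (map Dual z) = word_val (map Dual (rev (concat (rev ds))))"
    using knuth_word_val[OF ds(2) pos(2)] by simp
  ultimately have "word_val w = word_val (pair_word (transpose cs, transpose ds))"
    by (simp only: yz(1) pw word_val_simps(3))
  moreover have "length w = length (pair_word (transpose cs, transpose ds))"
    using knuth_length[OF cs(2)] knuth_length[OF ds(2)] yz(2) by (simp only: pw length_append length_map length_rev)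
  moreover have "max_index (map Gen y @ map Dual z) = max_index (pair_word (transpose cs, transpose ds))"
    unfolding pw using knuth_set[OF cs(2)] knuth_set[OF ds(2)]
    by (intro max_index_cong) (simp only: set_append set_map set_rev)
  ultimately show ?thesis using yz(4) cs(1) ds(1) by (intro exI[of _ cs] exI[of _ ds]) simp
qed

definition dual_column :: "nat set \<Rightarrow> letter list" where
  "dual_column A = map Dual (rev (slist A))"

lemma set_dual_column: "finite A \<Longrightarrow> set (dual_column A) = Dual ` A"
  by (simp add: dual_column_def)

lemma dual_column_split:
  assumes "finite L" "finite H" "\<And>l. l \<in> L \<Longrightarrow> l < m" "\<And>h. h \<in> H \<Longrightarrow> m < h"
  shows "dual_column (L \<union> {m} \<union> H) = dual_column H @ [Dual m] @ dual_column L"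
proof -
  have "slist (L \<union> {m} \<union> H) = slist L @ [m] @ slist H"
    using assms by (intro slist_unique) (auto simp: sorted_wrt_append intro: less_trans)
  then show ?thesis by (simp add: dual_column_def)
qed

lemma word_val_commute_dual_column:
  assumes "finite A" "x \<notin> A" "1 \<le> x" "\<And>a. a \<in> A \<Longrightarrow> 1 \<le> a"
  shows "word_val (Gen x # dual_column A) = word_val (dual_column A @ [Gen x])"
proof -
  have "word_val (Gen x # map Dual z) = word_val (map Dual z @ [Gen x])" if "x \<notin> set z" "\<forall>a\<in>set z. 1 \<le> a" for z
    using that
  proof (induction z)
    case (Cons a z)
    have "word_val [Gen x, Dual a] = word_val [Dual a, Gen x]" using Cons.prems assms(3)
      by (intro word_val_rel word_rel.intros) auto
    then have "word_val (Gen x # Dual a # map Dual z) = word_val (Dual a # Gen x # map Dual z)"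
      by (simp add: word_val_simps flip: mult.assoc)
    then show ?case using Cons by (simp add: word_val_simps)
  qed simp
  then show ?thesis using assms by (simp add: dual_column_def)
qed

text \<open>The letter \<open>u\<^sub>x\<close> decreases by one each time it meets its dual: it runs
  through \<open>x, x - 1, \<dots>\<close> down to the largest \<open>y \<notin> A\<close>. If
  there is no such \<open>y \<ge> 1\<close>, it ends with \<open>u\<^sub>1 v\<^sub>1 =
  t\<close> and disappears.\<close>

lemma word_val_Gen_pass:
  assumes "finite A" "1 \<le> x" "x \<in> A" "\<forall>a\<in>A. 1 \<le> a"
  shows "word_val (Gen x # dual_column A) = scalar t_laurent * word_val (dual_column (A - {x})) \<and> {1..x} \<subseteq> A \<or>
    (\<exists>y. 1 \<le> y \<and> y < x \<and> y \<notin> A \<and> {y<..x} \<subseteq> A \<and>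
      word_val (Gen x # dual_column A) = word_val (dual_column (insert y (A - {x})) @ [Gen y]))"
  using assms
proof (induction x arbitrary: A)
  case (Suc x)
  define L H where "L = {a\<in>A. a < Suc x}" and "H = {a\<in>A. Suc x < a}"
  have fin: "finite L" "finite H" using Suc.prems by (auto simp: L_def H_def)
  have A: "A = L \<union> {Suc x} \<union> H" using Suc.prems(3) by (auto simp: L_def H_def)
  have dA: "dual_column A = dual_column H @ [Dual (Suc x)] @ dual_column L"
    unfolding A using fin by (intro dual_column_split) (auto simp: L_def H_def)
  have posL: "\<forall>a\<in>L. 1 \<le> a" using Suc.prems(4) by (auto simp: L_def)
  have "word_val (Gen (Suc x) # dual_column H) = word_val (dual_column H @ [Gen (Suc x)])"
    using Suc.prems fin by (intro word_val_commute_dual_column) (auto simp: H_def)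
  then have e1: "word_val (Gen (Suc x) # dual_column A) = word_val (dual_column H) * word_val [Gen (Suc x), Dual (Suc x)] * word_val (dual_column L)"
    unfolding dA by (simp add: word_val_simps flip: mult.assoc)
  show ?case
  proof (cases "x = 0")
    case True
    then have "L = {}" using posL by (force simp: L_def)
    then have "A - {Suc x} = H" unfolding A by (auto simp: H_def)
    moreover have "word_val (Gen (Suc x) # dual_column A) = scalar t_laurent * word_val (dual_column H)"
      using e1 word_val_contract True \<open>L = {}\<close> scalar_central[of t_laurent "word_val (dual_column H)"]
      by (simp add: dual_column_def word_val_simps)
    ultimately show ?thesis using Suc.prems(3) True by simp
  next
    case False
    then have x: "1 \<le> x" by simp
    have e2: "word_val (Gen (Suc x) # dual_column A) = word_val (dual_column H @ [Dual x]) * word_val (Gen x # dual_column L)"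
    proof -
      have r: "word_val [Gen (Suc x), Dual (Suc x)] = word_val [Dual x, Gen x]"
        using word_val_rel[OF word_rel.intros(5)[of x]] x by simp
      show ?thesis unfolding e1 r by (simp add: word_val_simps mult.assoc)
    qed
    show ?thesis
    proof (cases "x \<in> L")
      case xL: False
      have "x \<notin> A" using xL by (auto simp: L_def)
      have "word_val (Gen x # dual_column L) = word_val (dual_column L @ [Gen x])"
        using fin xL x posL by (intro word_val_commute_dual_column) auto
      moreover have "dual_column (insert x (A - {Suc x})) = dual_column H @ [Dual x] @ dual_column L"
      proof -
        have e: "insert x (A - {Suc x}) = L \<union> {x} \<union> H" by (auto simp: L_def H_def)
        have "l < x" if "l \<in> L" for l using that xL by (cases "l = x") (auto simp: L_def)
        then show ?thesis unfolding e using fin by (intro dual_column_split) (auto simp: H_def)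
      qed
      ultimately have "word_val (Gen (Suc x) # dual_column A) = word_val (dual_column (insert x (A - {Suc x})) @ [Gen x])"
        using e2 by (simp add: word_val_simps mult.assoc)
      moreover have "{x<..Suc x} \<subseteq> A" using Suc.prems(3) by (auto simp: le_Suc_eq)
      ultimately show ?thesis using x \<open>x \<notin> A\<close> by blast
    next
      case xL: True
      have "x \<in> A" using xL by (simp add: L_def)
      have "word_val (Gen x # dual_column L) = scalar t_laurent * word_val (dual_column (L - {x})) \<and> {1..x} \<subseteq> L \<or>
        (\<exists>y. 1 \<le> y \<and> y < x \<and> y \<notin> L \<and> {y<..x} \<subseteq> L \<and>
          word_val (Gen x # dual_column L) = word_val (dual_column (insert y (L - {x})) @ [Gen y]))"
        by (rule Suc.IH[OF fin(1) x xL posL])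
      then show ?thesis
      proof (elim disjE exE conjE)
        assume *: "word_val (Gen x # dual_column L) = scalar t_laurent * word_val (dual_column (L - {x}))" "{1..x} \<subseteq> L"
        have e: "A - {Suc x} = (L - {x}) \<union> {x} \<union> H" using \<open>x \<in> A\<close> by (auto simp: L_def H_def)
        have "dual_column (A - {Suc x}) = dual_column H @ [Dual x] @ dual_column (L - {x})"
          unfolding e using fin by (intro dual_column_split) (auto simp: H_def L_def)
        moreover have "word_val (Gen (Suc x) # dual_column A) =
            scalar t_laurent * (word_val (dual_column H @ [Dual x]) * word_val (dual_column (L - {x})))"
          unfolding e2 *(1) by (metis mult.assoc scalar_central)
        ultimately have "word_val (Gen (Suc x) # dual_column A) = scalar t_laurent * word_val (dual_column (A - {Suc x}))"
          by (simp add: word_val_simps mult.assoc)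
        moreover have "{1..Suc x} \<subseteq> A" using *(2) Suc.prems(3) by (auto simp: L_def le_Suc_eq)
        ultimately show ?thesis by blast
      next
        fix y assume y: "1 \<le> y" "y < x" "y \<notin> L" "{y<..x} \<subseteq> L"
          "word_val (Gen x # dual_column L) = word_val (dual_column (insert y (L - {x})) @ [Gen y])"
        have "y \<notin> A" using y(2,3) by (auto simp: L_def)
        have e: "insert y (A - {Suc x}) = insert y (L - {x}) \<union> {x} \<union> H"
          using \<open>x \<in> A\<close> by (auto simp: L_def H_def)
        have "dual_column (insert y (A - {Suc x})) = dual_column H @ [Dual x] @ dual_column (insert y (L - {x}))"
          unfolding e using fin y(2) by (intro dual_column_split) (auto simp: H_def L_def)
        then have "word_val (Gen (Suc x) # dual_column A) = word_val (dual_column (insert y (A - {Suc x})) @ [Gen y])"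
          using e2 y(5) by (simp add: word_val_simps mult.assoc)
        moreover have "{y<..Suc x} \<subseteq> A" using y(4) Suc.prems(3) by (auto simp: L_def le_Suc_eq)
        ultimately show ?thesis using y(1,2) \<open>y \<notin> A\<close> by (meson less_SucI)
      qed
    qed
  qed
qed simp

lemma count_le_add: "m \<le> n \<Longrightarrow> count_le A n \<le> count_le A m + (n - m)"
proof -
  assume "m \<le> n"
  then have "A \<inter> {..n} \<subseteq> (A \<inter> {..m}) \<union> {m<..n}" by auto
  then have "card (A \<inter> {..n}) \<le> card ((A \<inter> {..m}) \<union> {m<..n})" by (intro card_mono) auto
  also have "\<dots> \<le> card (A \<inter> {..m}) + card {m<..n}" by (rule card_Un_le)
  finally show ?thesis by (simp add: count_le_def)
qed

lemma max_index_dual_column_le: "finite A \<Longrightarrow> max_index (dual_column A) \<le> M \<longleftrightarrow> (\<forall>a\<in>A. a \<le> M)"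
  by (auto simp: max_index_le_iff set_dual_column)

text \<open>The letters of \<open>s\<close> pass through \<open>A\<close> one after the other, the
  largest first. If none of them disappears, each one has been matched with an element of the
  complement of \<open>A\<close> that is not larger, and counting gives the condition on
  tableau pairs. An index drops by at most \<open>card A\<close> in each passage, since the
  run it goes through lies in \<open>A\<close>.\<close>

lemma word_val_columns_contract:
  assumes "sorted_wrt (<) s" "\<forall>x\<in>set s. 1 \<le> x" "finite A" "\<forall>a\<in>A. 1 \<le> a"
  shows "(\<forall>k. count_le (set s) k + count_le A k \<le> k) \<or>
    (\<exists>w. valid w \<and> word_val (map Gen s @ dual_column A) = scalar t_laurent * word_val w \<and>
       length w + 2 = length s + card A \<and>
       max_index (map Gen s @ dual_column A) \<le> max_index w + length s * card A)"
  using assms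
proof (induction s arbitrary: A rule: rev_induct)
  case Nil
  have "count_le A k \<le> k" for k
  proof -
    have "A \<inter> {..0} = {}" using Nil by auto
    then show ?thesis using count_le_add[of 0 k A] by (simp add: count_le_def)
  qed
  then show ?case by simp
next
  case (snoc x s)
  have x: "1 \<le> x" and s: "sorted_wrt (<) s" "\<forall>a\<in>set s. 1 \<le> a" "\<forall>a\<in>set s. a < x"
    using snoc.prems by (auto simp: sorted_wrt_append)
  have cs: "count_le (set (s @ [x])) k = count_le (set s) k + (if x \<le> k then 1 else 0)" for k
  proof -
    have "x \<notin> set s" using s(3) by auto
    then show ?thesis by (simp add: count_le_insert)
  qed
  have full: "count_le (set s) k = count_le (set s) (x - 1)" if "x \<le> k" for k
  proof -
    have "set s \<inter> {..k} = set s \<inter> {..x - 1}" using s(3) that by (auto simp: less_le_trans)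
    then show ?thesis by (simp add: count_le_def)
  qed
  have wdsx: "word_val (map Gen (s @ [x]) @ dual_column A) = word_val (map Gen s) * word_val (Gen x # dual_column A)"
    by (simp add: word_val_simps mult.assoc)
  \<comment> \<open>The rest of the argument after \<open>x\<close> has passed; \<open>y\<close> is what becomes of \<open>x\<close>.\<close>
  have pass: ?case if A': "finite A'" "\<forall>a\<in>A'. 1 \<le> a" "card A' = card A" and y: "1 \<le> y"
    and word_val: "word_val (Gen x # dual_column A) = word_val (dual_column A' @ [Gen y])"
    and le: "x \<le> y + card A" "\<forall>a\<in>A. a \<le> max x (max_index (dual_column A'))"
    and cond: "\<forall>k. count_le (set s) k + count_le A' k \<le> k \<Longrightarrow> \<forall>k. count_le (set (s @ [x])) k + count_le A k \<le> k"
    for A' y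
    using snoc.IH[OF s(1,2) A'(1,2)]
  proof (elim disjE exE conjE)
    fix w assume w: "valid w" "word_val (map Gen s @ dual_column A') = scalar t_laurent * word_val w"
      "length w + 2 = length s + card A'" "max_index (map Gen s @ dual_column A') \<le> max_index w + length s * card A'"
    have "word_val (map Gen (s @ [x]) @ dual_column A) = scalar t_laurent * word_val (w @ [Gen y])"
      using wdsx word_val w(2) by (simp add: word_val_simps mult.assoc[symmetric])
    moreover have "max_index (map Gen (s @ [x]) @ dual_column A) \<le> max_index (w @ [Gen y]) + length (s @ [x]) * card A"
    proof -
      have "max_index (dual_column A) \<le> max x (max_index (dual_column A'))" using le(2) max_index_dual_column_le[OF snoc.prems(3)] by blast
      moreover have "max_index (map Gen s) \<le> max_index w + length s * card A"
        "max_index (dual_column A') \<le> max_index w + length s * card A" using w(4) A'(3) by simp_all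
      ultimately show ?thesis using le(1) by (simp add: max_def split: if_splits)
    qed
    moreover have "length (w @ [Gen y]) + 2 = length (s @ [x]) + card A" using w(3) A'(3) by simp
    moreover have "valid (w @ [Gen y])" using w(1) y by simp
    ultimately show ?thesis by blast
  qed (use cond in blast)
  show ?case
  proof (cases "x \<in> A")
    case False
    show ?thesis
    proof (rule pass[of A x])
      show "word_val (Gen x # dual_column A) = word_val (dual_column A @ [Gen x])"
        using False snoc.prems x by (intro word_val_commute_dual_column) auto
      show "\<forall>a\<in>A. a \<le> max x (max_index (dual_column A))"
        using max_index_dual_column_le[OF snoc.prems(3), of "max_index (dual_column A)"] by auto
      assume *: "\<forall>k. count_le (set s) k + count_le A k \<le> k"
      show "\<forall>k. count_le (set (s @ [x])) k + count_le A k \<le> k"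
      proof
        fix k
        show "count_le (set (s @ [x])) k + count_le A k \<le> k"
        proof (cases "x \<le> k")
          case True
          have "A \<inter> {..x} = A \<inter> {..x - 1}" using False x by (auto simp: le_less)
          then have "count_le A k \<le> count_le A (x - 1) + (k - x)"
            using count_le_add[OF True, of A] by (simp add: count_le_def)
          moreover have "count_le (set s) (x - 1) + count_le A (x - 1) \<le> x - 1" using * by blast
          ultimately show ?thesis using True x full[OF True] cs[of k] by simp
        next
          case False
          then show ?thesis using * cs[of k] by simp
        qed
      qed
    qed (use snoc.prems x in auto)
  next
    case True
    from word_val_Gen_pass[OF snoc.prems(3) x True snoc.prems(4)] show ?thesis
    proof (elim disjE exE conjE)
      assume *: "word_val (Gen x # dual_column A) = scalar t_laurent * word_val (dual_column (A - {x}))" "{1..x} \<subseteq> A"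
      have "x \<le> card A" using card_mono[OF snoc.prems(3) *(2)] by simp
      have cA: "card A = Suc (card (A - {x}))" by (rule card.remove[OF snoc.prems(3) True])
      have "word_val (map Gen (s @ [x]) @ dual_column A) = scalar t_laurent * word_val (map Gen s @ dual_column (A - {x}))"
        unfolding wdsx *(1) using scalar_central[of t_laurent "word_val (map Gen s)"]
        by (simp add: word_val_simps mult.assoc[symmetric])
      moreover have "max_index (map Gen (s @ [x]) @ dual_column A)
          \<le> max_index (map Gen s @ dual_column (A - {x})) + length (s @ [x]) * card A"
      proof -
        have "\<forall>a\<in>A. a \<le> max x (max_index (dual_column (A - {x})))"
          using max_index_dual_column_le[of "A - {x}" "max_index (dual_column (A - {x}))"] snoc.prems(3) by (auto simp: le_max_iff_disj)
        then have "max_index (dual_column A) \<le> max x (max_index (dual_column (A - {x})))"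
          using max_index_dual_column_le[OF snoc.prems(3)] by blast
        then show ?thesis using \<open>x \<le> card A\<close> by (simp add: max_def split: if_splits)
      qed
      moreover have "valid (map Gen s @ dual_column (A - {x}))"
        using s snoc.prems by (auto simp: valid_def set_dual_column)
      moreover have "length (map Gen s @ dual_column (A - {x})) + 2 = length (s @ [x]) + card A"
        using snoc.prems(3) cA by (simp add: dual_column_def)
      ultimately show ?thesis by blast
    next
      fix y assume y: "1 \<le> y" "y < x" "y \<notin> A" "{y<..x} \<subseteq> A"
        "word_val (Gen x # dual_column A) = word_val (dual_column (insert y (A - {x})) @ [Gen y])"
      let ?A = "insert y (A - {x})"
      have fA: "finite ?A" using snoc.prems by simp
      show ?thesis
      proof (rule pass[of ?A y])
        show "card ?A = card A" using card.remove[OF snoc.prems(3) True] y snoc.prems(3) by simp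
        have "card {y<..x} \<le> card A" by (rule card_mono[OF snoc.prems(3) y(4)])
        then show "x \<le> y + card A" by simp
        show "\<forall>a\<in>A. a \<le> max x (max_index (dual_column ?A))"
          using max_index_dual_column_le[OF fA, of "max_index (dual_column ?A)"] by (auto simp: le_max_iff_disj)
        assume *: "\<forall>k. count_le (set s) k + count_le ?A k \<le> k"
        have cA: "count_le ?A k + (if x \<le> k then 1 else 0) = count_le A k + (if y \<le> k then 1 else 0)" for k
          using count_le_remove[OF True, of k] count_le_insert[of y "A - {x}" k] y by simp
        show "\<forall>k. count_le (set (s @ [x])) k + count_le A k \<le> k"
        proof
          fix k
          show "count_le (set (s @ [x])) k + count_le A k \<le> k"
          proof (cases "x \<le> k")
            case True
            have "count_le ?A (x - 1) = Suc (count_le A (x - 1))" 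
            proof -
              have "\<not> x \<le> x - 1" "y \<le> x - 1" using y(1,2) by linarith+
              then show ?thesis using cA[of "x - 1"] by simp
            qed
            moreover have "count_le A x \<le> Suc (count_le A (x - 1))" using count_le_add[of "x - 1" x A] x by simp
            moreover have "count_le A k \<le> count_le A x + (k - x)" by (rule count_le_add[OF True])
            moreover have "count_le (set s) (x - 1) + count_le ?A (x - 1) \<le> x - 1" using * by blast
            moreover have "count_le (set (s @ [x])) k = count_le (set s) (x - 1) + 1"
              using cs[of k] full[OF True] True by simp
            ultimately show ?thesis using True x by linarith
          next
            case False
            then show ?thesis using *[rule_format, of k] cs[of k] cA[of k] by (simp split: if_splits)
          qed
        qed
      qed (use fA y snoc.prems in auto)
    qed
  qed
qed

lemma length_concat_transpose: "length (concat (transpose xs)) = length (concat xs)"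
proof (induction xs rule: transpose.induct)
  case (3 x xs xss)
  have "length (concat (concat (map (\<lambda>r. case r of [] \<Rightarrow> [] | h # t \<Rightarrow> [t]) xss))) +
      length (concat (map (\<lambda>r. case r of [] \<Rightarrow> [] | h # t \<Rightarrow> [h]) xss)) = length (concat xss)"
    by (induction xss) (auto split: list.split)
  then show ?case using 3 by simp
qed auto

lemma pair_degree_length: "pair_degree b = length (pair_word b)"
  using length_concat_transpose[of "fst b"] length_concat_transpose[of "snd b"]
  by (simp add: pair_degree_def pair_word_def shape_def length_concat rev_map[symmetric] o_def)

text \<open>Moving the dual letters to the right and inserting letters into columns turns a word into
  that of a pair of tableaux. If the pair violates the condition, its two adjacent first
  columns release a factor \<open>t\<close> and the length drops by two. The loss in the
  largest index depends on the length only, hence the bound \<open>D\<close> is chosen before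
  the word.\<close>

theorem word_val_reduce:
  "\<exists>D. \<forall>w. valid w \<and> length w = n \<longrightarrow> (\<exists>b\<in>basis_pairs. \<exists>c.
     word_val w = scalar (t_laurent ^ c) * u_pair b \<and> pair_degree b \<le> n \<and> max_index w \<le> max_index (pair_word b) + D)"
proof (induction n rule: less_induct)
  case (less n)
  obtain D where D: "\<And>w. valid w \<Longrightarrow> Suc (Suc (length w)) = n \<Longrightarrow> (\<exists>b\<in>basis_pairs. \<exists>c.
     word_val w = scalar (t_laurent ^ c) * u_pair b \<and> pair_degree b \<le> length w \<and> max_index w \<le> max_index (pair_word b) + D)"
  proof (cases "2 \<le> n")
    case True
    then have "n - 2 < n" by simp
    from less[OF this] obtain D where D: "\<forall>w. valid w \<and> length w = n - 2 \<longrightarrow> (\<exists>b\<in>basis_pairs. \<exists>c.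
     word_val w = scalar (t_laurent ^ c) * u_pair b \<and> pair_degree b \<le> n - 2 \<and> max_index w \<le> max_index (pair_word b) + D)"
      by blast
    show ?thesis
    proof (rule that[of D])
      fix w assume "valid w" "Suc (Suc (length w)) = n"
      then have "length w = n - 2" by simp
      then show "\<exists>b\<in>basis_pairs. \<exists>c. word_val w = scalar (t_laurent ^ c) * u_pair b \<and>
        pair_degree b \<le> length w \<and> max_index w \<le> max_index (pair_word b) + D"
        using D \<open>valid w\<close> by metis
    qed
  next
    case False
    \<comment> \<open>words of length less than two release no factor, and the hypothesis on lengths cannot be met\<close>
    then show ?thesis by (intro that[of 0]) auto
  qed
  have "\<exists>b\<in>basis_pairs. \<exists>c. word_val w = scalar (t_laurent ^ c) * u_pair b \<and> pair_degree b \<le> n \<and>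
      max_index w \<le> max_index (pair_word b) + (D + n * n)" if w: "valid w" "length w = n" for w
  proof -
    obtain cs ds where cd: "is_column_list cs" "is_column_list ds" and
      red: "word_val w = word_val (pair_word (transpose cs, transpose ds))"
      "length w = length (pair_word (transpose cs, transpose ds))"
      "max_index w \<le> max_index (pair_word (transpose cs, transpose ds))"
      using word_val_tableaux[OF w(1)] by blast
    let ?b = "(transpose cs, transpose ds)"
    have tt: "transpose (transpose cs) = cs" "transpose (transpose ds) = ds"
      using cols_tab(2) cd by blast+
    show ?thesis
    proof (cases "\<forall>k\<ge>1. count_le (first_col (fst ?b)) k + count_le (first_col (snd ?b)) k \<le> k")
      case True
      then have "?b \<in> basis_pairs" using cols_tab(1) cd by (simp add: basis_pairs_iff)
      moreover have "word_val w = scalar (t_laurent ^ 0) * u_pair ?b"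
        using red(1) by (simp add: u_pair_word_val scalar_simps)
      moreover have "pair_degree ?b \<le> n" using red(2) w(2) by (simp add: pair_degree_length)
      ultimately show ?thesis using red(3) by (intro bexI[of _ ?b] exI[of _ 0]) auto
    next
      case False
      have pos: "\<forall>a\<in>first_col (transpose cs) \<union> first_col (transpose ds). 1 \<le> a"
        using cd by (auto simp: first_col_def tt is_column_list_def split: list.splits)
      have zero: "count_le A k \<le> k" if "\<forall>a\<in>A. 1 \<le> a" for A k
        using count_le_add[of 0 k A] that by (force simp: count_le_def)
      have "cs \<noteq> []" "ds \<noteq> []"
        using False zero[of "first_col (transpose cs)"] zero[of "first_col (transpose ds)"] pos
        by (auto simp: first_col_def tt)
      then obtain s cs' a ds' where sa: "cs = s # cs'" "ds = a # ds'" by (meson neq_Nil_conv)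
      have s: "sorted_wrt (<) s" "\<forall>x\<in>set s. 1 \<le> x" and a: "sorted_wrt (<) a" "\<forall>x\<in>set a. 1 \<le> x"
        using cd by (auto simp: is_column_list_def sa)
      define p q where "p = map Gen (concat (rev cs'))" and "q = map Dual (concat (map rev ds'))"
      have da: "dual_column (set a) = map Dual (rev a)" using slist_unique[OF a(1) refl] by (simp add: dual_column_def)
      have pw: "pair_word ?b = p @ (map Gen s @ dual_column (set a)) @ q"
        by (simp add: pair_word_def tt p_def q_def da) (simp add: sa)
      have "\<not> (\<forall>k. count_le (set s) k + count_le (set a) k \<le> k)"
      proof -
        have "first_col (transpose cs) = set s" "first_col (transpose ds) = set a"
          unfolding first_col_def tt by (simp_all add: sa)
        then show ?thesis using False by auto
      qed
      then obtain w' where w': "valid w'" "word_val (map Gen s @ dual_column (set a)) = scalar t_laurent * word_val w'"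
        "length w' + 2 = length s + card (set a)"
        "max_index (map Gen s @ dual_column (set a)) \<le> max_index w' + length s * card (set a)"
        using word_val_columns_contract[OF s finite_set a(2)] by blast
      have vp: "valid (p @ w' @ q)"
        using w'(1) cd by (auto simp: p_def q_def valid_def is_column_list_def sa)
      have ca: "card (set a) = length a" using a(1) by (simp add: distinct_card strict_sorted_iff)
      have len: "Suc (Suc (length (p @ w' @ q))) = n"
        using red(2) w(2) w'(3) ca by (simp add: pw da)
      obtain b c where b: "b \<in> basis_pairs" "word_val (p @ w' @ q) = scalar (t_laurent ^ c) * u_pair b"
        "pair_degree b \<le> length (p @ w' @ q)" "max_index (p @ w' @ q) \<le> max_index (pair_word b) + D"
        using D[OF vp len] by blast
      have "word_val w = word_val p * (scalar t_laurent * word_val w') * word_val q"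
        unfolding red(1) pw w'(2)[symmetric] by (simp add: word_val_simps mult.assoc)
      also have "\<dots> = scalar t_laurent * word_val (p @ w' @ q)"
        unfolding word_val_simps(3) by (simp add: mult.assoc[symmetric] scalar_central[of _ "word_val p"])
      also have "\<dots> = scalar (t_laurent ^ Suc c) * u_pair b"
        by (simp add: b(2) scalar_simps mult.assoc)
      finally have "word_val w = scalar (t_laurent ^ Suc c) * u_pair b" .
      moreover have "pair_degree b \<le> n" using b(3) len by simp
      moreover have "max_index w \<le> max_index (pair_word b) + (D + n * n)"
      proof -
        have "length s \<le> n" "card (set a) \<le> n" using red(2) w(2) ca by (simp_all add: pw da)
        then have "length s * card (set a) \<le> n * n" by (rule mult_le_mono)
        moreover have "max_index w \<le> max_index (p @ w' @ q) + length s * card (set a)"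
          using red(3) w'(4) unfolding pw by (simp add: max_def split: if_splits)
        ultimately show ?thesis using b(4) by linarith
      qed
      ultimately show ?thesis using b(1) by blast
    qed
  qed
  then show ?case by blast
qed

section \<open>The completion as a topological ring\<close>

definition coord :: "ualg \<Rightarrow> tableau_pair \<Rightarrow> laurent" where
  "coord x b = Poly_Mapping.lookup (basis_coords x) b"

lemma u_pair_span:
  "\<exists>B c. finite B \<and> B \<subseteq> basis_pairs \<and> x = (\<Sum>b\<in>B. scalar (c b) * u_pair b)"
proof -
  have add: "\<exists>B c. finite B \<and> B \<subseteq> basis_pairs \<and> x + y = (\<Sum>b\<in>B. scalar (c b) * u_pair b)"
    if "finite B" "B \<subseteq> basis_pairs" "x = (\<Sum>b\<in>B. scalar (c b) * u_pair b)"
      "finite B'" "B' \<subseteq> basis_pairs" "y = (\<Sum>b\<in>B'. scalar (c' b) * u_pair b)" for x y B c B' c'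
  proof -
    let ?c = "\<lambda>b. if b \<in> B then c b else 0" and ?c' = "\<lambda>b. if b \<in> B' then c' b else 0"
    have "x = (\<Sum>b\<in>B \<union> B'. scalar (?c b) * u_pair b)" "y = (\<Sum>b\<in>B \<union> B'. scalar (?c' b) * u_pair b)"
      unfolding that(3,6) using that(1,4)
      by (auto simp: scalar_simps intro!: sum.mono_neutral_cong_left)
    then have "x + y = (\<Sum>b\<in>B \<union> B'. scalar (?c b + ?c' b) * u_pair b)"
      by (simp add: scalar_simps distrib_right sum.distrib)
    then show ?thesis using that
      by (intro exI[of _ "B \<union> B'"] exI[of _ "\<lambda>b. ?c b + ?c' b"]) auto
  qed
  obtain W d where W: "finite W" "\<forall>w\<in>W. valid w" "x = (\<Sum>w\<in>W. scalar (d w) * word_val w)"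
    using ualg_word_sum by blast
  have "\<exists>B c. finite B \<and> B \<subseteq> basis_pairs \<and> (\<Sum>w\<in>W. scalar (d w) * word_val w) = (\<Sum>b\<in>B. scalar (c b) * u_pair b)"
    using W(1,2)
  proof (induction W)
    case empty
    show ?case by (intro exI[of _ "{}"]) simp
  next
    case (insert w W)
    obtain b k where b: "b \<in> basis_pairs" "word_val w = scalar (t_laurent ^ k) * u_pair b"
      using word_val_reduce[of "length w"] insert.prems by auto
    have "scalar (d w) * word_val w = (\<Sum>b\<in>{b}. scalar (d w * t_laurent ^ k) * u_pair b)"
      by (simp add: b(2) scalar_simps mult.assoc)
    moreover obtain B c where "finite B" "B \<subseteq> basis_pairs"
      "(\<Sum>w\<in>W. scalar (d w) * word_val w) = (\<Sum>b\<in>B. scalar (c b) * u_pair b)"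
      using insert by auto
    ultimately have "\<exists>B c. finite B \<and> B \<subseteq> basis_pairs \<and>
      scalar (d w) * word_val w + (\<Sum>w\<in>W. scalar (d w) * word_val w) = (\<Sum>b\<in>B. scalar (c b) * u_pair b)"
      using b(1) add[of "{b}"] by fastforce
    then show ?case using insert.hyps by simp
  qed
  then show ?thesis using W(3) by simp
qed

lemma coords_unique:
  assumes "Poly_Mapping.keys c \<subseteq> basis_pairs"
    and "x = (\<Sum>b\<in>Poly_Mapping.keys c. scalar (Poly_Mapping.lookup c b) * u_pair b)"
  shows "basis_coords x = c"
  unfolding basis_coords_def
proof (rule the_equality)
  fix d :: "tableau_pair \<Rightarrow>\<^sub>0 laurent"
  assume d: "Poly_Mapping.keys d \<subseteq> basis_pairs \<and>
    x = (\<Sum>b\<in>Poly_Mapping.keys d. scalar (Poly_Mapping.lookup d b) * u_pair b)"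
  let ?B = "Poly_Mapping.keys c \<union> Poly_Mapping.keys d"
  have "x = (\<Sum>b\<in>?B. scalar (Poly_Mapping.lookup c b) * u_pair b)"
    unfolding assms(2) by (rule sum.mono_neutral_left) (auto simp: in_keys_iff scalar_simps)
  moreover have "x = (\<Sum>b\<in>?B. scalar (Poly_Mapping.lookup d b) * u_pair b)"
    using d by (subst conjunct2[OF d], intro sum.mono_neutral_left) (auto simp: in_keys_iff scalar_simps)
  ultimately have "(\<Sum>b\<in>?B. scalar (Poly_Mapping.lookup d b) * u_pair b)
      = (\<Sum>b\<in>?B. scalar (Poly_Mapping.lookup c b) * u_pair b)" by simp
  moreover have "scalar (Poly_Mapping.lookup d b) * u_pair b =
      scalar (Poly_Mapping.lookup d b - Poly_Mapping.lookup c b) * u_pair b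
      + scalar (Poly_Mapping.lookup c b) * u_pair b" for b
    by (simp flip: distrib_right scalar_simps(3))
  ultimately have "(\<Sum>b\<in>?B. scalar (Poly_Mapping.lookup d b - Poly_Mapping.lookup c b) * u_pair b) = 0"
    by (simp add: sum.distrib)
  then have z: "Poly_Mapping.lookup d b - Poly_Mapping.lookup c b = 0" if "b \<in> ?B" for b
    using that d assms(1)
    by (intro u_pair_independent[of ?B "\<lambda>b. Poly_Mapping.lookup d b - Poly_Mapping.lookup c b" b]) auto
  show "d = c"
  proof (rule poly_mapping_eqI)
    fix b
    show "Poly_Mapping.lookup d b = Poly_Mapping.lookup c b"
      using z[of b] by (cases "b \<in> ?B") (auto simp: in_keys_iff)
  qed
qed (use assms in blast)

lemma coord_sum_u_pair:
  assumes "finite B" "B \<subseteq> basis_pairs"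
  shows "coord (\<Sum>b\<in>B. scalar (f b) * u_pair b) b = (if b \<in> B then f b else 0)"
proof -
  define c where "c = (\<Sum>b\<in>B. Poly_Mapping.single b (f b))"
  have lookup: "Poly_Mapping.lookup c b = (if b \<in> B then f b else 0)" for b
    using assms(1) by (simp add: c_def lookup_sum lookup_single when_def)
  have keys: "Poly_Mapping.keys c \<subseteq> B" by (auto simp: in_keys_iff lookup split: if_splits)
  have "(\<Sum>b\<in>B. scalar (f b) * u_pair b) =
      (\<Sum>b\<in>Poly_Mapping.keys c. scalar (Poly_Mapping.lookup c b) * u_pair b)"
    using assms(1) keys
    by (intro sum.mono_neutral_cong_right) (auto simp: lookup in_keys_iff scalar_simps)
  then have "basis_coords (\<Sum>b\<in>B. scalar (f b) * u_pair b) = c"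
    using keys assms(2) by (intro coords_unique) auto
  then show ?thesis by (simp add: coord_def lookup)
qed

lemma coord_finite: "finite {b. coord x b \<noteq> 0}"
  unfolding coord_def by simp

lemma coord_basis: "coord x b \<noteq> 0 \<Longrightarrow> b \<in> basis_pairs"
proof -
  obtain B c where B: "finite B" "B \<subseteq> basis_pairs" "x = (\<Sum>b\<in>B. scalar (c b) * u_pair b)"
    using u_pair_span by blast
  then show "coord x b \<noteq> 0 \<Longrightarrow> b \<in> basis_pairs"
    using coord_sum_u_pair[OF B(1,2), of c b] by (auto split: if_splits)
qed

lemma coord_expand:
  assumes "finite C" "{b. coord x b \<noteq> 0} \<subseteq> C"
  shows "x = (\<Sum>b\<in>C. scalar (coord x b) * u_pair b)"
proof -
  obtain B c where B: "finite B" "B \<subseteq> basis_pairs" "x = (\<Sum>b\<in>B. scalar (c b) * u_pair b)"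
    using u_pair_span by blast
  have c: "coord x b = (if b \<in> B then c b else 0)" for b
    using coord_sum_u_pair[OF B(1,2), of c b] B(3) by simp
  have "(\<Sum>b\<in>B. scalar (c b) * u_pair b) = (\<Sum>b\<in>B \<union> C. scalar (coord x b) * u_pair b)"
    using B(1) assms(1) by (intro sum.mono_neutral_cong_left) (auto simp: c scalar_simps)
  also have "\<dots> = (\<Sum>b\<in>C. scalar (coord x b) * u_pair b)"
  proof (rule sum.mono_neutral_right)
    show "\<forall>b\<in>B \<union> C - C. scalar (coord x b) * u_pair b = 0"
    proof
      fix b assume "b \<in> B \<union> C - C"
      then have "coord x b = 0" using assms(2) by blast
      then show "scalar (coord x b) * u_pair b = 0" by (simp add: scalar_simps)
    qed
  qed (use B(1) assms(1) in auto)
  finally show ?thesis using B(3) by simp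
qed

lemma coord_add: "coord (x + y) b = coord x b + coord y b"
proof -
  let ?C = "{b. coord x b \<noteq> 0} \<union> {b. coord y b \<noteq> 0}"
  have "x + y = (\<Sum>b\<in>?C. scalar (coord x b + coord y b) * u_pair b)"
    using coord_expand[of ?C x] coord_expand[of ?C y] coord_finite
    by (simp add: scalar_simps distrib_right sum.distrib)
  then have "coord (x + y) b = (if b \<in> ?C then coord x b + coord y b else 0)"
    by (simp only:, intro coord_sum_u_pair) (use coord_finite coord_basis in auto)
  then show ?thesis by auto
qed

lemma coord_zero [simp]: "coord 0 b = 0"
  using coord_add[of 0 0 b] by simp

lemma coord_sum: "coord (sum f A) b = (\<Sum>a\<in>A. coord (f a) b)"
  by (induction A rule: infinite_finite_induct) (simp_all add: coord_add)

lemma coord_uminus: "coord (- x) b = - coord x b"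
  using coord_add[of x "- x" b] by (simp add: add_eq_0_iff)

lemma coord_scalar: "coord (scalar c * x) b = c * coord x b"
proof -
  let ?C = "{b. coord x b \<noteq> 0}"
  have "scalar c * x = scalar c * (\<Sum>b\<in>?C. scalar (coord x b) * u_pair b)"
    using coord_expand[of ?C x] coord_finite by simp
  also have "\<dots> = (\<Sum>b\<in>?C. scalar (c * coord x b) * u_pair b)"
    by (simp add: sum_distrib_left scalar_simps mult.assoc)
  finally have "coord (scalar c * x) b = (if b \<in> ?C then c * coord x b else 0)"
    by (simp only:, intro coord_sum_u_pair) (use coord_finite coord_basis in auto)
  then show ?thesis by auto
qed

lemma coord_u_pair: "b' \<in> basis_pairs \<Longrightarrow> coord (u_pair b') b = (if b = b' then 1 else 0)"
  using coord_sum_u_pair[of "{b'}" "\<lambda>_. 1" b] by (simp add: scalar_simps)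

text \<open>Only an upper bound is kept, since the factors \<open>t\<close> lower the degree of a
  product.\<close>

definition deg_le :: "nat \<Rightarrow> ualg \<Rightarrow> bool" where
  "deg_le n x \<longleftrightarrow> (\<forall>b. coord x b \<noteq> 0 \<longrightarrow> pair_degree b \<le> n)"

lemma deg_le_mono: "deg_le m x \<Longrightarrow> m \<le> n \<Longrightarrow> deg_le n x"
  by (auto simp: deg_le_def intro: le_trans)

lemma deg_le_add: "deg_le n x \<Longrightarrow> deg_le n y \<Longrightarrow> deg_le n (x + y)"
  unfolding deg_le_def coord_add by (metis add_0)

lemma deg_le_zero: "deg_le n 0"
  by (simp add: deg_le_def)

lemma deg_le_scalar: "deg_le n x \<Longrightarrow> deg_le n (scalar c * x)"
  unfolding deg_le_def coord_scalar by (metis mult_zero_right)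

lemma coord_word_val:
  "\<exists>D. \<forall>w b. valid w \<and> length w = n \<and> coord (word_val w) b \<noteq> 0 \<longrightarrow> pair_degree b \<le> n \<and> max_index w \<le> max_index (pair_word b) + D"
proof -
  obtain D where D: "\<And>w. valid w \<Longrightarrow> length w = n \<Longrightarrow> (\<exists>b\<in>basis_pairs. \<exists>c.
     word_val w = scalar (t_laurent ^ c) * u_pair b \<and> pair_degree b \<le> n \<and> max_index w \<le> max_index (pair_word b) + D)"
    using word_val_reduce[of n] by blast
  have "pair_degree b \<le> n \<and> max_index w \<le> max_index (pair_word b) + D"
    if w: "valid w" "length w = n" "coord (word_val w) b \<noteq> 0" for w b
  proof -
    obtain b' c where b': "b' \<in> basis_pairs" "word_val w = scalar (t_laurent ^ c) * u_pair b'"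
      "pair_degree b' \<le> n" "max_index w \<le> max_index (pair_word b') + D" using D[OF w(1,2)] by blast
    then have "b = b'" using w(3) by (simp add: coord_scalar coord_u_pair split: if_splits)
    then show ?thesis using b' by simp
  qed
  then show ?thesis by blast
qed

lemma deg_le_word_val: "valid w \<Longrightarrow> length w \<le> n \<Longrightarrow> deg_le n (word_val w)"
  unfolding deg_le_def
proof (intro allI impI)
  fix b assume w: "valid w" "length w \<le> n" "coord (word_val w) b \<noteq> 0"
  then have "pair_degree b \<le> length w" using coord_word_val[of "length w"] by blast
  then show "pair_degree b \<le> n" using w(2) by linarith
qed

lemma words_bounded:
  "\<exists>M. \<forall>w. valid w \<and> length w \<le> n \<and> coord (word_val w) b \<noteq> 0 \<longrightarrow> max_index w \<le> M"
proof (induction n)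
  case 0
  show ?case by (intro exI[of _ 0]) auto
next
  case (Suc n)
  then obtain M where M: "\<forall>w. valid w \<and> length w \<le> n \<and> coord (word_val w) b \<noteq> 0 \<longrightarrow> max_index w \<le> M" by blast
  obtain D where D: "\<forall>w b. valid w \<and> length w = Suc n \<and> coord (word_val w) b \<noteq> 0 \<longrightarrow>
      pair_degree b \<le> Suc n \<and> max_index w \<le> max_index (pair_word b) + D" using coord_word_val by blast
  have "max_index w \<le> max M (max_index (pair_word b) + D)"
    if "valid w" "length w \<le> Suc n" "coord (word_val w) b \<noteq> 0" for w
  proof (cases "length w = Suc n")
    case True
    then have "max_index w \<le> max_index (pair_word b) + D" using D that by blast
    then show ?thesis by (simp add: le_max_iff_disj)
  next
    case False
    then have "length w \<le> n" using that by simp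
    then have "max_index w \<le> M" using M that by blast
    then show ?thesis by (simp add: le_max_iff_disj)
  qed
  then show ?case by blast
qed

lemma finite_words: "finite {w. max_index w \<le> M \<and> length w \<le> n}"
proof -
  have "l \<in> Gen ` {..M} \<union> Dual ` {..M}" if "letter_index l \<le> M" for l
    using that by (cases l) auto
  then have "{w. max_index w \<le> M \<and> length w \<le> n} \<subseteq> {w. set w \<subseteq> Gen ` {..M} \<union> Dual ` {..M} \<and> length w \<le> n}"
    by (auto simp: max_index_le_iff)
  then show ?thesis using finite_lists_length_le[of "Gen ` {..M} \<union> Dual ` {..M}" n]
    by (meson finite_UnI finite_atMost finite_imageI finite_subset)
qed

lemma pair_word_inj: "inj_on pair_word basis_pairs"
proof (rule inj_onI)
  fix b b' assume b: "b \<in> basis_pairs" "b' \<in> basis_pairs" "pair_word b = pair_word b'"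
  then have "coord (u_pair b) b = coord (u_pair b') b" by (simp add: u_pair_word_val)
  then show "b = b'" using b by (simp add: coord_u_pair split: if_splits)
qed

definition fibre :: "nat \<Rightarrow> tableau_pair \<Rightarrow> (tableau_pair \<times> tableau_pair) set" where
  "fibre n b = {(b1, b2). b1 \<in> basis_pairs \<and> b2 \<in> basis_pairs \<and> pair_degree b1 \<le> n \<and>
     pair_degree b2 \<le> n \<and> coord (u_pair b1 * u_pair b2) b \<noteq> 0}"

lemma u_pair_mult_word_val: "u_pair b1 * u_pair b2 = word_val (pair_word b1 @ pair_word b2)"
  by (simp add: u_pair_word_val word_val_simps)

text \<open>A product of two basis elements is a word; its letters are bounded by those of
  \<open>b\<close> up to a constant.\<close>

lemma finite_fibre: "finite (fibre n b)"
proof -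
  obtain M where M: "\<forall>w. valid w \<and> length w \<le> 2 * n \<and> coord (word_val w) b \<noteq> 0 \<longrightarrow> max_index w \<le> M"
    using words_bounded by blast
  let ?W = "{w. max_index w \<le> M \<and> length w \<le> n}"
  let ?f = "\<lambda>(b1, b2). (pair_word b1, pair_word b2)"
  have "?f ` fibre n b \<subseteq> ?W \<times> ?W"
  proof (rule image_subsetI)
    fix p assume "p \<in> fibre n b"
    moreover obtain b1 b2 where p: "p = (b1, b2)" by (rule prod.exhaust)
    ultimately have *: "b1 \<in> basis_pairs" "b2 \<in> basis_pairs" "pair_degree b1 \<le> n" "pair_degree b2 \<le> n"
      "coord (word_val (pair_word b1 @ pair_word b2)) b \<noteq> 0" by (auto simp: fibre_def u_pair_mult_word_val)
    then have "valid (pair_word b1 @ pair_word b2)" "length (pair_word b1 @ pair_word b2) \<le> 2 * n"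
      using valid_pair_word by (simp_all add: pair_degree_length)
    then have "max_index (pair_word b1 @ pair_word b2) \<le> M" using M *(5) by blast
    then show "?f p \<in> ?W \<times> ?W"
      using * by (simp add: pair_degree_length p)
  qed
  then have "finite (?f ` fibre n b)" using finite_words finite_subset by blast
  moreover have "inj_on ?f (fibre n b)"
    using pair_word_inj by (auto simp: inj_on_def fibre_def)
  ultimately show ?thesis by (rule finite_imageD)
qed

lemma coord_mult:
  assumes "deg_le n x" "deg_le n y"
  shows "coord (x * y) b = (\<Sum>(b1, b2)\<in>fibre n b. coord x b1 * coord y b2 * coord (u_pair b1 * u_pair b2) b)"
proof -
  let ?X = "{b. coord x b \<noteq> 0}" and ?Y = "{b. coord y b \<noteq> 0}"
  have "x * y = (\<Sum>b1\<in>?X. scalar (coord x b1) * u_pair b1) * (\<Sum>b2\<in>?Y. scalar (coord y b2) * u_pair b2)"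
    using coord_expand[of ?X x] coord_expand[of ?Y y] coord_finite by simp
  also have "\<dots> = (\<Sum>b1\<in>?X. \<Sum>b2\<in>?Y. scalar (coord x b1 * coord y b2) * (u_pair b1 * u_pair b2))"
    unfolding sum_product
  proof (intro sum.cong refl)
    fix b1 b2
    show "scalar (coord x b1) * u_pair b1 * (scalar (coord y b2) * u_pair b2) =
        scalar (coord x b1 * coord y b2) * (u_pair b1 * u_pair b2)"
      unfolding scalar_simps by (metis mult.assoc scalar_central)
  qed
  finally have "coord (x * y) b =
      (\<Sum>b1\<in>?X. \<Sum>b2\<in>?Y. coord x b1 * coord y b2 * coord (u_pair b1 * u_pair b2) b)"
    by (simp add: coord_sum coord_scalar)
  also have "\<dots> = (\<Sum>(b1, b2)\<in>?X \<times> ?Y. coord x b1 * coord y b2 * coord (u_pair b1 * u_pair b2) b)"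
    by (simp add: sum.cartesian_product)
  also have "\<dots> = (\<Sum>(b1, b2)\<in>fibre n b. coord x b1 * coord y b2 * coord (u_pair b1 * u_pair b2) b)"
  proof (rule sum.mono_neutral_cong[OF finite_fibre])
    show "finite (?X \<times> ?Y)" using coord_finite by simp
  qed (use assms in \<open>auto simp: fibre_def deg_le_def dest: coord_basis\<close>)
  finally show ?thesis .
qed

lemma deg_le_mult:
  assumes "deg_le n x" "deg_le n y"
  shows "deg_le (2 * n) (x * y)"
  unfolding deg_le_def
proof (intro allI impI)
  fix b assume "coord (x * y) b \<noteq> 0"
  then have "fibre n b \<noteq> {}" using coord_mult[OF assms, of b] by auto
  then obtain b1 b2 where b: "(b1, b2) \<in> fibre n b" by auto
  then have *: "b1 \<in> basis_pairs" "b2 \<in> basis_pairs" "pair_degree b1 \<le> n" "pair_degree b2 \<le> n"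
    "coord (u_pair b1 * u_pair b2) b \<noteq> 0" by (simp_all add: fibre_def)
  then have "valid (pair_word b1 @ pair_word b2)" "length (pair_word b1 @ pair_word b2) \<le> 2 * n"
    using valid_pair_word by (simp_all add: pair_degree_length)
  then have "deg_le (2 * n) (u_pair b1 * u_pair b2)" unfolding u_pair_mult_word_val by (rule deg_le_word_val)
  then show "pair_degree b \<le> 2 * n" using *(5) unfolding deg_le_def by blast
qed

text \<open>Coefficientwise convergence in the discrete topology, with a common bound on the degrees so
  that the limit lies in the completion.\<close>

definition converges :: "(nat \<Rightarrow> ualg) \<Rightarrow> uhat \<Rightarrow> bool" where
  "converges X f \<longleftrightarrow> (\<exists>n. \<forall>N. deg_le n (X N)) \<and>
     (\<forall>b. eventually (\<lambda>N. coord (X N) b = hcoeff f b) sequentially)"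

lemma converges_coord: "converges X f \<Longrightarrow> eventually (\<lambda>N. coord (X N) b = hcoeff f b) sequentially"
  unfolding converges_def by blast

lemma converges_deg: "converges X f \<Longrightarrow> \<exists>n. \<forall>N. deg_le n (X N)"
  by (simp add: converges_def)

lemma convergesI: "(\<And>N. deg_le n (X N)) \<Longrightarrow>
    (\<And>b. eventually (\<lambda>N. coord (X N) b = hcoeff f b) sequentially) \<Longrightarrow> converges X f"
  unfolding converges_def by blast

lemma converges_unique: "converges X f \<Longrightarrow> converges X g \<Longrightarrow> f = g"
proof (rule uhat_eqI)
  fix b assume "converges X f" "converges X g"
  then have "eventually (\<lambda>N. coord (X N) b = hcoeff f b \<and> coord (X N) b = hcoeff g b) sequentially"
    by (intro eventually_conj converges_coord)
  then have "\<exists>N. coord (X N) b = hcoeff f b \<and> coord (X N) b = hcoeff g b"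
    by (rule eventually_happens'[OF sequentially_bot])
  then show "hcoeff f b = hcoeff g b" by auto
qed

lemma converges_degree:
  assumes "converges X f" "\<forall>N. deg_le n (X N)" "hcoeff f b \<noteq> 0"
  shows "b \<in> basis_pairs" "pair_degree b \<le> n"
proof -
  have "eventually (\<lambda>N. coord (X N) b = hcoeff f b) sequentially" by (rule converges_coord[OF assms(1)])
  then have "\<exists>N. coord (X N) b = hcoeff f b" by (rule eventually_happens'[OF sequentially_bot])
  then obtain N where "coord (X N) b \<noteq> 0" using assms(3) by metis
  then show "b \<in> basis_pairs" "pair_degree b \<le> n"
    using assms(2) coord_basis unfolding deg_le_def by blast+
qed

lemma converges_add: "converges X f \<Longrightarrow> converges Y g \<Longrightarrow> converges (\<lambda>N. X N + Y N) (f + g)"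
proof -
  assume X: "converges X f" and Y: "converges Y g"
  obtain m n where mn: "\<forall>N. deg_le m (X N)" "\<forall>N. deg_le n (Y N)"
    using converges_deg[OF X] converges_deg[OF Y] by blast
  show ?thesis
  proof (rule convergesI)
    show "deg_le (max m n) (X N + Y N)" for N
      using mn by (intro deg_le_add) (auto intro: deg_le_mono)
    show "eventually (\<lambda>N. coord (X N + Y N) b = hcoeff (f + g) b) sequentially" for b
      using converges_coord[OF X, of b] converges_coord[OF Y, of b]
      by eventually_elim (simp add: coord_add plus_uhat.rep_eq)
  qed
qed

lemma converges_uminus: "converges X f \<Longrightarrow> converges (\<lambda>N. - X N) (- f)"
  unfolding converges_def deg_le_def by (simp add: coord_uminus uminus_uhat.rep_eq)

lemma converges_scalar: "converges (\<lambda>N. scalar c) (hat_scalar c)"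
proof -
  have "scalar c = scalar c * u_pair ([], [])" by (simp add: u_pair_word_val pair_word_def word_val_simps)
  then have "coord (scalar c) b = (if b = ([], []) then c else 0)" for b
    using coord_scalar[of c "u_pair ([], [])" b] coord_u_pair[OF empty_in_basis_pairs, of b] by simp
  then show ?thesis
    by (intro convergesI[of 0]) (simp_all add: hcoeff_hat_scalar deg_le_def pair_degree_def shape_def)
qed

lemma hat_scalar_0: "hat_scalar 0 = 0"
  by (rule uhat_eqI) (simp add: hcoeff_hat_scalar zero_uhat.rep_eq)

lemma converges_0: "converges (\<lambda>N. 0) 0" and converges_1: "converges (\<lambda>N. 1) 1"
  using converges_scalar[of 0] converges_scalar[of 1]
  by (simp_all add: scalar_simps hat_scalar_0 one_uhat_def)

lemma converges_sum: "(\<And>a. a \<in> A \<Longrightarrow> converges (X a) (f a)) \<Longrightarrow> converges (\<lambda>N. \<Sum>a\<in>A. X a N) (\<Sum>a\<in>A. f a)"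
  by (induction A rule: infinite_finite_induct) (simp_all add: converges_0 converges_add)

lemma converges_approx: "\<exists>X. converges X f"
proof -
  have f: "\<And>b. hcoeff f b \<noteq> 0 \<Longrightarrow> b \<in> basis_pairs" "finite (pair_degree ` {b. hcoeff f b \<noteq> 0})"
    using hcoeff[of f] by auto
  then obtain n where n: "\<And>b. hcoeff f b \<noteq> 0 \<Longrightarrow> pair_degree b \<le> n"
    unfolding finite_nat_set_iff_bounded_le by blast
  define B where "B N = {b \<in> basis_pairs. pair_degree b \<le> n \<and> max_index (pair_word b) \<le> N}" for N
  have B: "finite (B N)" "B N \<subseteq> basis_pairs" for N
  proof -
    have "pair_word ` B N \<subseteq> {w. max_index w \<le> N \<and> length w \<le> n}" by (auto simp: B_def pair_degree_length)
    then have "finite (pair_word ` B N)" using finite_words finite_subset by blast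
    moreover have "inj_on pair_word (B N)"
      by (rule inj_on_subset[OF pair_word_inj]) (auto simp: B_def)
    ultimately show "finite (B N)" by (rule finite_imageD)
  qed (auto simp: B_def)
  define X where "X N = (\<Sum>b\<in>B N. scalar (hcoeff f b) * u_pair b)" for N
  have c: "coord (X N) b = (if b \<in> B N then hcoeff f b else 0)" for N b
    unfolding X_def by (rule coord_sum_u_pair[OF B])
  have "deg_le n (X N)" for N by (simp add: deg_le_def c B_def)
  moreover have "eventually (\<lambda>N. coord (X N) b = hcoeff f b) sequentially" for b
  proof (cases "hcoeff f b = 0")
    case False
    then have "\<forall>N\<ge>max_index (pair_word b). coord (X N) b = hcoeff f b" using f(1) n by (simp add: c B_def)
    then show ?thesis unfolding eventually_sequentially by blast
  qed (simp add: c)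
  ultimately have "converges X f" by (rule convergesI)
  then show ?thesis by (intro exI)
qed

text \<open>A coefficient of the product is a finite sum over a fibre that does not depend on
  \<open>N\<close>, and on this fibre both factors are eventually equal to their limits.\<close>

theorem converges_mult:
  assumes "converges X f" "converges Y g"
  shows "converges (\<lambda>N. X N * Y N) (f * g)"
proof -
  obtain m1 m2 where "\<forall>N. deg_le m1 (X N)" "\<forall>N. deg_le m2 (Y N)"
    using converges_deg[OF assms(1)] converges_deg[OF assms(2)] by blast
  then obtain n where n: "\<forall>N. deg_le n (X N)" "\<forall>N. deg_le n (Y N)"
    by (metis deg_le_mono max.cobounded1 max.cobounded2)
  define h where "h = (\<lambda>b. \<Sum>(b1, b2)\<in>fibre n b. hcoeff f b1 * hcoeff g b2 * coord (u_pair b1 * u_pair b2) b)"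
  have h: "Sum_any (\<lambda>(b1, b2). hcoeff f b1 * hcoeff g b2 *
      Poly_Mapping.lookup (basis_coords (u_pair b1 * u_pair b2)) b) = h b" for b
    unfolding h_def coord_def[symmetric]
  proof (rule Sum_any.expand_superset[OF finite_fibre])
    show "{p. (case p of (b1, b2) \<Rightarrow> hcoeff f b1 * hcoeff g b2 * coord (u_pair b1 * u_pair b2) b) \<noteq> 0}
        \<subseteq> fibre n b"
      using converges_degree[OF assms(1) n(1)] converges_degree[OF assms(2) n(2)] by (auto simp: fibre_def)
  qed
  have lim: "eventually (\<lambda>N. coord (X N * Y N) b = h b) sequentially" for b
  proof -
    have "eventually (\<lambda>N. \<forall>p\<in>fibre n b. coord (X N) (fst p) = hcoeff f (fst p) \<and>
        coord (Y N) (snd p) = hcoeff g (snd p)) sequentially"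
      by (intro eventually_ball_finite finite_fibre ballI eventually_conj converges_coord assms)
    then show ?thesis
    proof eventually_elim
      case (elim N)
      then show ?case unfolding h_def
        by (subst coord_mult[of n]) (use n in \<open>auto intro!: sum.cong\<close>)
    qed
  qed
  have deg: "\<forall>N. deg_le (2 * n) (X N * Y N)" using n by (auto intro: deg_le_mult)
  have hb: "b \<in> basis_pairs \<and> pair_degree b \<le> 2 * n" if nz: "h b \<noteq> 0" for b
  proof -
    have "\<exists>N. coord (X N * Y N) b = h b" by (rule eventually_happens'[OF sequentially_bot lim])
    then obtain N where "coord (X N * Y N) b \<noteq> 0" using nz by metis
    then show ?thesis using deg coord_basis unfolding deg_le_def by blast
  qed
  then have "pair_degree ` {b. h b \<noteq> 0} \<subseteq> {..2 * n}" by auto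
  then have "finite (pair_degree ` {b. h b \<noteq> 0})" using finite_subset by blast
  then have "hcoeff (f * g) = h"
    unfolding times_uhat_def h using hb by (subst Abs_uhat_inverse) auto
  then show ?thesis using deg lim by (intro convergesI[of "2 * n"]) simp_all
qed

text \<open>Every element of the completion is a limit of elements of the algebra, so the ring axioms
  pass to the limit.\<close>

instance uhat :: ring_1
proof
  fix f g h :: uhat
  obtain X Y Z where c: "converges X f" "converges Y g" "converges Z h" using converges_approx by metis
  show "f * g * h = f * (g * h)"
    using converges_unique[OF converges_mult[OF converges_mult[OF c(1,2)] c(3)]] converges_mult[OF c(1) converges_mult[OF c(2,3)]]
    by (simp add: mult.assoc)
  show "(f + g) * h = f * h + g * h"
    using converges_unique[OF converges_mult[OF converges_add[OF c(1,2)] c(3)]]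
      converges_add[OF converges_mult[OF c(1,3)] converges_mult[OF c(2,3)]] by (simp add: distrib_right)
  show "f * (g + h) = f * g + f * h"
    using converges_unique[OF converges_mult[OF c(1) converges_add[OF c(2,3)]]]
      converges_add[OF converges_mult[OF c(1,2)] converges_mult[OF c(1,3)]] by (simp add: distrib_left)
  show "1 * f = f" using converges_unique[OF converges_mult[OF converges_1 c(1)]] c(1) by simp
  show "f * 1 = f" using converges_unique[OF converges_mult[OF c(1) converges_1]] c(1) by simp
  have "hcoeff (1 :: uhat) ([], []) \<noteq> hcoeff 0 ([], [])"
    by (simp add: one_uhat_def hcoeff_hat_scalar zero_uhat.rep_eq)
  then show "(0 :: uhat) \<noteq> 1" by metis
qed

lemma hat_scalar_add: "hat_scalar (c + d) = hat_scalar c + hat_scalar d"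
  by (rule uhat_eqI) (simp add: hcoeff_hat_scalar plus_uhat.rep_eq)

lemma hat_scalar_mult: "hat_scalar (c * d) = hat_scalar c * hat_scalar d"
  using converges_unique[OF converges_mult[OF converges_scalar[of c] converges_scalar[of d]]] converges_scalar[of "c * d"]
  by (simp add: scalar_simps)

lemma hat_scalar_central: "hat_scalar c * f = f * hat_scalar c"
proof -
  obtain X where X: "converges X f" using converges_approx by blast
  have "(\<lambda>N. scalar c * X N) = (\<lambda>N. X N * scalar c)" by (rule ext) (rule scalar_central)
  then show ?thesis
    using converges_unique[OF converges_mult[OF converges_scalar X]] converges_mult[OF X converges_scalar] by metis
qed

lemma stable_value_eq:
  assumes "eventually (\<lambda>i. f i = c) F" "F \<noteq> bot"
  shows "stable_value F f = c"
  unfolding stable_value_def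
proof (rule the_equality)
  fix d assume "eventually (\<lambda>i. f i = d) F"
  with assms(1) have "eventually (\<lambda>i. c = d) F" by eventually_elim auto
  then show "d = c" using assms(2) by (simp add: eventually_const)
qed (rule assms)

lemma hat_limit_converges: "converges (\<lambda>N. fps_nth (F N) n) f \<Longrightarrow> hat_limit F n = f"
proof -
  assume c: "converges (\<lambda>N. fps_nth (F N) n) f"
  have "stable_value sequentially (\<lambda>N. coord (fps_nth (F N) n) b) = hcoeff f b" for b
    by (intro stable_value_eq converges_coord c) simp
  then show ?thesis unfolding hat_limit_def coord_def[symmetric] by (simp add: hcoeff_inverse)
qed

section \<open>Elementary series and their commutation\<close>

text \<open>Combinations of words with a property of the words, so that length and largest letter can be
  controlled without computing coordinates.\<close>

inductive_set word_span :: "(letter list \<Rightarrow> bool) \<Rightarrow> ualg set" for P where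
  zero: "0 \<in> word_span P"
| word: "valid w \<Longrightarrow> P w \<Longrightarrow> scalar c * word_val w \<in> word_span P"
| add: "x \<in> word_span P \<Longrightarrow> y \<in> word_span P \<Longrightarrow> x + y \<in> word_span P"

lemma word_span_word_val: "valid w \<Longrightarrow> P w \<Longrightarrow> word_val w \<in> word_span P"
  using word_span.word[of w P 1] by (simp add: scalar_simps)

lemma word_span_mono: "x \<in> word_span P \<Longrightarrow> (\<And>w. P w \<Longrightarrow> Q w) \<Longrightarrow> x \<in> word_span Q"
  by (induction rule: word_span.induct) (auto intro: word_span.intros)

lemma word_span_mult:
  assumes "x \<in> word_span P" "y \<in> word_span Q" "\<And>v w. P v \<Longrightarrow> Q w \<Longrightarrow> R (v @ w)"
  shows "x * y \<in> word_span R"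
  using assms(1)
proof induction
  case (word v c)
  from assms(2) show ?case
  proof induction
    case (word w d)
    have "scalar c * word_val v * (scalar d * word_val w) = scalar (c * d) * word_val (v @ w)"
      unfolding scalar_simps word_val_simps by (metis mult.assoc scalar_central)
    then show ?case using word \<open>valid v\<close> \<open>P v\<close> assms(3) by (auto intro: word_span.word)
  qed (auto simp: distrib_left intro: word_span.intros)
qed (auto simp: distrib_right intro: word_span.intros)

lemma word_span_deg: "x \<in> word_span P \<Longrightarrow> (\<And>w. P w \<Longrightarrow> length w \<le> n) \<Longrightarrow> deg_le n x"
  by (induction rule: word_span.induct) (auto intro: deg_le_zero deg_le_add deg_le_scalar deg_le_word_val)

lemma word_span_coord:
  "x \<in> word_span P \<Longrightarrow> (\<And>w. valid w \<Longrightarrow> P w \<Longrightarrow> coord (word_val w) b = 0) \<Longrightarrow> coord x b = 0"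
  by (induction rule: word_span.induct) (simp_all add: coord_add coord_scalar)

lemma word_span_coord_large:
  "\<exists>M. \<forall>N>M. \<forall>x\<in>word_span (\<lambda>w. length w \<le> n \<and> N \<le> max_index w). coord x b = 0"
proof -
  obtain M where M: "\<forall>w. valid w \<and> length w \<le> n \<and> coord (word_val w) b \<noteq> 0 \<longrightarrow> max_index w \<le> M"
    using words_bounded by blast
  have "coord x b = 0" if "N > M" "x \<in> word_span (\<lambda>w. length w \<le> n \<and> N \<le> max_index w)" for N x
    using that(2)
  proof (rule word_span_coord)
    fix w assume "valid w" "length w \<le> n \<and> N \<le> max_index w"
    then show "coord (word_val w) b = 0" using M that(1) by (meson leD le_trans)
  qed
  then show ?thesis by blast
qed

text \<open>Words of bounded length whose letters tend to infinity contribute to each basis element only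
  finitely often.\<close>

lemma converges_large:
  assumes "\<And>N. X N \<in> word_span (\<lambda>w. length w \<le> n \<and> N \<le> max_index w)"
  shows "converges X 0"
proof (rule convergesI)
  show "deg_le n (X N)" for N using assms[of N] by (rule word_span_deg) simp
  show "eventually (\<lambda>N. coord (X N) b = hcoeff 0 b) sequentially" for b
  proof -
    obtain M where M: "\<forall>N>M. \<forall>x\<in>word_span (\<lambda>w. length w \<le> n \<and> N \<le> max_index w). coord x b = 0"
      using word_span_coord_large by blast
    then have "\<forall>N\<ge>Suc M. coord (X N) b = hcoeff 0 b"
      using assms by (simp add: zero_uhat.rep_eq Suc_le_eq)
    then show ?thesis unfolding eventually_sequentially by blast
  qed
qed

text \<open>The increments only involve words with a letter of index at least \<open>N\<close>, so every
  coefficient is eventually constant.\<close>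

lemma converges_stable:
  assumes deg: "\<And>N. X N \<in> word_span (\<lambda>w. length w \<le> n)"
    and step: "\<And>N. X (Suc N) - X N \<in> word_span (\<lambda>w. length w \<le> n \<and> N \<le> max_index w)"
  shows "\<exists>f. converges X f"
proof -
  have d: "deg_le n (X N)" for N using deg[of N] by (rule word_span_deg) simp
  have "\<exists>M. \<forall>N\<ge>M. coord (X N) b = coord (X M) b" for b
  proof -
    obtain M where M: "\<forall>N>M. \<forall>x\<in>word_span (\<lambda>w. length w \<le> n \<and> N \<le> max_index w). coord x b = 0"
      using word_span_coord_large by blast
    have "coord (X N) b = coord (X (Suc M)) b" if "N \<ge> Suc M" for N
      using that
    proof (induction N rule: dec_induct)
      case (step N)
      have "coord (X (Suc N) - X N) b = 0" using M assms(2)[of N] step.hyps by (simp add: Suc_le_eq)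
      then have "coord (X (Suc N)) b = coord (X N) b"
        using coord_add[of "X (Suc N) - X N" "X N" b] by simp
      then show ?case using step.IH by simp
    qed simp
    then show ?thesis by blast
  qed
  then obtain M where M: "\<And>b N. N \<ge> M b \<Longrightarrow> coord (X N) b = coord (X (M b)) b" by metis
  define h where "h b = coord (X (M b)) b" for b
  have h: "b \<in> basis_pairs \<and> pair_degree b \<le> n" if "h b \<noteq> 0" for b
  proof -
    have nz: "coord (X (M b)) b \<noteq> 0" using that by (simp add: h_def)
    then have "pair_degree b \<le> n" using d[of "M b"] unfolding deg_le_def by blast
    then show ?thesis using coord_basis[OF nz] by blast
  qed
  have "pair_degree ` {b. h b \<noteq> 0} \<subseteq> {..n}"
  proof (rule image_subsetI)
    fix b assume "b \<in> {b. h b \<noteq> 0}"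
    then show "pair_degree b \<in> {..n}" using h[of b] by simp
  qed
  then have "finite (pair_degree ` {b. h b \<noteq> 0})" using finite_subset by blast
  then have hc: "hcoeff (Abs_uhat h) = h" using h by (intro Abs_uhat_inverse) blast
  have "converges X (Abs_uhat h)"
  proof (rule convergesI[OF d])
    fix b
    have "\<forall>N\<ge>M b. coord (X N) b = hcoeff (Abs_uhat h) b" unfolding hc h_def using M by blast
    then show "eventually (\<lambda>N. coord (X N) b = hcoeff (Abs_uhat h) b) sequentially"
      unfolding eventually_sequentially by blast
  qed
  then show ?thesis by blast
qed

lemma lin_factor_nth_left:
  "fps_nth ((1 + fps_const c * fps_X) * F) n = fps_nth F n + (if n = 0 then 0 else c * fps_nth F (n - 1))"
  for c :: "'a::ring_1"
  by (simp add: distrib_right mult.assoc)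

lemma lin_factor_nth_right:
  "fps_nth (F * (1 + fps_const c * fps_X)) n = fps_nth F n + (if n = 0 then 0 else fps_nth F (n - 1) * c)"
  for c :: "'a::ring_1"
  by (simp add: distrib_left mult.assoc[symmetric])

text \<open>The noncommutative elementary symmetric function of degree \<open>n\<close> in the listed
  generators.\<close>

definition elementary :: "letter list \<Rightarrow> nat \<Rightarrow> ualg" where
  "elementary xs n = fps_nth (prod_list (map (\<lambda>l. lin_factor (gen l)) xs)) n"

definition shift_seq :: "(nat \<Rightarrow> 'a::zero) \<Rightarrow> nat \<Rightarrow> 'a" where
  "shift_seq f n = (if n = 0 then 0 else f (n - 1))"

lemma shift_seq_simps [simp]: "shift_seq f 0 = 0" "shift_seq f (Suc n) = f n"
  by (simp_all add: shift_seq_def)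

lemma elementary_Nil: "elementary [] n = (if n = 0 then 1 else 0)"
  by (simp add: elementary_def)

lemma elementary_Cons: "elementary (l # xs) n = elementary xs n + gen l * shift_seq (elementary xs) n"
  by (simp add: elementary_def lin_factor_def lin_factor_nth_left shift_seq_def)

lemma elementary_snoc: "elementary (xs @ [l]) n = elementary xs n + shift_seq (elementary xs) n * gen l"
  by (simp add: elementary_def lin_factor_def lin_factor_nth_right shift_seq_def)

lemma elementary_span: "valid xs \<Longrightarrow> elementary xs n \<in> word_span (\<lambda>w. length w = n)"
proof (induction xs arbitrary: n)
  case Nil
  then show ?case using word_span_word_val[of "[]"] by (auto simp: elementary_Nil word_val_simps intro: word_span.zero)
next
  case (Cons l xs)
  have "gen l * shift_seq (elementary xs) n \<in> word_span (\<lambda>w. length w = n)"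
  proof (cases n)
    case (Suc m)
    have "word_val [l] \<in> word_span (\<lambda>w. length w = 1)" using Cons.prems by (intro word_span_word_val) auto
    from word_span_mult[OF this Cons.IH[of m]] show ?thesis using Cons.prems Suc by (simp add: word_val_simps)
  qed (simp add: word_span.zero)
  then show ?case using Cons by (simp add: elementary_Cons word_span.add)
qed

lemma elementary_commute:
  "(\<And>l. l \<in> set xs \<Longrightarrow> v * gen l = gen l * v) \<Longrightarrow> v * elementary xs n = elementary xs n * v"
proof (induction xs arbitrary: n)
  case Nil
  then show ?case by (simp add: elementary_Nil)
next
  case (Cons l xs)
  have shift_seq: "v * shift_seq (elementary xs) n = shift_seq (elementary xs) n * v" using Cons by (simp add: shift_seq_def)
  have "v * (gen l * shift_seq (elementary xs) n) = gen l * (v * shift_seq (elementary xs) n)"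
    using Cons.prems[of l] by (simp flip: mult.assoc)
  also have "\<dots> = gen l * shift_seq (elementary xs) n * v" by (simp add: shift_seq mult.assoc)
  finally show ?case using Cons by (simp add: elementary_Cons distrib_left distrib_right)
qed

text \<open>The noncommutative complete symmetric function of degree \<open>n\<close>; the reversal
  makes its generating series inverse to the one of the elementary functions at
  \<open>-x\<close>.\<close>

definition complete_homog :: "letter list \<Rightarrow> nat \<Rightarrow> ualg" where
  "complete_homog xs n = fps_nth (prod_list (map (\<lambda>l. inv_factor (gen l)) (rev xs))) n"

definition alternate :: "nat \<Rightarrow> 'a \<Rightarrow> 'a::uminus" where
  "alternate n x = (if even n then x else - x)"

lemma neg_prod_nth:
  "fps_nth (prod_list (map (\<lambda>l. 1 - fps_const (gen l) * fps_X) xs)) n = alternate n (elementary xs n)"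
proof (induction xs arbitrary: n)
  case (Cons l xs)
  let ?F = "prod_list (map (\<lambda>l. 1 - fps_const (gen l) * fps_X) xs)"
  have "fps_nth ((1 - fps_const (gen l) * fps_X) * ?F) n =
      fps_nth ?F n - (if n = 0 then 0 else gen l * fps_nth ?F (n - 1))"
    by (simp add: left_diff_distrib mult.assoc)
  then show ?case using Cons
    by (cases n) (auto simp: elementary_Cons alternate_def)
qed (simp add: elementary_Nil alternate_def)

lemma complete_elementary:
  "(\<Sum>k\<le>n. complete_homog xs k * alternate (n - k) (elementary xs (n - k))) = (if n = 0 then 1 else 0)"
  "(\<Sum>k\<le>n. alternate k (elementary xs k) * complete_homog xs (n - k)) = (if n = 0 then 1 else 0)"
proof -
  let ?I = "\<lambda>xs. prod_list (map (\<lambda>l. inv_factor (gen l)) (rev xs))"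
  let ?N = "\<lambda>xs. prod_list (map (\<lambda>l. 1 - fps_const (gen l) * fps_X) xs)"
  have "?I xs * ?N xs = 1 \<and> ?N xs * ?I xs = 1"
  proof (induction xs)
    case (Cons l xs)
    let ?i = "inv_factor (gen l)" and ?n = "1 - fps_const (gen l) * fps_X"
    have "?I (l # xs) * ?N (l # xs) = ?I xs * (?i * ?n) * ?N xs" by (simp add: mult.assoc)
    moreover have "?N (l # xs) * ?I (l # xs) = ?n * (?N xs * ?I xs) * ?i" by (simp add: mult.assoc)
    ultimately show ?case using Cons by (simp add: inv_factor)
  qed simp
  then have "fps_nth (?I xs * ?N xs) n = fps_nth 1 n" "fps_nth (?N xs * ?I xs) n = fps_nth 1 n" by simp_all
  then show "(\<Sum>k\<le>n. complete_homog xs k * alternate (n - k) (elementary xs (n - k))) = (if n = 0 then 1 else 0)"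
    "(\<Sum>k\<le>n. alternate k (elementary xs k) * complete_homog xs (n - k)) = (if n = 0 then 1 else 0)"
    unfolding fps_mult_nth neg_prod_nth complete_homog_def by (simp_all add: atLeast0AtMost)
qed

lemma converges_alternate: "converges X f \<Longrightarrow> converges (\<lambda>N. alternate n (X N)) (alternate n f)"
  by (simp add: alternate_def converges_uminus)

lemma converges_delta: "converges (\<lambda>N. if n = (0::nat) then 1 else 0) (if n = 0 then 1 else 0)"
  using converges_0 converges_1 by simp

lemma converges_complete:
  assumes "\<And>n. converges (\<lambda>N. elementary (xs N) n) (q n)"
  shows "\<exists>f. converges (\<lambda>N. complete_homog (xs N) n) f"
proof (induction n rule: less_induct)
  case (less n)
  then obtain f where f: "\<And>k. k < n \<Longrightarrow> converges (\<lambda>N. complete_homog (xs N) k) (f k)" by metis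
  have "elementary xs 0 = 1" for xs by (induction xs) (simp_all add: elementary_Nil elementary_Cons)
  then have e: "complete_homog (xs N) n = (if n = 0 then 1 else 0) +
      - (\<Sum>k<n. complete_homog (xs N) k * alternate (n - k) (elementary (xs N) (n - k)))" for N
    using complete_elementary(1)[of "xs N" n] by (simp add: alternate_def lessThan_Suc_atMost[symmetric] eq_diff_eq[symmetric])
  have "converges (\<lambda>N. \<Sum>k<n. complete_homog (xs N) k * alternate (n - k) (elementary (xs N) (n - k)))
      (\<Sum>k<n. f k * alternate (n - k) (q (n - k)))"
    by (intro converges_sum converges_mult converges_alternate assms) (use f in auto)
  then show ?case unfolding e using converges_add[OF converges_delta converges_uminus] by blast
qed

abbreviation "gens N \<equiv> map Gen [1..<Suc N]"
abbreviation "duals N \<equiv> map Dual (rev [1..<Suc N])"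

lemma valid_gens: "valid (gens N)" "valid (duals N)"
  by (auto simp: valid_def)

lemma elementary_gens: "elementary (gens (Suc N)) n = elementary (gens N) n + shift_seq (elementary (gens N)) n * gen (Gen (Suc N))"
  using elementary_snoc[of "gens N" "Gen (Suc N)"] by simp

lemma elementary_duals: "elementary (duals (Suc N)) n = elementary (duals N) n + gen (Dual (Suc N)) * shift_seq (elementary (duals N)) n"
  using elementary_Cons[of "Dual (Suc N)" "duals N"] by simp

lemma elementary_span_le: "valid xs \<Longrightarrow> elementary xs n \<in> word_span (\<lambda>w. length w \<le> n)"
  by (rule word_span_mono[OF elementary_span]) auto

lemma converges_gens: "\<exists>f. converges (\<lambda>N. elementary (gens N) n) f"
proof (rule converges_stable[OF elementary_span_le[OF valid_gens(1)]])
  fix N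
  have "shift_seq (elementary (gens N)) n * gen (Gen (Suc N)) \<in> word_span (\<lambda>w. length w \<le> n \<and> N \<le> max_index w)"
  proof (cases n)
    case (Suc m)
    have "word_val [Gen (Suc N)] \<in> word_span (\<lambda>w. w = [Gen (Suc N)])" by (intro word_span_word_val) auto
    from word_span_mult[OF elementary_span[OF valid_gens(1), of N m] this] show ?thesis
      using Suc by (simp add: word_val_simps)
  qed (simp add: word_span.zero)
  then show "elementary (gens (Suc N)) n - elementary (gens N) n \<in> word_span (\<lambda>w. length w \<le> n \<and> N \<le> max_index w)"
    unfolding elementary_gens by simp
qed

lemma converges_duals: "\<exists>f. converges (\<lambda>N. elementary (duals N) n) f"
proof (rule converges_stable[OF elementary_span_le[OF valid_gens(2)]])
  fix N
  have "gen (Dual (Suc N)) * shift_seq (elementary (duals N)) n \<in> word_span (\<lambda>w. length w \<le> n \<and> N \<le> max_index w)"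
  proof (cases n)
    case (Suc m)
    have "word_val [Dual (Suc N)] \<in> word_span (\<lambda>w. w = [Dual (Suc N)])" by (intro word_span_word_val) auto
    from word_span_mult[OF this elementary_span[OF valid_gens(2), of N m]] show ?thesis
      using Suc by (simp add: word_val_simps)
  qed (simp add: word_span.zero)
  then show "elementary (duals (Suc N)) n - elementary (duals N) n \<in> word_span (\<lambda>w. length w \<le> n \<and> N \<le> max_index w)"
    unfolding elementary_duals by simp
qed

lemma converges_Q1: "converges (\<lambda>N. elementary (gens N) n) (Q_var 1 n)"
proof -
  obtain f where f: "converges (\<lambda>N. elementary (gens N) n) f" using converges_gens by blast
  then have "hat_limit (\<lambda>N. prod_list (map (\<lambda>i. lin_factor (u_gen i)) [1..<Suc N])) n = f"
    by (intro hat_limit_converges) (simp add: elementary_def o_def del: upt_Suc)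
  then show ?thesis using f by (simp add: Q_var_def)
qed

lemma converges_P1: "converges (\<lambda>N. elementary (duals N) n) (P_var 1 n)"
proof -
  obtain f where f: "converges (\<lambda>N. elementary (duals N) n) f" using converges_duals by blast
  then have "hat_limit (\<lambda>N. prod_list (map (\<lambda>i. lin_factor (u_dual i)) (rev [1..<Suc N]))) n = f"
    by (intro hat_limit_converges) (simp add: elementary_def o_def del: upt_Suc)
  then show ?thesis using f by (simp add: P_var_def)
qed

lemma converges_Q0: "converges (\<lambda>N. complete_homog (gens N) n) (Q_var 0 n)"
proof -
  obtain f where f: "converges (\<lambda>N. complete_homog (gens N) n) f" using converges_complete[OF converges_Q1] by blast
  then have "hat_limit (\<lambda>N. prod_list (map (\<lambda>i. inv_factor (u_gen i)) (rev [1..<Suc N]))) n = f"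
    by (intro hat_limit_converges) (simp add: complete_homog_def o_def rev_map del: upt_Suc)
  then show ?thesis using f by (simp add: Q_var_def)
qed

lemma converges_P0: "converges (\<lambda>N. complete_homog (duals N) n) (P_var 0 n)"
proof -
  obtain f where f: "converges (\<lambda>N. complete_homog (duals N) n) f" using converges_complete[OF converges_P1] by blast
  then have "hat_limit (\<lambda>N. prod_list (map (\<lambda>i. inv_factor (u_dual i)) [1..<Suc N])) n = f"
    by (intro hat_limit_converges) (simp add: complete_homog_def o_def rev_map del: upt_Suc)
  then show ?thesis using f by (simp add: P_var_def)
qed

lemma limit_inverse:
  assumes "\<And>n. converges (\<lambda>N. elementary (xs N) n) (q n)" "\<And>n. converges (\<lambda>N. complete_homog (xs N) n) (p n)"
  shows "(\<Sum>k\<le>n. p k * alternate (n - k) (q (n - k))) = (if n = 0 then 1 else 0)"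
    "(\<Sum>k\<le>n. alternate k (q k) * p (n - k)) = (if n = 0 then 1 else 0)"
proof -
  have "converges (\<lambda>N. \<Sum>k\<le>n. complete_homog (xs N) k * alternate (n - k) (elementary (xs N) (n - k)))
      (\<Sum>k\<le>n. p k * alternate (n - k) (q (n - k)))"
    by (intro converges_sum converges_mult converges_alternate assms)
  then show "(\<Sum>k\<le>n. p k * alternate (n - k) (q (n - k))) = (if n = 0 then 1 else 0)"
    unfolding complete_elementary by (rule converges_unique) (rule converges_delta)
  have "converges (\<lambda>N. \<Sum>k\<le>n. alternate k (elementary (xs N) k) * complete_homog (xs N) (n - k))
      (\<Sum>k\<le>n. alternate k (q k) * p (n - k))"
    by (intro converges_sum converges_mult converges_alternate assms)
  then show "(\<Sum>k\<le>n. alternate k (q k) * p (n - k)) = (if n = 0 then 1 else 0)"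
    unfolding complete_elementary by (rule converges_unique) (rule converges_delta)
qed

lemmas Q_inverse = limit_inverse[OF converges_Q1 converges_Q0]
lemmas P_inverse = limit_inverse[OF converges_P1 converges_P0]

definition diag_sum :: "(nat \<Rightarrow> nat \<Rightarrow> nat \<Rightarrow> 'a::comm_monoid_add) \<Rightarrow> nat \<Rightarrow> nat \<Rightarrow> 'a" where
  "diag_sum F n m = (\<Sum>k\<le>min n m. F k (n - k) (m - k))"

lemma diag_sum_0: "n = 0 \<or> m = 0 \<Longrightarrow> diag_sum F n m = F 0 n m"
  by (auto simp: diag_sum_def)

lemma diag_sum_Suc: "diag_sum F (Suc n) (Suc m) = F 0 (Suc n) (Suc m) + diag_sum (\<lambda>k. F (Suc k)) n m"
  unfolding diag_sum_def min_Suc_Suc by (subst sum.atMost_Suc_shift) simp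

lemma diag_sum_left:
  assumes "\<And>k j. F k 0 j = 0"
  shows "diag_sum F n m = (case n of 0 \<Rightarrow> 0 | Suc n' \<Rightarrow> diag_sum (\<lambda>k i. F k (Suc i)) n' m)"
proof (cases n)
  case (Suc n')
  have "(\<Sum>k\<le>min (Suc n') m. F k (Suc n' - k) (m - k)) = (\<Sum>k\<le>min n' m. F k (Suc (n' - k)) (m - k))"
    by (rule sum.mono_neutral_cong_right) (auto simp: assms le_Suc_eq Suc_diff_le)
  then show ?thesis by (simp add: Suc diag_sum_def)
qed (simp add: diag_sum_0 assms)

lemma diag_sum_right:
  assumes "\<And>k i. F k i 0 = 0"
  shows "diag_sum F n m = (case m of 0 \<Rightarrow> 0 | Suc m' \<Rightarrow> diag_sum (\<lambda>k i j. F k i (Suc j)) n m')"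
proof (cases m)
  case (Suc m')
  have "(\<Sum>k\<le>min n (Suc m'). F k (n - k) (Suc m' - k)) = (\<Sum>k\<le>min n m'. F k (n - k) (Suc (m' - k)))"
    by (rule sum.mono_neutral_cong_right) (auto simp: assms le_Suc_eq Suc_diff_le)
  then show ?thesis by (simp add: Suc diag_sum_def)
qed (simp add: diag_sum_0 assms)

text \<open>The coefficient of \<open>x\<^sup>n y\<^sup>m\<close> in \<open>f(x) (1 - c x
  y)\<^sup>-\<^sup>1 g(y)\<close>.\<close>

definition sandwich :: "(nat \<Rightarrow> 'a) \<Rightarrow> (nat \<Rightarrow> 'a) \<Rightarrow> 'a \<Rightarrow> nat \<Rightarrow> nat \<Rightarrow> 'a::ring_1" where
  "sandwich f g c = diag_sum (\<lambda>k i j. f i * c ^ k * g j)"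

lemma sandwich_sum: "sandwich f g c n m = (\<Sum>k\<le>min n m. f (n - k) * c ^ k * g (m - k))"
  by (simp add: sandwich_def diag_sum_def)

lemma sandwich_0: "n = 0 \<or> m = 0 \<Longrightarrow> sandwich f g c n m = f n * g m"
  by (simp add: sandwich_def diag_sum_0)

lemma sandwich_Suc:
  "sandwich f g c (Suc n) (Suc m) =
     f (Suc n) * g (Suc m) + (\<Sum>k\<le>min n m. f (n - k) * c ^ Suc k * g (m - k))"
  by (simp add: sandwich_def diag_sum_Suc) (simp add: diag_sum_def)

lemma sandwich_shift_left:
  "sandwich (shift_seq f) g c n m = (case n of 0 \<Rightarrow> 0 | Suc n' \<Rightarrow> sandwich f g c n' m)"
  unfolding sandwich_def by (subst diag_sum_left) (simp_all split: nat.split)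

lemma sandwich_shift_right:
  "sandwich f (shift_seq g) c n m = (case m of 0 \<Rightarrow> 0 | Suc m' \<Rightarrow> sandwich f g c n m')"
  unfolding sandwich_def by (subst diag_sum_right) (simp_all split: nat.split)

lemmas sandwich_sh = sandwich_shift_left sandwich_shift_right

lemma power_slide: "u * (v * u) ^ k = (u * v) ^ k * u" for u v :: "'a::monoid_mult"
  by (induction k) (simp_all add: mult.assoc)

text \<open>The left-hand side is the coefficient of \<open>a(x) (1 + u x) (1 - v u x y)\<^sup>-\<^sup>1
  (1 + v y) b(y)\<close>. Moving \<open>u\<close> and \<open>v\<close> outwards replaces
  \<open>v u\<close> by \<open>u v\<close>, and the terms \<open>k\<close> and \<open>k +
  1\<close> combine.\<close>

lemma sandwich_step:
  fixes a b :: "nat \<Rightarrow> 'a::ring_1"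
  assumes va: "\<And>n. v * a n = a n * v" and ub: "\<And>n. u * b n = b n * u"
  shows "sandwich (\<lambda>n. a n + shift_seq a n * u) (\<lambda>n. b n + v * shift_seq b n) (v * u) n m =
    sandwich a b (u * v) n m + sandwich (shift_seq a) b (u * v) n m * u +
    v * sandwich a (shift_seq b) (u * v) n m + v * sandwich (shift_seq a) (shift_seq b) (u * v) n m * u"
proof -
  let ?c = "u * v"
  have vsa: "v * shift_seq a n = shift_seq a n * v" and usb: "u * shift_seq b n = shift_seq b n * u" for n
    using va ub by (simp_all add: shift_seq_def)
  have slide: "u * (v * u) ^ k = ?c ^ k * u" "(v * u) ^ k * v = v * ?c ^ k" for k
    using power_slide[of u v k] power_slide[of v u k] by simp_all
  have t: "(a i + shift_seq a i * u) * (v * u) ^ k * (b j + v * shift_seq b j) =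
      a i * (v * u) ^ k * b j + shift_seq a i * ?c ^ k * b j * u + v * (a i * ?c ^ k * shift_seq b j)
      + shift_seq a i * ?c ^ k * (?c * shift_seq b j)" for i j k
  proof -
    have "shift_seq a i * u * (v * u) ^ k * b j = shift_seq a i * ?c ^ k * b j * u"
      by (metis slide(1) ub mult.assoc)
    moreover have "a i * (v * u) ^ k * (v * shift_seq b j) = v * (a i * ?c ^ k * shift_seq b j)"
      by (metis slide(2) va mult.assoc)
    moreover have "shift_seq a i * u * (v * u) ^ k * (v * shift_seq b j) = shift_seq a i * ?c ^ k * (?c * shift_seq b j)"
      by (metis slide(1) mult.assoc)
    ultimately show ?thesis by (simp add: distrib_left distrib_right)
  qed
  have "sandwich (\<lambda>n. a n + shift_seq a n * u) (\<lambda>n. b n + v * shift_seq b n) (v * u) n m =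
      sandwich a b (v * u) n m + sandwich (shift_seq a) b ?c n m * u + v * sandwich a (shift_seq b) ?c n m
      + sandwich (shift_seq a) (shift_seq (\<lambda>j. ?c * b j)) ?c n m"
  proof -
    have "shift_seq (\<lambda>j. ?c * b j) i = ?c * shift_seq b i" for i by (simp add: shift_seq_def)
    then show ?thesis
      unfolding sandwich_sum t by (simp add: sum.distrib sum_distrib_left sum_distrib_right)
  qed
  moreover have "sandwich a b (v * u) n m = a n * b m + v * sandwich (shift_seq a) (shift_seq b) ?c n m * u"
  proof (cases "n = 0 \<or> m = 0")
    case True
    then show ?thesis by (auto simp: sandwich_0)
  next
    case False
    then obtain n' m' where nm: "n = Suc n'" "m = Suc m'" by (meson not0_implies_Suc)
    have "a i * (v * u) ^ Suc k * b j = v * (a i * ?c ^ k * b j) * u" for i j k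
    proof -
      have "(v * u) ^ Suc k = v * ?c ^ k * u" using slide(2)[of k] by (metis power_Suc2 mult.assoc)
      then show ?thesis by (metis ub va mult.assoc)
    qed
    then show ?thesis
      unfolding nm sandwich_sh nat.case
      unfolding sandwich_Suc unfolding sandwich_sum by (simp add: sum_distrib_left sum_distrib_right del: power_Suc)
  qed
  moreover have "a n * b m + sandwich (shift_seq a) (shift_seq (\<lambda>j. ?c * b j)) ?c n m = sandwich a b ?c n m"
  proof (cases "n = 0 \<or> m = 0")
    case True
    then show ?thesis by (auto simp: sandwich_0)
  next
    case False
    then obtain n' m' where nm: "n = Suc n'" "m = Suc m'" by (meson not0_implies_Suc)
    have "a i * ?c ^ k * (?c * b j) = a i * ?c ^ Suc k * b j" for i j k
      unfolding power_Suc2 by (simp only: mult.assoc)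
    then show ?thesis
      unfolding nm sandwich_sh nat.case
      unfolding sandwich_Suc unfolding sandwich_sum by simp
  qed
  ultimately show ?thesis by (simp add: algebra_simps)
qed

text \<open>The coefficient of \<open>x\<^sup>n y\<^sup>m\<close> in \<open>(1 - t x y)\<^sup>-\<^sup>1
  g(y) f(x)\<close> for central \<open>t\<close>.\<close>

definition twisted :: "(nat \<Rightarrow> 'a) \<Rightarrow> (nat \<Rightarrow> 'a) \<Rightarrow> 'a \<Rightarrow> nat \<Rightarrow> nat \<Rightarrow> 'a::ring_1" where
  "twisted f g t = diag_sum (\<lambda>k i j. t ^ k * (g j * f i))"

lemma twisted_sum: "twisted f g t n m = (\<Sum>k\<le>min n m. t ^ k * (g (m - k) * f (n - k)))"
  by (simp add: twisted_def diag_sum_def)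

lemma twisted_0: "n = 0 \<or> m = 0 \<Longrightarrow> twisted f g t n m = g m * f n"
  by (simp add: twisted_def diag_sum_0)

lemma twisted_Suc:
  "twisted f g t (Suc n) (Suc m) = g (Suc m) * f (Suc n) + t * twisted f g t n m"
  by (simp add: twisted_def diag_sum_Suc) (simp add: diag_sum_def sum_distrib_left mult.assoc)

lemma twisted_shift_left:
  "twisted (shift_seq f) g t n m = (case n of 0 \<Rightarrow> 0 | Suc n' \<Rightarrow> twisted f g t n' m)"
  unfolding twisted_def by (subst diag_sum_left) (simp_all split: nat.split)

lemma twisted_shift_right:
  "twisted f (shift_seq g) t n m = (case m of 0 \<Rightarrow> 0 | Suc m' \<Rightarrow> twisted f g t n m')"
  unfolding twisted_def by (subst diag_sum_right) (simp_all split: nat.split)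

lemmas twisted_sh = twisted_shift_left twisted_shift_right

lemma twisted_step:
  fixes a b :: "nat \<Rightarrow> 'a::ring_1"
  assumes t: "\<And>x. t * x = x * t"
  shows "twisted (\<lambda>n. a n + shift_seq a n * u) (\<lambda>n. b n + v * shift_seq b n) t n m =
    twisted a b t n m + twisted (shift_seq a) b t n m * u + v * twisted a (shift_seq b) t n m
    + v * twisted (shift_seq a) (shift_seq b) t n m * u"
proof -
  have tk: "t ^ k * x = x * t ^ k" for k x
    by (induction k) (simp_all add: mult.assoc t, metis mult.assoc t)
  have "t ^ k * ((b j + v * shift_seq b j) * (a i + shift_seq a i * u)) =
      t ^ k * (b j * a i) + t ^ k * (b j * shift_seq a i) * u + v * (t ^ k * (shift_seq b j * a i))
      + v * (t ^ k * (shift_seq b j * shift_seq a i)) * u" for i j k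
  proof -
    have "t ^ k * (v * x) = v * (t ^ k * x)" for x by (metis mult.assoc tk)
    then show ?thesis by (simp add: distrib_left distrib_right mult.assoc)
  qed
  then show ?thesis unfolding twisted_sum
    by (simp add: sum.distrib sum_distrib_left sum_distrib_right)
qed

text \<open>The innermost factors of both products have the largest index. Exchanging them turns
  \<open>c\<^sub>N\<^sub>+\<^sub>1\<close> into \<open>c\<^sub>N\<close>, and the process ends
  with \<open>c\<^sub>1 = t\<close>.\<close>

lemma truncated_cauchy:
  "sandwich (elementary (gens N)) (elementary (duals N)) (gen (Gen (Suc N)) * gen (Dual (Suc N))) n m =
   twisted (elementary (gens N)) (elementary (duals N)) (scalar t_laurent) n m"
proof (induction N arbitrary: n m)
  case 0
  have c: "gen (Gen (Suc 0)) * gen (Dual (Suc 0)) = scalar t_laurent"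
    using word_val_contract by (simp add: word_val_simps)
  show ?case unfolding sandwich_sum twisted_sum c
    by (intro sum.cong) (auto simp: elementary_Nil)
next
  case (Suc N)
  let ?a = "elementary (gens N)" and ?b = "elementary (duals N)"
  let ?u = "gen (Gen (Suc N))" and ?v = "gen (Dual (Suc N))"
  have comm: "gen (Gen i) * gen (Dual j) = gen (Dual j) * gen (Gen i)" if "1 \<le> i" "1 \<le> j" "i \<noteq> j" for i j
    using word_val_rel[OF word_rel.intros(6)[OF that]] by (simp add: word_val_simps)
  have va: "?v * ?a n = ?a n * ?v" for n
    by (rule elementary_commute) (auto simp del: upt_Suc intro!: comm[symmetric])
  have ub: "?u * ?b n = ?b n * ?u" for n
    by (rule elementary_commute) (auto simp del: upt_Suc intro!: comm)
  have c: "gen (Gen (Suc (Suc N))) * gen (Dual (Suc (Suc N))) = ?v * ?u"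
    using word_val_rel[OF word_rel.intros(5)[of "Suc N"]] by (simp add: word_val_simps)
  have shift_seq: "sandwich (shift_seq ?a) ?b (?u * ?v) n m = twisted (shift_seq ?a) ?b (scalar t_laurent) n m"
    "sandwich ?a (shift_seq ?b) (?u * ?v) n m = twisted ?a (shift_seq ?b) (scalar t_laurent) n m"
    "sandwich (shift_seq ?a) (shift_seq ?b) (?u * ?v) n m = twisted (shift_seq ?a) (shift_seq ?b) (scalar t_laurent) n m"
    unfolding sandwich_sh twisted_sh
    using Suc.IH by (auto split: nat.split)
  have eg: "elementary (gens (Suc N)) = (\<lambda>n. ?a n + shift_seq ?a n * ?u)"
    and ed: "elementary (duals (Suc N)) = (\<lambda>n. ?b n + ?v * shift_seq ?b n)"
    by (rule ext, rule elementary_gens) (rule ext, rule elementary_duals)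
  show ?case unfolding eg ed c
    unfolding sandwich_step[of ?v ?a ?u ?b, OF va ub] twisted_step[OF scalar_central] shift_seq Suc.IH ..
qed

lemma converges_power: "converges X f \<Longrightarrow> converges (\<lambda>N. X N ^ k) (f ^ k)"
  by (induction k) (simp_all add: converges_1 converges_mult)

text \<open>In the truncated identity, the terms with \<open>k > 0\<close> on the left contain the
  letters of index \<open>N + 1\<close> and converge to \<open>0\<close>.\<close>

theorem Q1_P1:
  "Q_var 1 n * P_var 1 m = twisted (Q_var 1) (P_var 1) (hat_scalar t_laurent) n m"
proof -
  let ?X = "\<lambda>k N. elementary (gens N) (n - k) * (gen (Gen (Suc N)) * gen (Dual (Suc N))) ^ k * elementary (duals N) (m - k)"
  have l0: "converges (?X 0) (Q_var 1 n * P_var 1 m)"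
    using converges_mult[OF converges_Q1[of n] converges_P1[of m]] by simp
  have lk: "converges (?X k) 0" if "0 < k" for k
  proof (rule converges_large)
    fix N
    define w where "w = concat (replicate k [Gen (Suc N), Dual (Suc N)])"
    have "word_val w = (gen (Gen (Suc N)) * gen (Dual (Suc N))) ^ k"
      unfolding w_def by (induction k) (simp_all add: word_val_simps mult.assoc)
    moreover have "valid w" unfolding w_def by (induction k) auto
    moreover have "length w = 2 * k" unfolding w_def by (induction k) auto
    moreover have "N \<le> max_index w" unfolding w_def using that by (cases k) auto
    ultimately have "(gen (Gen (Suc N)) * gen (Dual (Suc N))) ^ k \<in> word_span (\<lambda>w. length w = 2 * k \<and> N \<le> max_index w)"
      using word_span_word_val[of w "\<lambda>w. length w = 2 * k \<and> N \<le> max_index w"] by simp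
    from word_span_mult[OF word_span_mult[OF elementary_span[OF valid_gens(1), of N "n - k"] this]
        elementary_span[OF valid_gens(2), of N "m - k"],
        of "\<lambda>w. length w = n - k + 2 * k \<and> N \<le> max_index w" "\<lambda>w. length w \<le> n - k + 2 * k + (m - k) \<and> N \<le> max_index w"]
    show "?X k N \<in> word_span (\<lambda>w. length w \<le> n - k + 2 * k + (m - k) \<and> N \<le> max_index w)"
      by (simp add: le_max_iff_disj del: upt_Suc)
  qed
  have "converges (\<lambda>N. \<Sum>k\<le>min n m. ?X k N) (\<Sum>k\<le>min n m. if k = 0 then Q_var 1 n * P_var 1 m else 0)"
    by (rule converges_sum) (use l0 lk in auto)
  then have "converges (\<lambda>N. sandwich (elementary (gens N)) (elementary (duals N)) (gen (Gen (Suc N)) * gen (Dual (Suc N))) n m)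
      (Q_var 1 n * P_var 1 m)"
    by (simp add: sandwich_sum)
  moreover have "converges (\<lambda>N. twisted (elementary (gens N)) (elementary (duals N)) (scalar t_laurent) n m)
      (twisted (Q_var 1) (P_var 1) (hat_scalar t_laurent) n m)"
    unfolding twisted_sum
    by (intro converges_sum converges_mult converges_power converges_scalar converges_Q1 converges_P1)
  ultimately show ?thesis unfolding truncated_cauchy by (rule converges_unique)
qed

text \<open>The same relation with the geometric series cleared, which is a relation between finitely
  many products.\<close>

corollary Q1_P1_rec:
  "Q_var 1 n * P_var 1 m = P_var 1 m * Q_var 1 n +
    (if n = 0 \<or> m = 0 then 0 else hat_scalar t_laurent * (Q_var 1 (n - 1) * P_var 1 (m - 1)))"
proof (cases "n = 0 \<or> m = 0")
  case True
  then show ?thesis by (auto simp: Q1_P1 twisted_0)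
next
  case False
  then obtain n' m' where "n = Suc n'" "m = Suc m'" by (meson not0_implies_Suc)
  then show ?thesis by (simp add: Q1_P1 twisted_Suc)
qed

section \<open>Power series over the completion\<close>

lemma mps_mult_1_right:
  fixes F :: "('v, 'c::semiring_1) mps"
  shows "F * 1 = F"
proof (rule mps_eqI)
  fix m :: "'v \<Rightarrow>\<^sub>0 nat"
  have "mcoeff (F * 1) m = (\<Sum>(p, q)\<in>{(m, 0 :: 'v \<Rightarrow>\<^sub>0 nat)}. mcoeff F p * mcoeff 1 q)"
    unfolding times_mps.rep_eq
    by (rule sum.mono_neutral_right[OF finite_monomial_splits])
      (auto simp: one_mps.rep_eq split: if_splits)
  then show "mcoeff (F * 1) m = mcoeff F m" by (simp add: one_mps.rep_eq)
qed

lemma mps_distrib_left: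
  fixes F G H :: "('v, 'c::semiring_0) mps"
  shows "F * (G + H) = F * G + F * H"
  by (rule mps_eqI)
    (simp add: times_mps.rep_eq plus_mps.rep_eq distrib_left sum.distrib case_prod_unfold)

text \<open>Power series over a noncommutative ring form a ring. The type already has arities for
  commutative coefficients, and these have to be generalised class by class, superclasses
  first.\<close>

instance mps :: (type, ring_1) numeral ..

instance mps :: (type, ring_1) power ..

instance mps :: (type, ring_1) semigroup_mult
  by standard (rule mps_mult_assoc)

instance mps :: (type, ring_1) monoid_mult
  by standard (simp_all add: mps_mult_1_left mps_mult_1_right)

instance mps :: (type, ring_1) zero_neq_one
  by standard (transfer, metis zero_neq_one)

instance mps :: (type, ring_1) semiring
  by standard (simp_all add: mps_distrib_right mps_distrib_left)

instance mps :: (type, ring_1) mult_zero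
  by standard (rule mps_eqI; simp add: times_mps.rep_eq zero_mps.rep_eq)+

instance mps :: (type, ring_1) semiring_0 ..

instance mps :: (type, ring_1) semiring_1 ..

instance mps :: (type, ring_1) semiring_0_cancel ..

instance mps :: (type, ring_1) ring ..

instance mps :: (type, ring_1) neg_numeral ..

instance mps :: (type, ring_1) ring_1 ..

lemma mcoeff_Abs [simp]: "mcoeff (Abs_mps f) = f"
  by (simp add: Abs_mps_inverse)

lemma mcoeff_mult: "mcoeff (F * G) m = (\<Sum>(p, q)\<in>{(p, q). p + q = m}. mcoeff F p * mcoeff G q)"
  by (simp add: times_mps.rep_eq)

lemma keys_add_nat: "Poly_Mapping.keys (p + q) = Poly_Mapping.keys p \<union> Poly_Mapping.keys q"
  for p q :: "'v \<Rightarrow>\<^sub>0 nat"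
  by (auto simp: in_keys_iff lookup_add)

text \<open>Setting the variables outside \<open>V\<close> to zero is a ring homomorphism, and a series
  is determined by its images for finite \<open>V\<close>. This reduces infinite products to
  finite ones.\<close>

definition restrict_vars :: "'v set \<Rightarrow> ('v, 'c::zero) mps \<Rightarrow> ('v, 'c) mps" where
  "restrict_vars V F = Abs_mps (\<lambda>m. if Poly_Mapping.keys m \<subseteq> V then mcoeff F m else 0)"

lemma mcoeff_restrict_vars: "mcoeff (restrict_vars V F) m = (if Poly_Mapping.keys m \<subseteq> V then mcoeff F m else 0)"
  by (simp add: restrict_vars_def)

lemma restrict_vars_mult: "restrict_vars V (F * G) = restrict_vars V F * restrict_vars V G" for F G :: "('v, 'c::ring_1) mps"
proof (rule mps_eqI)
  fix m :: "'v \<Rightarrow>\<^sub>0 nat"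
  show "mcoeff (restrict_vars V (F * G)) m = mcoeff (restrict_vars V F * restrict_vars V G) m"
  proof (cases "Poly_Mapping.keys m \<subseteq> V")
    case True
    then show ?thesis unfolding mcoeff_mult mcoeff_restrict_vars
      by (auto simp: keys_add_nat intro!: sum.cong)
  next
    case False
    then show ?thesis unfolding mcoeff_mult mcoeff_restrict_vars
      by (auto simp: keys_add_nat intro!: sum.neutral)
  qed
qed

lemma restrict_vars_1 [simp]: "restrict_vars V 1 = (1 :: ('v, 'c::ring_1) mps)"
  by (rule mps_eqI) (auto simp: mcoeff_restrict_vars one_mps.rep_eq)

lemma restrict_vars_prod_list: "restrict_vars V (prod_list Fs) = prod_list (map (restrict_vars V) Fs)"
  for Fs :: "('v, 'c::ring_1) mps list"
  by (induction Fs) (simp_all add: restrict_vars_mult)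

lemma restrict_vars_prod: "restrict_vars V (prod f I) = (\<Prod>i\<in>I. restrict_vars V (f i))"
  for f :: "'i \<Rightarrow> ('v, 'c::comm_ring_1) mps"
  by (induction I rule: infinite_finite_induct) (simp_all add: restrict_vars_mult)

lemma mps_eq_restrict_varsI: "(\<And>V. finite V \<Longrightarrow> restrict_vars V F = restrict_vars V G) \<Longrightarrow> F = G"
proof (rule mps_eqI)
  fix m
  assume "\<And>V. finite V \<Longrightarrow> restrict_vars V F = restrict_vars V G"
  then have "mcoeff (restrict_vars (Poly_Mapping.keys m) F) m = mcoeff (restrict_vars (Poly_Mapping.keys m) G) m" by simp
  then show "mcoeff F m = mcoeff G m" by (simp add: mcoeff_restrict_vars)
qed

lemma mcoeff_univariate:
  "mcoeff (mps_univariate v c) m = (if Poly_Mapping.keys m \<subseteq> {v} then c (Poly_Mapping.lookup m v) else 0)"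
  by (simp add: mps_univariate_def)

lemma keys_subset_single: "Poly_Mapping.keys m \<subseteq> {v} \<Longrightarrow> m = Poly_Mapping.single v (Poly_Mapping.lookup m v)"
  by (rule poly_mapping_eqI) (auto simp: lookup_single when_def in_keys_iff)

lemma restrict_vars_univariate:
  fixes c :: "nat \<Rightarrow> 'c::ring_1" and v :: 'a
  assumes "c 0 = 1"
  shows "restrict_vars V (mps_univariate v c) = (if v \<in> V then mps_univariate v c else 1)"
proof (rule mps_eqI)
  fix m :: "'a \<Rightarrow>\<^sub>0 nat"
  have "m = 0" if "Poly_Mapping.keys (m :: 'a \<Rightarrow>\<^sub>0 nat) \<subseteq> V" "Poly_Mapping.keys m \<subseteq> {v}" "v \<notin> V"
  proof -
    have "Poly_Mapping.keys m = {}" using that by blast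
    then show ?thesis by simp
  qed
  then show "mcoeff (restrict_vars V (mps_univariate v c)) m = mcoeff (if v \<in> V then mps_univariate v c else 1) m"
    using assms by (auto simp: mcoeff_restrict_vars mcoeff_univariate one_mps.rep_eq)
qed

lemma univariate_mult_same:
  fixes f g :: "nat \<Rightarrow> 'c::ring_1"
  shows "mps_univariate v f * mps_univariate v g = mps_univariate v (\<lambda>n. \<Sum>k\<le>n. f k * g (n - k))"
proof (rule mps_eqI)
  fix m
  show "mcoeff (mps_univariate v f * mps_univariate v g) m =
      mcoeff (mps_univariate v (\<lambda>n. \<Sum>k\<le>n. f k * g (n - k))) m"
  proof (cases "Poly_Mapping.keys m \<subseteq> {v}")
    case True
    define n where "n = Poly_Mapping.lookup m v"
    have m: "m = Poly_Mapping.single v n" using keys_subset_single[OF True] by (simp add: n_def)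
    have "mcoeff (mps_univariate v f * mps_univariate v g) m =
        (\<Sum>(p, q)\<in>{(p, q). p + q = m}. f (Poly_Mapping.lookup p v) * g (Poly_Mapping.lookup q v))"
      unfolding mcoeff_mult using True
      by (intro sum.cong) (auto simp: mcoeff_univariate keys_add_nat)
    also have "\<dots> = (\<Sum>k\<le>n. f k * g (n - k))"
    proof (rule sum.reindex_bij_witness[where
        i = "\<lambda>k. (Poly_Mapping.single v k, Poly_Mapping.single v (n - k))" and
        j = "\<lambda>(p, q). Poly_Mapping.lookup p v"])
      fix a assume "a \<in> {(p, q). p + q = m}"
      then obtain p q where a: "a = (p, q)" "p + q = m" by auto
      have pq: "Poly_Mapping.keys p \<subseteq> {v}" "Poly_Mapping.keys q \<subseteq> {v}"
        using True a(2) by (auto simp: keys_add_nat)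
      have n: "Poly_Mapping.lookup p v + Poly_Mapping.lookup q v = n"
        using a(2) by (auto simp: n_def lookup_add)
      then have n': "n - Poly_Mapping.lookup p v = Poly_Mapping.lookup q v" by simp
      show "(\<lambda>k. (Poly_Mapping.single v k, Poly_Mapping.single v (n - k)))
          ((\<lambda>(p, q). Poly_Mapping.lookup p v) a) = a"
        using keys_subset_single[OF pq(1)] keys_subset_single[OF pq(2)] by (simp add: a n')
      show "(\<lambda>(p, q). Poly_Mapping.lookup p v) a \<in> {..n}" using n by (simp add: a)
      show "f ((\<lambda>(p, q). Poly_Mapping.lookup p v) a) * g (n - (\<lambda>(p, q). Poly_Mapping.lookup p v) a) =
          (\<lambda>(p, q). f (Poly_Mapping.lookup p v) * g (Poly_Mapping.lookup q v)) a"
        by (simp add: a n')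
    qed (auto simp: m single_add[symmetric])
    finally show ?thesis using True by (simp add: mcoeff_univariate n_def)
  next
    case False
    then have "mcoeff (mps_univariate v f * mps_univariate v g) m = 0"
      unfolding mcoeff_mult
      by (intro sum.neutral) (auto simp: mcoeff_univariate keys_add_nat)
    then show ?thesis using False by (simp add: mcoeff_univariate)
  qed
qed

lemma univariate_delta: "mps_univariate v (\<lambda>n. if n = 0 then 1 else 0) = (1 :: ('v, 'c::ring_1) mps)"
proof (rule mps_eqI)
  fix m
  show "mcoeff (mps_univariate v (\<lambda>n. if n = 0 then 1 else 0)) m = mcoeff (1 :: ('v, 'c) mps) m"
    using keys_subset_single[of m v] by (auto simp: mcoeff_univariate one_mps.rep_eq)
qed

lemma univariate_mult_distinct:
  fixes f g :: "nat \<Rightarrow> 'c::ring_1"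
  assumes "x \<noteq> y"
  shows "mcoeff (mps_univariate x f * mps_univariate y g) m =
    (if Poly_Mapping.keys m \<subseteq> {x, y} then f (Poly_Mapping.lookup m x) * g (Poly_Mapping.lookup m y) else 0)"
proof (cases "Poly_Mapping.keys m \<subseteq> {x, y}")
  case True
  let ?p = "Poly_Mapping.single x (Poly_Mapping.lookup m x)" and ?q = "Poly_Mapping.single y (Poly_Mapping.lookup m y)"
  have m: "?p + ?q = m"
    using True assms by (intro poly_mapping_eqI) (auto simp: lookup_add lookup_single when_def in_keys_iff)
  have "mcoeff (mps_univariate x f * mps_univariate y g) m =
      (\<Sum>(p, q)\<in>{(?p, ?q)}. mcoeff (mps_univariate x f) p * mcoeff (mps_univariate y g) q)"
    unfolding mcoeff_mult
  proof (rule sum.mono_neutral_right[OF finite_monomial_splits])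
    show "{(?p, ?q)} \<subseteq> {(p, q). p + q = m}" using m by simp
    show "\<forall>a\<in>{(p, q). p + q = m} - {(?p, ?q)}.
        (case a of (p, q) \<Rightarrow> mcoeff (mps_univariate x f) p * mcoeff (mps_univariate y g) q) = 0"
    proof
      fix a assume a: "a \<in> {(p, q). p + q = m} - {(?p, ?q)}"
      obtain p q where pq: "a = (p, q)" by (rule prod.exhaust)
      have sum: "p + q = m" using a pq by simp
      have False if "Poly_Mapping.keys p \<subseteq> {x}" "Poly_Mapping.keys q \<subseteq> {y}"
      proof -
        have p: "p = Poly_Mapping.single x (Poly_Mapping.lookup p x)"
          and q: "q = Poly_Mapping.single y (Poly_Mapping.lookup q y)"
          by (rule keys_subset_single[OF that(1)]) (rule keys_subset_single[OF that(2)])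
        have "x \<notin> Poly_Mapping.keys q" "y \<notin> Poly_Mapping.keys p" using that assms by blast+
        then have z: "Poly_Mapping.lookup q x = 0" "Poly_Mapping.lookup p y = 0"
          by (simp_all add: in_keys_iff)
        have e: "Poly_Mapping.lookup p x = Poly_Mapping.lookup m x"
          "Poly_Mapping.lookup q y = Poly_Mapping.lookup m y"
          unfolding sum[symmetric] lookup_add z by simp_all
        have "a = (?p, ?q)" using p q unfolding e pq by (rule arg_cong2)
        then show False using a by blast
      qed
      then show "(case a of (p, q) \<Rightarrow> mcoeff (mps_univariate x f) p * mcoeff (mps_univariate y g) q) = 0"
        by (auto simp: pq mcoeff_univariate)
    qed
  qed
  then show ?thesis using True by (simp add: mcoeff_univariate)
next
  case False
  then have "mcoeff (mps_univariate x f * mps_univariate y g) m = 0"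
    unfolding mcoeff_mult by (intro sum.neutral) (auto simp: mcoeff_univariate keys_add_nat)
  then show ?thesis using False by simp
qed

definition mps_monom :: "('v \<Rightarrow>\<^sub>0 nat) \<Rightarrow> 'c::zero \<Rightarrow> ('v, 'c) mps" where
  "mps_monom p c = Abs_mps (\<lambda>m. if m = p then c else 0)"

lemma mcoeff_monom: "mcoeff (mps_monom p c) m = (if m = p then c else 0)"
  by (simp add: mps_monom_def)

lemma mcoeff_monom_mult:
  fixes c :: "'c::ring_1"
  shows "mcoeff (mps_monom p c * F) m = (if \<exists>q. m = p + q then c * mcoeff F (m - p) else 0)"
proof (cases "\<exists>q. m = p + q")
  case True
  then obtain q where q: "m = p + q" by blast
  have "mcoeff (mps_monom p c * F) m = (\<Sum>(p', q')\<in>{(p, q)}. mcoeff (mps_monom p c) p' * mcoeff F q')"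
    unfolding mcoeff_mult
    by (rule sum.mono_neutral_right[OF finite_monomial_splits]) (auto simp: mcoeff_monom q split: if_splits)
  then show ?thesis by (simp add: mcoeff_monom q)
next
  case False
  then have "mcoeff (mps_monom p c * F) m = 0"
    unfolding mcoeff_mult by (intro sum.neutral) (auto simp: mcoeff_monom)
  then show ?thesis using False by simp
qed

lemma monom_mult: "mps_monom p c * mps_monom q d = mps_monom (p + q) (c * d)" for c :: "'c::ring_1"
  by (rule mps_eqI) (auto simp: mcoeff_monom_mult mcoeff_monom)

lemma t_xx_monom: "t_xx (a, b) = mps_monom (Poly_Mapping.single (Inl a) 1 + Poly_Mapping.single (Inr b) 1) t_laurent"
proof -
  have "mps_const t_laurent = mps_monom (0 :: ('a + 'b) \<Rightarrow>\<^sub>0 nat) t_laurent"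
    by (simp add: mps_const_def mps_monom_def)
  moreover have "mps_var v = mps_monom (Poly_Mapping.single v 1) (1 :: laurent)" for v :: "'a + 'b"
    by (simp add: mps_var_def mps_monom_def)
  ultimately show ?thesis by (simp add: t_xx_def monom_mult)
qed

lemma univariate_commutation:
  fixes f g :: "nat \<Rightarrow> 'c::ring_1" and x y :: 'v
  assumes "x \<noteq> y"
    and rel: "\<And>n m. f n * g m = g m * f n + (if n = 0 \<or> m = 0 then 0 else \<sigma> * (f (n - 1) * g (m - 1)))"
  shows "mps_univariate x f * mps_univariate y g = mps_univariate y g * mps_univariate x f +
    mps_monom (Poly_Mapping.single x 1 + Poly_Mapping.single y 1) \<sigma> * (mps_univariate x f * mps_univariate y g)"
    (is "?F * ?G = _ + mps_monom ?e \<sigma> * _")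
proof (rule mps_eqI)
  fix m :: "'v \<Rightarrow>\<^sub>0 nat"
  let ?n = "Poly_Mapping.lookup m x" and ?k = "Poly_Mapping.lookup m y"
  have le: "(\<exists>q. m = ?e + q) \<longleftrightarrow> ?n \<noteq> 0 \<and> ?k \<noteq> 0"
  proof
    assume "\<exists>q. m = ?e + q"
    then show "?n \<noteq> 0 \<and> ?k \<noteq> 0" by (auto simp: lookup_add)
  next
    assume *: "?n \<noteq> 0 \<and> ?k \<noteq> 0"
    have "m = ?e + (m - ?e)"
      using * assms(1) by (intro poly_mapping_eqI) (auto simp: lookup_add lookup_minus lookup_single when_def)
    then show "\<exists>q. m = ?e + q" ..
  qed
  have "mcoeff (mps_monom ?e \<sigma> * (?F * ?G)) m =
      (if Poly_Mapping.keys m \<subseteq> {x, y} then if ?n = 0 \<or> ?k = 0 then 0 else \<sigma> * (f (?n - 1) * g (?k - 1)) else 0)"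
  proof (cases "?n \<noteq> 0 \<and> ?k \<noteq> 0")
    case True
    then obtain q where q: "m = ?e + q" using le by blast
    have "Poly_Mapping.keys m \<subseteq> {x, y} \<longleftrightarrow> Poly_Mapping.keys q \<subseteq> {x, y}"
      unfolding q keys_add_nat by auto
    moreover have "Poly_Mapping.lookup q x = ?n - 1" "Poly_Mapping.lookup q y = ?k - 1"
      using assms(1) unfolding q by (simp_all add: lookup_add lookup_single)
    moreover have "m - ?e = q" by (simp add: q)
    ultimately show ?thesis
      using True le unfolding mcoeff_monom_mult univariate_mult_distinct[OF assms(1)] by auto
  next
    case False
    then show ?thesis using le unfolding mcoeff_monom_mult by auto
  qed
  then show "mcoeff (?F * ?G) m = mcoeff (?G * ?F + mps_monom ?e \<sigma> * (?F * ?G)) m"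
    using rel[of ?n ?k] assms(1)
    by (auto simp: plus_mps.rep_eq univariate_mult_distinct insert_commute)
qed

abbreviation hat :: "('v, laurent) mps \<Rightarrow> ('v, uhat) mps" where
  "hat \<equiv> mps_map hat_scalar"

lemma mcoeff_hat: "mcoeff (hat F) m = hat_scalar (mcoeff F m)"
  by (simp add: mps_map_def)

lemma hat_scalar_sum: "hat_scalar (sum f A) = (\<Sum>a\<in>A. hat_scalar (f a))"
  by (induction A rule: infinite_finite_induct) (simp_all add: hat_scalar_add hat_scalar_0)

lemma hat_scalar_uminus: "hat_scalar (- c) = - hat_scalar c"
  using hat_scalar_add[of c "- c"] by (simp add: hat_scalar_0 add_eq_0_iff)

lemma hat_mult: "hat (F * G) = hat F * hat G"
  by (rule mps_eqI)
    (simp add: mcoeff_hat mcoeff_mult hat_scalar_sum hat_scalar_mult case_prod_unfold)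

lemma hat_1 [simp]: "hat 1 = 1"
  by (rule mps_eqI) (simp add: mcoeff_hat one_mps.rep_eq hat_scalar_0 one_uhat_def)

lemma hat_add: "hat (F + G) = hat F + hat G"
  by (rule mps_eqI) (simp add: mcoeff_hat plus_mps.rep_eq hat_scalar_add)

lemma hat_uminus: "hat (- F) = - hat F"
  by (rule mps_eqI) (simp add: mcoeff_hat uminus_mps.rep_eq hat_scalar_uminus)

lemma hat_diff: "hat (F - G) = hat F - hat G"
  using hat_add[of F "- G"] by (simp add: hat_uminus)

lemma hat_central: "hat F * G = G * hat F"
proof (rule mps_eqI)
  fix m
  show "mcoeff (hat F * G) m = mcoeff (G * hat F) m"
    unfolding mcoeff_mult
    by (rule sum.reindex_bij_witness[where i = prod.swap and j = prod.swap])
      (auto simp: mcoeff_hat hat_scalar_central add.commute)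
qed

lemma hat_monom: "hat (mps_monom p c) = mps_monom p (hat_scalar c)"
  by (rule mps_eqI) (simp add: mcoeff_hat mcoeff_monom hat_scalar_0)

lemma restrict_vars_hat: "restrict_vars V (hat F) = hat (restrict_vars V F)"
  by (rule mps_eqI) (simp add: mcoeff_restrict_vars mcoeff_hat hat_scalar_0)

definition monomial_degree :: "('v \<Rightarrow>\<^sub>0 nat) \<Rightarrow> nat" where
  "monomial_degree m = (\<Sum>v\<in>Poly_Mapping.keys m. Poly_Mapping.lookup m v)"

lemma monomial_degree_add: "monomial_degree (p + q) = monomial_degree p + monomial_degree q"
proof -
  have *: "monomial_degree r = (\<Sum>v\<in>Poly_Mapping.keys (p + q). Poly_Mapping.lookup r v)"
    if "Poly_Mapping.keys r \<subseteq> Poly_Mapping.keys (p + q)" for r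
    unfolding monomial_degree_def using that by (intro sum.mono_neutral_left) (auto simp: in_keys_iff)
  show ?thesis using *[of p] *[of q] *[of "p + q"] by (simp add: keys_add_nat lookup_add sum.distrib)
qed

lemma monomial_degree_pos: "m \<noteq> 0 \<Longrightarrow> 0 < monomial_degree m"
proof -
  assume "m \<noteq> 0"
  then obtain v where v: "v \<in> Poly_Mapping.keys m" by fastforce
  then have "Poly_Mapping.lookup m v \<le> monomial_degree m" unfolding monomial_degree_def by (intro member_le_sum) auto
  moreover have "0 < Poly_Mapping.lookup m v" using v by (simp add: in_keys_iff)
  ultimately show ?thesis by simp
qed

lemma mcoeff_power_0:
  fixes H :: "('v, 'c::comm_ring_1) mps"
  assumes "mcoeff H 0 = 0" "monomial_degree m < n"
  shows "mcoeff (H ^ n) m = 0"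
  using assms(2)
proof (induction n arbitrary: m)
  case (Suc n)
  have "mcoeff H p * mcoeff (H ^ n) q = 0" if "p + q = m" for p q
  proof (cases "p = 0")
    case False
    then have "monomial_degree q < n" using monomial_degree_pos[of p] monomial_degree_add[of p q] that Suc.prems by simp
    then show ?thesis using Suc.IH by simp
  qed (simp add: assms(1))
  then show ?case by (auto simp: mcoeff_mult intro!: sum.neutral)
qed simp

lemma mcoeff_sum: "mcoeff (sum f A) m = (\<Sum>a\<in>A. mcoeff (f a) m)"
  by (induction A rule: infinite_finite_induct) (simp_all add: zero_mps.rep_eq plus_mps.rep_eq)

lemma mps_inverse_unique:
  fixes F :: "('v, 'c::comm_ring_1) mps"
  assumes "F * G = 1"
  shows "inverse F = G"
  unfolding inverse_mps_def
proof (rule the_equality)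
  show "F * G = 1" by (rule assms)
next
  fix G' assume "F * G' = 1"
  have "G' = (F * G) * G'" by (simp add: assms)
  also have "\<dots> = (F * G') * G" by (simp only: mult_ac)
  finally show "G' = G" by (simp add: \<open>F * G' = 1\<close>)
qed

text \<open>The inverse is the geometric series in \<open>1 - F\<close>. As \<open>1 - F\<close> has no
  constant term, a coefficient only sees the powers up to the degree of its monomial.\<close>

lemma mps_inverse:
  fixes F :: "('v, 'c::comm_ring_1) mps"
  assumes "mcoeff F 0 = 1"
  shows "F * inverse F = 1"
proof -
  define H where "H = 1 - F"
  have H0: "mcoeff H 0 = 0" by (simp add: H_def minus_mps.rep_eq one_mps.rep_eq assms)
  define S where "S N = (\<Sum>n<Suc N. H ^ n)" for N
  define G where "G = Abs_mps (\<lambda>m. mcoeff (S (monomial_degree m)) m)"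
  have G: "mcoeff G q = mcoeff (S N) q" if "monomial_degree q \<le> N" for q N
  proof -
    have "(\<Sum>n<Suc (monomial_degree q). mcoeff (H ^ n) q) = (\<Sum>n<Suc N. mcoeff (H ^ n) q)"
      using that by (intro sum.mono_neutral_left) (auto intro!: mcoeff_power_0[OF H0])
    then show ?thesis by (simp add: G_def S_def mcoeff_sum del: sum.lessThan_Suc)
  qed
  have "F * G = 1"
  proof (rule mps_eqI)
    fix m
    have "mcoeff (F * G) m = mcoeff (F * S (monomial_degree m)) m"
      unfolding mcoeff_mult
    proof (rule sum.cong)
      fix a assume "a \<in> {(p, q). p + q = m}"
      then obtain p q where "a = (p, q)" "p + q = m" by auto
      then show "(case a of (p, q) \<Rightarrow> mcoeff F p * mcoeff G q) =
          (case a of (p, q) \<Rightarrow> mcoeff F p * mcoeff (S (monomial_degree m)) q)"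
        using G[of q "monomial_degree m"] by (auto simp: monomial_degree_add)
    qed simp
    also have "F * S (monomial_degree m) = 1 - H ^ Suc (monomial_degree m)"
      unfolding S_def one_diff_power_eq by (simp add: H_def)
    also have "mcoeff (1 - H ^ Suc (monomial_degree m)) m = mcoeff 1 m"
      using mcoeff_power_0[OF H0, of m "Suc (monomial_degree m)"] by (simp add: minus_mps.rep_eq del: power_Suc)
    finally show "mcoeff (F * G) m = mcoeff 1 m" .
  qed
  then show ?thesis using mps_inverse_unique by metis
qed

lemma mcoeff_t_xx_0: "mcoeff (t_xx p) 0 = 0"
proof (cases p)
  case (Pair a b)
  have "(0 :: ('a + 'b) \<Rightarrow>\<^sub>0 nat) \<noteq> Poly_Mapping.single (Inl a) 1 + Poly_Mapping.single (Inr b) 1"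
  proof
    assume "(0 :: ('a + 'b) \<Rightarrow>\<^sub>0 nat) = Poly_Mapping.single (Inl a) 1 + Poly_Mapping.single (Inr b) 1"
    then have "Poly_Mapping.lookup (0 :: ('a + 'b) \<Rightarrow>\<^sub>0 nat) (Inl a) =
        Poly_Mapping.lookup (Poly_Mapping.single (Inl a) 1 + Poly_Mapping.single (Inr b) 1) (Inl a)" by simp
    then show False by (simp add: lookup_add)
  qed
  then show ?thesis by (simp add: Pair t_xx_monom mcoeff_monom)
qed

definition cauchy_factor :: "bool \<Rightarrow> 'a \<times> 'b \<Rightarrow> ('a + 'b, laurent) mps" where
  "cauchy_factor same p = (if same then inverse (1 - t_xx p) else 1 + t_xx p)"

lemma one_minus_t_xx: "(1 - t_xx p) * inverse (1 - t_xx p) = 1"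
  by (rule mps_inverse) (simp add: minus_mps.rep_eq one_mps.rep_eq mcoeff_t_xx_0)

lemma alternate_rel_left:
  fixes f g :: "nat \<Rightarrow> 'c::ring_1"
  assumes "\<And>n m. f n * g m = g m * f n + (if n = 0 \<or> m = 0 then 0 else \<sigma> * (f (n - 1) * g (m - 1)))"
  shows "alternate n (f n) * g m = g m * alternate n (f n) +
    (if n = 0 \<or> m = 0 then 0 else - \<sigma> * (alternate (n - 1) (f (n - 1)) * g (m - 1)))"
  using assms[of n m] by (cases n) (auto simp: alternate_def)

lemma alternate_rel_right:
  fixes f g :: "nat \<Rightarrow> 'c::ring_1"
  assumes "\<And>n m. f n * g m = g m * f n + (if n = 0 \<or> m = 0 then 0 else \<sigma> * (f (n - 1) * g (m - 1)))"
  shows "f n * alternate m (g m) = alternate m (g m) * f n +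
    (if n = 0 \<or> m = 0 then 0 else - \<sigma> * (f (n - 1) * alternate (m - 1) (g (m - 1))))"
  using assms[of n m] by (cases m) (auto simp: alternate_def)

text \<open>Commutation up to a central factor is inherited by inverses, with the factor on the other
  side.\<close>

lemma central_conj:
  fixes x x' y z :: "'r::ring_1"
  assumes "x * y * z = y * x" "x' * x = 1" "x * x' = 1" "\<And>w. z * w = w * z"
  shows "y * x' * z = x' * y"
proof -
  have "y * x' * z = (x' * x) * y * (z * x')" by (simp add: assms(2) assms(4)[of x'] mult.assoc)
  also have "\<dots> = x' * (x * y * z) * x'" by (simp only: mult.assoc)
  also have "\<dots> = x' * y * (x * x')" unfolding assms(1) by (simp only: mult.assoc)
  finally show ?thesis by (simp add: assms(3))
qed

lemma central_conj':
  fixes x y y' z :: "'r::ring_1"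
  assumes "x * y * z = y * x" "y' * y = 1" "y * y' = 1" "\<And>w. z * w = w * z"
  shows "y' * x * z = x * y'"
proof -
  have "y' * x * z = y' * x * (y * y') * z" by (simp add: assms(3))
  also have "\<dots> = y' * (x * y * z) * y'" by (simp add: assms(4)[of y'] mult.assoc)
  also have "\<dots> = (y' * y) * x * y'" unfolding assms(1) by (simp only: mult.assoc)
  finally show ?thesis by (simp add: assms(2))
qed

text \<open>The coefficients \<open>alternate n (f n)\<close> belong to the series in \<open>-x\<close>,
  whose inverse is the series of the other parity. A sign change turns \<open>1 - t x
  y\<close> into \<open>1 + t x y\<close>, and each inversion moves the factor to the other
  side.\<close>

lemma pair_commutation:
  fixes a :: 'a and b :: 'b
  shows "mps_univariate (Inl a) (Q_var \<delta>) * mps_univariate (Inr b) (P_var \<epsilon>) =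
    mps_univariate (Inr b) (P_var \<epsilon>) * mps_univariate (Inl a) (Q_var \<delta>) * hat (cauchy_factor (\<delta> = \<epsilon>) (a, b))"
proof -
  let ?x = "Inl a :: 'a + 'b" and ?y = "Inr b :: 'a + 'b"
  let ?T = "t_xx (a, b)" and ?\<tau> = "hat_scalar t_laurent"
  define q0 q1 q1' where "q0 = mps_univariate ?x (Q_var 0)" and "q1 = mps_univariate ?x (Q_var 1)"
    and "q1' = mps_univariate ?x (\<lambda>n. alternate n (Q_var 1 n))"
  define p0 p1 p1' where "p0 = mps_univariate ?y (P_var 0)" and "p1 = mps_univariate ?y (P_var 1)"
    and "p1' = mps_univariate ?y (\<lambda>n. alternate n (P_var 1 n))"
  have inv: "q0 * q1' = 1" "q1' * q0 = 1" "p0 * p1' = 1" "p1' * p0 = 1"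
    unfolding q0_def q1'_def p0_def p1'_def univariate_mult_same Q_inverse P_inverse univariate_delta
    by (rule refl)+
  have mono: "mps_monom (Poly_Mapping.single ?x 1 + Poly_Mapping.single ?y 1) ?\<tau> = hat ?T"
    "mps_monom (Poly_Mapping.single ?x 1 + Poly_Mapping.single ?y 1) (- ?\<tau>) = - hat ?T"
  proof -
    show 1: "mps_monom (Poly_Mapping.single ?x 1 + Poly_Mapping.single ?y 1) ?\<tau> = hat ?T"
      by (simp add: t_xx_monom hat_monom)
    show "mps_monom (Poly_Mapping.single ?x 1 + Poly_Mapping.single ?y 1) (- ?\<tau>) = - hat ?T"
      unfolding 1[symmetric] by (rule mps_eqI) (simp add: mcoeff_monom uminus_mps.rep_eq)
  qed
  have e: "F * G * hat (1 - s) = G * F" if "F * G = G * F + hat s * (F * G)"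
    for F G :: "('a + 'b, uhat) mps" and s
  proof -
    have "F * G * hat (1 - s) = F * G - F * G * hat s" by (simp add: hat_diff right_diff_distrib)
    also have "\<dots> = F * G - hat s * (F * G)" by (simp add: hat_central)
    also have "\<dots> = G * F" using that by (metis add_diff_cancel_right')
    finally show ?thesis .
  qed
  have xy: "?x \<noteq> ?y" by simp
  have r11: "q1 * p1 * hat (1 - ?T) = p1 * q1"
    unfolding q1_def p1_def
    using univariate_commutation[OF xy Q1_P1_rec] by (intro e) (simp only: mono)
  have r1'1: "q1' * p1 * hat (1 - (- ?T)) = p1 * q1'"
    unfolding q1'_def p1_def
    using univariate_commutation[OF xy alternate_rel_left[OF Q1_P1_rec]]
    by (intro e) (simp only: mono hat_uminus)
  have r11': "q1 * p1' * hat (1 - (- ?T)) = p1' * q1"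
    unfolding q1_def p1'_def
    using univariate_commutation[OF xy alternate_rel_right[OF Q1_P1_rec]]
    by (intro e) (simp only: mono hat_uminus)
  have r1'1': "q1' * p1' * hat (1 - ?T) = p1' * q1'"
    unfolding q1'_def p1'_def
    using univariate_commutation[OF xy alternate_rel_left[OF alternate_rel_right[OF Q1_P1_rec]]]
    by (intro e) (simp only: mono minus_minus)
  have z: "hat (1 - ?T) * hat (cauchy_factor True (a, b)) = 1"
    by (simp add: hat_mult[symmetric] cauchy_factor_def one_minus_t_xx)
  have fin: "F * G = G * F * hat (cauchy_factor True (a, b))" if "F * G * hat (1 - ?T) = G * F"
    for F G :: "('a + 'b, uhat) mps"
  proof -
    have "F * G = (F * G * hat (1 - ?T)) * hat (cauchy_factor True (a, b))" by (simp only: mult.assoc z mult_1_right)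
    then show ?thesis by (simp only: that)
  qed
  have s01: "q0 * p1 = p1 * q0 * hat (cauchy_factor False (a, b))"
    using central_conj[OF r1'1 inv(1,2) hat_central] by (simp add: cauchy_factor_def)
  have s10: "q1 * p0 = p0 * q1 * hat (cauchy_factor False (a, b))"
    using central_conj'[OF r11' inv(3,4) hat_central] by (simp add: cauchy_factor_def)
  have "p1' * q0 * hat (1 - ?T) = q0 * p1'" by (rule central_conj[OF r1'1' inv(1,2) hat_central])
  from central_conj[OF this inv(3,4) hat_central] have "q0 * p0 * hat (1 - ?T) = p0 * q0" .
  then have s00: "q0 * p0 = p0 * q0 * hat (cauchy_factor True (a, b))" by (rule fin)
  have s11: "q1 * p1 = p1 * q1 * hat (cauchy_factor True (a, b))" by (rule fin[OF r11])
  consider "\<delta> = 0" "\<epsilon> = 0" | "\<delta> = 0" "\<epsilon> = 1" | "\<delta> = 1" "\<epsilon> = 0" | "\<delta> = 1" "\<epsilon> = 1"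
    by (cases \<delta>; cases \<epsilon>) auto
  then show ?thesis
    using s00 s01 s10 s11 unfolding q0_def q1_def p0_def p1_def by cases simp_all
qed

lemma list_commutation1:
  assumes "\<And>b. q * p b = p b * q * hat (z b)"
  shows "q * prod_list (map p ys) = prod_list (map p ys) * q * hat (prod_list (map z ys))"
proof (induction ys)
  case (Cons b ys)
  let ?P = "prod_list (map p ys)" and ?Z = "prod_list (map z ys)"
  have "q * prod_list (map p (b # ys)) = (q * p b) * ?P" by (simp add: mult.assoc)
  also have "\<dots> = p b * (q * ?P) * hat (z b)"
    unfolding assms by (simp only: mult.assoc hat_central[of "z b" ?P])
  also have "\<dots> = p b * ?P * q * hat (?Z * z b)"
    unfolding Cons.IH by (simp only: hat_mult mult.assoc)
  finally show ?case by (simp add: mult.commute)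
qed simp

lemma list_commutation:
  assumes "\<And>a b. q a * p b = p b * q a * hat (z a b)"
  shows "prod_list (map q xs) * prod_list (map p ys) =
    prod_list (map p ys) * prod_list (map q xs) * hat (prod_list (map (\<lambda>a. prod_list (map (z a) ys)) xs))"
proof (induction xs)
  case (Cons a xs)
  let ?P = "prod_list (map p ys)" and ?Q = "prod_list (map q xs)"
  let ?Z = "prod_list (map (\<lambda>a. prod_list (map (z a) ys)) xs)" and ?za = "prod_list (map (z a) ys)"
  have "prod_list (map q (a # xs)) * ?P = q a * (?Q * ?P)" by (simp add: mult.assoc)
  also have "\<dots> = (q a * ?P) * ?Q * hat ?Z" unfolding Cons.IH by (simp only: mult.assoc)
  also have "\<dots> = ?P * q a * hat ?za * ?Q * hat ?Z"
    unfolding list_commutation1[of "q a" p "z a", OF assms] ..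
  also have "\<dots> = ?P * q a * ?Q * (hat ?za * hat ?Z)"
    by (simp only: mult.assoc hat_central[of ?za "?Q * hat ?Z"] hat_central[of ?za "hat ?Z"])
  finally show ?case by (simp add: hat_mult mult.assoc)
qed simp

lemma sorted_list_filter:
  fixes J :: "'i::linorder set"
  assumes "finite J" "I \<subseteq> J"
  shows "filter (\<lambda>i. i \<in> I) (sorted_list_of_set J) = sorted_list_of_set I"
proof (rule strict_sorted_equal)
  have "finite I" using assms finite_subset by blast
  then show "set (filter (\<lambda>i. i \<in> I) (sorted_list_of_set J)) = set (sorted_list_of_set I)"
    using assms by auto
qed (auto intro: sorted_wrt_filter)

lemma foldr_prod_list: "foldr (\<lambda>i F. f i * F) xs 1 = prod_list (map f xs)" for f :: "'i \<Rightarrow> 'r::monoid_mult"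
  by (induction xs) auto

lemma prod_list_filter:
  "(\<And>i. i \<in> set xs \<Longrightarrow> \<not> P i \<Longrightarrow> f i = 1) \<Longrightarrow> prod_list (map f xs) = prod_list (map f (filter P xs))"
  for f :: "'i \<Rightarrow> 'r::monoid_mult"
  by (induction xs) auto

text \<open>All finite index sets that contain \<open>I0\<close> give the same product once the other
  variables are set to zero, so the limit defining an infinite product is attained at
  \<open>I0\<close>.\<close>

lemma restrict_vars_stable:
  fixes X :: "'i set \<Rightarrow> ('v, 'c::zero) mps"
  assumes "finite I0" "I0 \<subseteq> I"
    and "\<And>J. finite J \<Longrightarrow> I0 \<subseteq> J \<Longrightarrow> J \<subseteq> I \<Longrightarrow> restrict_vars V (X J) = Y"
  shows "restrict_vars V (Abs_mps (\<lambda>m. stable_value (finite_subsets_at_top I) (\<lambda>J. mcoeff (X J) m))) = Y"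
proof (rule mps_eqI)
  fix m
  show "mcoeff (restrict_vars V (Abs_mps (\<lambda>m. stable_value (finite_subsets_at_top I) (\<lambda>J. mcoeff (X J) m)))) m = mcoeff Y m"
  proof (cases "Poly_Mapping.keys m \<subseteq> V")
    case True
    have "mcoeff (X J) m = mcoeff Y m" if "finite J" "I0 \<subseteq> J" "J \<subseteq> I" for J
      using arg_cong[OF assms(3)[OF that], of "\<lambda>F. mcoeff F m"] True by (simp add: mcoeff_restrict_vars)
    then have "eventually (\<lambda>J. mcoeff (X J) m = mcoeff Y m) (finite_subsets_at_top I)"
      unfolding eventually_finite_subsets_at_top using assms(1,2) by blast
    then have "stable_value (finite_subsets_at_top I) (\<lambda>J. mcoeff (X J) m) = mcoeff Y m"
      by (rule stable_value_eq) simp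
    then show ?thesis using True by (simp add: mcoeff_restrict_vars)
  next
    case False
    have "mcoeff (restrict_vars V (X I0)) m = mcoeff Y m" using assms by simp
    then show ?thesis using False by (simp add: mcoeff_restrict_vars)
  qed
qed

lemma restrict_vars_ordered_prod:
  fixes f :: "'i::linorder \<Rightarrow> ('v, 'c::ring_1) mps"
  assumes "finite I0" "I0 \<subseteq> I" and "\<And>i. i \<in> I0 \<Longrightarrow> restrict_vars V (f i) = f i"
    and "\<And>i. i \<in> I - I0 \<Longrightarrow> restrict_vars V (f i) = 1"
  shows "restrict_vars V (mps_ordered_prod I f) = prod_list (map f (sorted_list_of_set I0))"
  unfolding mps_ordered_prod_def
proof (rule restrict_vars_stable[OF assms(1,2)])
  fix J assume J: "finite J" "I0 \<subseteq> J" "J \<subseteq> I"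
  have "restrict_vars V (foldr (\<lambda>i F. f i * F) (sorted_list_of_set J) 1) =
      prod_list (map (\<lambda>i. restrict_vars V (f i)) (sorted_list_of_set J))"
    by (simp add: foldr_prod_list restrict_vars_prod_list o_def)
  also have "\<dots> = prod_list (map (\<lambda>i. restrict_vars V (f i)) (filter (\<lambda>i. i \<in> I0) (sorted_list_of_set J)))"
    using J assms(4) by (intro prod_list_filter) auto
  also have "\<dots> = prod_list (map (\<lambda>i. restrict_vars V (f i)) (sorted_list_of_set I0))"
    by (simp add: sorted_list_filter[OF J(1,2)])
  also have "\<dots> = prod_list (map f (sorted_list_of_set I0))"
    using assms(1,3) by (intro arg_cong[where f = prod_list] map_cong) auto
  finally show "restrict_vars V (foldr (\<lambda>i F. f i * F) (sorted_list_of_set J) 1) =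
      prod_list (map f (sorted_list_of_set I0))" .
qed

lemma restrict_vars_mps_prod:
  fixes f :: "'i \<Rightarrow> ('v, 'c::comm_ring_1) mps"
  assumes "finite I0" "I0 \<subseteq> I" and "\<And>i. i \<in> I0 \<Longrightarrow> restrict_vars V (f i) = f i"
    and "\<And>i. i \<in> I - I0 \<Longrightarrow> restrict_vars V (f i) = 1"
  shows "restrict_vars V (mps_prod I f) = prod f I0"
  unfolding mps_prod_def
proof (rule restrict_vars_stable[OF assms(1,2)])
  fix J assume J: "finite J" "I0 \<subseteq> J" "J \<subseteq> I"
  have "restrict_vars V (prod f J) = (\<Prod>i\<in>J. restrict_vars V (f i))" by (rule restrict_vars_prod)
  also have "\<dots> = (\<Prod>i\<in>I0. restrict_vars V (f i))"
    using J assms(4) by (intro prod.mono_neutral_right) auto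
  also have "\<dots> = prod f I0" using assms(3) by (intro prod.cong) auto
  finally show "restrict_vars V (prod f J) = prod f I0" .
qed

lemma Q_var_0: "Q_var \<epsilon> 0 = 1" and P_var_0: "P_var \<epsilon> 0 = 1"
proof -
  have e: "elementary xs 0 = 1" for xs by (induction xs) (simp_all add: elementary_Nil elementary_Cons)
  have 1: "Q_var 1 0 = 1" "P_var 1 0 = 1"
    using converges_unique[OF converges_Q1[of 0]] converges_unique[OF converges_P1[of 0]] converges_1 by (simp_all add: e)
  moreover have "Q_var 0 0 = 1" "P_var 0 0 = 1"
    using Q_inverse(1)[of 0] P_inverse(1)[of 0] 1 by (simp_all add: alternate_def)
  ultimately show "Q_var \<epsilon> 0 = 1" "P_var \<epsilon> 0 = 1" by (cases \<epsilon>; simp)+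
qed

lemma restrict_vars_monom: "restrict_vars V (mps_monom p c) = (if Poly_Mapping.keys p \<subseteq> V then mps_monom p c else 0)"
  by (rule mps_eqI) (auto simp: mcoeff_restrict_vars mcoeff_monom zero_mps.rep_eq)

lemma restrict_vars_t_xx: "restrict_vars V (t_xx (a, b)) = (if Inl a \<in> V \<and> Inr b \<in> V then t_xx (a, b) else 0)"
  by (simp add: t_xx_monom restrict_vars_monom keys_add_nat)

lemma restrict_vars_add: "restrict_vars V (F + G) = restrict_vars V F + restrict_vars V G" for F G :: "('v, 'c::ring_1) mps"
  by (rule mps_eqI) (simp add: mcoeff_restrict_vars plus_mps.rep_eq)

lemma restrict_vars_diff: "restrict_vars V (F - G) = restrict_vars V F - restrict_vars V G" for F G :: "('v, 'c::ring_1) mps"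
  by (rule mps_eqI) (simp add: mcoeff_restrict_vars minus_mps.rep_eq)

lemma mcoeff_prod_0:
  fixes f :: "'i \<Rightarrow> ('v, 'c::comm_ring_1) mps"
  assumes "\<And>i. i \<in> I \<Longrightarrow> mcoeff (f i) 0 = 1"
  shows "mcoeff (prod f I) 0 = 1"
proof -
  have "restrict_vars {} F = 1" if "mcoeff F 0 = 1" for F :: "('v, 'c) mps"
    using that by (intro mps_eqI) (auto simp: mcoeff_restrict_vars one_mps.rep_eq)
  then have "restrict_vars {} (prod f I) = 1" using assms by (simp add: restrict_vars_prod)
  then have "mcoeff (restrict_vars {} (prod f I)) 0 = mcoeff (1 :: ('v, 'c) mps) 0" by simp
  then show ?thesis by (simp add: mcoeff_restrict_vars one_mps.rep_eq)
qed

theorem corollary5p2: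
  fixes A :: "'a::linorder set" and B :: "'b::linorder set"
    and degA :: "'a \<Rightarrow> bit" and degB :: "'b \<Rightarrow> bit"
  assumes "countable A" and "countable B"
  shows "(cauchy_Q A degA :: ('a + 'b, uhat) mps) * cauchy_P B degB =
    cauchy_P B degB * cauchy_Q A degA *
    mps_map hat_scalar
      (mps_prod {(a, b). a \<in> A \<and> b \<in> B \<and> degA a \<noteq> degB b} (\<lambda>p. 1 + t_xx p) /
       mps_prod {(a, b). a \<in> A \<and> b \<in> B \<and> degA a = degB b} (\<lambda>p. 1 - t_xx p))"
proof (rule mps_eq_restrict_varsI)
  fix V :: "('a + 'b) set"
  assume V: "finite V"
  define A0 B0 where "A0 = {a \<in> A. Inl a \<in> V}" and "B0 = {b \<in> B. Inr b \<in> V}"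
  have fin: "finite A0" "finite B0"
  proof -
    have "Inl ` A0 \<subseteq> V" "Inr ` B0 \<subseteq> V" by (auto simp: A0_def B0_def)
    then have "finite (Inl ` A0 :: ('a + 'b) set)" "finite (Inr ` B0 :: ('a + 'b) set)"
      using V by (blast intro: finite_subset)+
    then show "finite A0" "finite B0" by (simp_all add: finite_image_iff)
  qed
  define xs ys where "xs = sorted_list_of_set A0" and "ys = sorted_list_of_set B0"
  define q where "q a = mps_univariate (Inl a :: 'a + 'b) (Q_var (degA a))" for a
  define p where "p b = mps_univariate (Inr b :: 'a + 'b) (P_var (degB b))" for b
  define z where "z a b = cauchy_factor (degA a = degB b) (a, b)" for a b
  let ?D = "{(a, b). a \<in> A \<and> b \<in> B \<and> degA a \<noteq> degB b}"
  let ?E = "{(a, b). a \<in> A \<and> b \<in> B \<and> degA a = degB b}"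
  let ?Dfin = "{(a, b). a \<in> A0 \<and> b \<in> B0 \<and> degA a \<noteq> degB b}"
  let ?Efin = "{(a, b). a \<in> A0 \<and> b \<in> B0 \<and> degA a = degB b}"
  have fDE: "finite ?Dfin" "finite ?Efin"
    by (rule finite_subset[OF _ finite_cartesian_product[OF fin]]; auto)+
  have Q: "restrict_vars V (cauchy_Q A degA) = prod_list (map q xs)"
    unfolding cauchy_Q_def xs_def q_def
    by (rule restrict_vars_ordered_prod[OF fin(1)]) (auto simp: A0_def restrict_vars_univariate Q_var_0)
  have P: "restrict_vars V (cauchy_P B degB) = prod_list (map p ys)"
    unfolding cauchy_P_def ys_def p_def
    by (rule restrict_vars_ordered_prod[OF fin(2)]) (auto simp: B0_def restrict_vars_univariate P_var_0)
  have N: "restrict_vars V (mps_prod ?D (\<lambda>p. 1 + t_xx p)) = (\<Prod>i\<in>?Dfin. 1 + t_xx i)"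
    by (rule restrict_vars_mps_prod[OF fDE(1)]) (auto simp: A0_def B0_def restrict_vars_add restrict_vars_t_xx split: if_splits)
  have E: "restrict_vars V (mps_prod ?E (\<lambda>p. 1 - t_xx p)) = (\<Prod>i\<in>?Efin. 1 - t_xx i)"
    by (rule restrict_vars_mps_prod[OF fDE(2)]) (auto simp: A0_def B0_def restrict_vars_diff restrict_vars_t_xx split: if_splits)
  have "mcoeff (mps_prod ?E (\<lambda>p. 1 - t_xx p)) 0 = 1"
  proof -
    have "mcoeff (restrict_vars V (mps_prod ?E (\<lambda>p. 1 - t_xx p))) 0 = 1"
      unfolding E by (rule mcoeff_prod_0) (simp add: minus_mps.rep_eq one_mps.rep_eq mcoeff_t_xx_0)
    then show ?thesis by (simp add: mcoeff_restrict_vars)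
  qed
  then have "mps_prod ?E (\<lambda>p. 1 - t_xx p) * inverse (mps_prod ?E (\<lambda>p. 1 - t_xx p)) = 1"
    by (rule mps_inverse)
  then have "(\<Prod>i\<in>?Efin. 1 - t_xx i) * restrict_vars V (inverse (mps_prod ?E (\<lambda>p. 1 - t_xx p))) = 1"
    unfolding E[symmetric] restrict_vars_mult[symmetric] by simp
  then have "restrict_vars V (inverse (mps_prod ?E (\<lambda>p. 1 - t_xx p))) = inverse (\<Prod>i\<in>?Efin. 1 - t_xx i)"
    by (rule mps_inverse_unique[symmetric])
  also have "\<dots> = (\<Prod>i\<in>?Efin. inverse (1 - t_xx i))"
    by (rule mps_inverse_unique) (simp add: one_minus_t_xx flip: prod.distrib)
  finally have I: "restrict_vars V (inverse (mps_prod ?E (\<lambda>p. 1 - t_xx p))) = (\<Prod>i\<in>?Efin. inverse (1 - t_xx i))" .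
  have "prod_list (map (\<lambda>a. prod_list (map (z a) ys)) xs) = (\<Prod>a\<in>A0. \<Prod>b\<in>B0. z a b)"
    by (simp add: xs_def ys_def fin prod.distinct_set_conv_list[symmetric])
  also have "\<dots> = (\<Prod>i\<in>A0 \<times> B0. cauchy_factor (degA (fst i) = degB (snd i)) i)"
    by (simp add: prod.cartesian_product z_def case_prod_unfold)
  also have "A0 \<times> B0 = ?Dfin \<union> ?Efin" by auto
  also have "(\<Prod>i\<in>?Dfin \<union> ?Efin. cauchy_factor (degA (fst i) = degB (snd i)) i) =
      (\<Prod>i\<in>?Dfin. cauchy_factor (degA (fst i) = degB (snd i)) i) * (\<Prod>i\<in>?Efin. cauchy_factor (degA (fst i) = degB (snd i)) i)"
    by (rule prod.union_disjoint[OF fDE]) auto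
  also have "(\<Prod>i\<in>?Dfin. cauchy_factor (degA (fst i) = degB (snd i)) i) = (\<Prod>i\<in>?Dfin. 1 + t_xx i)"
    by (rule prod.cong) (auto simp: cauchy_factor_def)
  also have "(\<Prod>i\<in>?Efin. cauchy_factor (degA (fst i) = degB (snd i)) i) = (\<Prod>i\<in>?Efin. inverse (1 - t_xx i))"
    by (rule prod.cong) (auto simp: cauchy_factor_def)
  finally have "restrict_vars V (mps_prod ?D (\<lambda>p. 1 + t_xx p) / mps_prod ?E (\<lambda>p. 1 - t_xx p)) =
      prod_list (map (\<lambda>a. prod_list (map (z a) ys)) xs)"
    by (simp only: divide_mps_def restrict_vars_mult N I)
  then have "restrict_vars V (hat (mps_prod ?D (\<lambda>p. 1 + t_xx p) / mps_prod ?E (\<lambda>p. 1 - t_xx p))) =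
      hat (prod_list (map (\<lambda>a. prod_list (map (z a) ys)) xs))"
    by (simp only: restrict_vars_hat)
  moreover have "prod_list (map q xs) * prod_list (map p ys) =
      prod_list (map p ys) * prod_list (map q xs) * hat (prod_list (map (\<lambda>a. prod_list (map (z a) ys)) xs))"
    by (rule list_commutation) (simp only: q_def p_def z_def pair_commutation)
  ultimately show "restrict_vars V (cauchy_Q A degA * cauchy_P B degB) =
    restrict_vars V (cauchy_P B degB * cauchy_Q A degA *
      hat (mps_prod ?D (\<lambda>p. 1 + t_xx p) / mps_prod ?E (\<lambda>p. 1 - t_xx p)))"
    by (simp only: restrict_vars_mult Q P)
qed

end
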